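(* The tensor space $V^{\otimes n}$ is a faithful $\mathcal{E}_n(u)$-module.
   Context: Let $u$ be an indeterminate, $\mathcal{A}=\mathbb{C}[u,u^{-1}]$ and $K=\mathbb{C}(u)$. $\mathcal{E}^{\mathcal{A}}_n(u)$ is the associative unital $\mathcal{A}$-algebra on generators $T_1,\dots,T_{n-1}$, $E_1,\dots,E_{n-1}$ with relations: (E1) $T_iT_j=T_jT_i$ if $|i-j|>1$; (E2) $E_iE_j=E_jE_i$ for all $i,j$; (E3) $E_iT_j=T_jE_i$ if $|i-j|>1$; (E4) $E_i^2=E_i$; (E5) $E_iT_i=T_iE_i$; (E6) $T_iT_jT_i=T_jT_iT_j$ if $|i-j|=1$; (E7) $E_jT_iT_j=T_iT_jE_i$ if $|i-j|=1$; (E8) $E_iE_jT_j=E_iT_jE_i=T_jE_iE_j$ if $|i-j|=1$; (E9) $T_i^2=1+(u-1)E_i(1+T_i)$. Put $\mathcal{E}_n(u)=\mathcal{E}^{\mathcal{A}}_n(u)\otimes_{\mathcal{A}}K$. Tensor space: $V$ is the $K$-vector space with basis $\{v_i^j \mid i,j=1,\dots,n\}$ ($i$ is the lower index, $j$ the upper index, not a power). Define $E,T\in\operatorname{End}_K(V^{\otimes 2})$ by $E(v_{i_1}^{j_1}\otimes v_{i_2}^{j_2})=v_{i_1}^{j_1}\otimes v_{i_2}^{j_2}$ if $j_1=j_2$, and $0$ otherwise; and $T(v_{i_1}^{j_1}\otimes v_{i_2}^{j_2})=$ - $v_{i_2}^{j_2}\otimes v_{i_1}^{j_1}$ if $j_1\ne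 j_2$; - $u\,v_{i_2}^{j_1}\otimes v_{i_1}^{j_2}$ if $j_1=j_2$, $i_1=i_2$; - $v_{i_2}^{j_2}\otimes v_{i_1}^{j_1}$ if $j_1=j_2$, $i_1<i_2$; - $u\,v_{i_2}^{j_2}\otimes v_{i_1}^{j_1}+(u-1)\,v_{i_1}^{j_1}\otimes v_{i_2}^{j_2}$ if $j_1=j_2$, $i_1>i_2$. The generators $E_i,T_i$ of $\mathcal{E}_n(u)$ act on $V^{\otimes n}$ by letting $E$, respectively $T$, act in the tensor factors $(i,i+1)$ and the identity elsewhere; this makes $V^{\otimes n}$ an $\mathcal{E}_n(u)$-module. *)

theory Defs
  imports
    "HOL-Library.Poly_Mapping"
    "HOL-Computational_Algebra.Fraction_Field"
    "HOL-Computational_Algebra.Polynomial"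
    "HOL-Algebra.Algebra"
    "HOL-Algebra.Algebraic_Closure_Type"
begin

text \<open>Laurent polynomials are the finitely supported functions on the exponents, multiplied by
  convolution.\<close>

type_synonym laurent = "int \<Rightarrow>\<^sub>0 complex"

definition u_laurent :: laurent where
  "u_laurent = Poly_Mapping.single 1 1"

type_synonym ratfun = "complex poly fract"

definition u_ratfun :: ratfun where
  "u_ratfun = Fract [:0, 1:] 1"

definition laurent_to_ratfun :: "laurent \<Rightarrow> ratfun" where
  "laurent_to_ratfun a =
     (\<Sum>k\<in>Poly_Mapping.keys a. Fract [:Poly_Mapping.lookup a k:] 1 * u_ratfun powi k)"

text \<open>The ring of finite formal linear combinations of elements of \<open>carrier M\<close>. For the monoid of
  words it is the free associative algebra.\<close>

definition monoid_ring :: "('m, 's) monoid_scheme \<Rightarrow> ('m \<Rightarrow>\<^sub>0 'r::comm_ring_1) ring" where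
  "monoid_ring M =
     \<lparr>carrier = {f. Poly_Mapping.keys f \<subseteq> carrier M},
      monoid.mult = (\<lambda>f g. \<Sum>x\<in>Poly_Mapping.keys f. \<Sum>y\<in>Poly_Mapping.keys g.
                Poly_Mapping.single (x \<otimes>\<^bsub>M\<^esub> y)
                  (Poly_Mapping.lookup f x * Poly_Mapping.lookup g y)),
      monoid.one = Poly_Mapping.single \<one>\<^bsub>M\<^esub> 1,
      ring.zero = 0,
      ring.add = (+)\<rparr>"

definition word_monoid :: "'g set \<Rightarrow> 'g list monoid" where
  "word_monoid G = \<lparr>carrier = lists G, monoid.mult = (@), monoid.one = []\<rparr>"

text \<open>The tensor product over the commutative ring \<open>'a\<close> of two \<open>'a\<close>-algebras, given as rings
  \<open>B\<close> and \<open>C\<close> with structure maps \<open>f\<close> and \<open>g\<close> into their centres: the free abelian group on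
  \<open>carrier B \<times> carrier C\<close> modulo the subgroup generated by the bilinearity relations. The
  multiplication of \<open>monoid_ring (B \<times>\<times> C)\<close> sends \<open>(b, c)\<close>, \<open>(b', c')\<close> to \<open>(b b', c c')\<close>, so that
  of the quotient is the usual one on pure tensors.\<close>

inductive_set tensor_relations ::
  "('a \<Rightarrow> 'b) \<Rightarrow> ('b, 's) ring_scheme \<Rightarrow> ('a \<Rightarrow> 'c) \<Rightarrow> ('c, 't) ring_scheme \<Rightarrow> ('b \<times> 'c \<Rightarrow>\<^sub>0 int) set"
  for f B g C
  where
    add_left: "\<lbrakk>b \<in> carrier B; b' \<in> carrier B; c \<in> carrier C\<rbrakk> \<Longrightarrow>
      Poly_Mapping.single (b \<oplus>\<^bsub>B\<^esub> b', c) 1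
        - Poly_Mapping.single (b, c) 1 - Poly_Mapping.single (b', c) 1
      \<in> tensor_relations f B g C"
  | add_right: "\<lbrakk>b \<in> carrier B; c \<in> carrier C; c' \<in> carrier C\<rbrakk> \<Longrightarrow>
      Poly_Mapping.single (b, c \<oplus>\<^bsub>C\<^esub> c') 1
        - Poly_Mapping.single (b, c) 1 - Poly_Mapping.single (b, c') 1
      \<in> tensor_relations f B g C"
  | balanced: "\<lbrakk>b \<in> carrier B; c \<in> carrier C\<rbrakk> \<Longrightarrow>
      Poly_Mapping.single (f a \<otimes>\<^bsub>B\<^esub> b, c) 1 - Poly_Mapping.single (b, g a \<otimes>\<^bsub>C\<^esub> c) 1
      \<in> tensor_relations f B g C"

definition tensor_algebra ::
  "('a \<Rightarrow> 'b) \<Rightarrow> ('b, 's) ring_scheme \<Rightarrow> ('a \<Rightarrow> 'c) \<Rightarrow> ('c, 't) ring_scheme \<Rightarrow> ('b \<times> 'c \<Rightarrow>\<^sub>0 int) set ring"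
  where
  "tensor_algebra f B g C =
     monoid_ring (B \<times>\<times> C) Quot
       generate (add_monoid (monoid_ring (B \<times>\<times> C))) (tensor_relations f B g C)"

datatype bt_gen = TGen nat | EGen nat

type_synonym bt_free = "bt_gen list \<Rightarrow>\<^sub>0 laurent"

definition bt_free_algebra :: "nat \<Rightarrow> bt_free ring" where
  "bt_free_algebra n = monoid_ring (word_monoid (TGen ` {1..<n} \<union> EGen ` {1..<n}))"

abbreviation bt_T :: "nat \<Rightarrow> bt_free" where
  "bt_T i \<equiv> Poly_Mapping.single [TGen i] 1"

abbreviation bt_E :: "nat \<Rightarrow> bt_free" where
  "bt_E i \<equiv> Poly_Mapping.single [EGen i] 1"

abbreviation bt_const :: "laurent \<Rightarrow> bt_free" where
  "bt_const a \<equiv> Poly_Mapping.single [] a"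

definition far :: "nat \<Rightarrow> nat \<Rightarrow> bool" where
  "far i j \<longleftrightarrow> \<bar>int i - int j\<bar> > 1"

definition adjacent :: "nat \<Rightarrow> nat \<Rightarrow> bool" where
  "adjacent i j \<longleftrightarrow> \<bar>int i - int j\<bar> = 1"

context
  fixes n :: nat
begin

private abbreviation bt_times :: "bt_free \<Rightarrow> bt_free \<Rightarrow> bt_free" (infixl \<open>\<star>\<close> 70) where
  "x \<star> y \<equiv> x \<otimes>\<^bsub>bt_free_algebra n\<^esub> y"

inductive bt_relation :: "bt_free \<Rightarrow> bt_free \<Rightarrow> bool" where
  E1: "\<lbrakk>i \<in> {1..<n}; j \<in> {1..<n}; far i j\<rbrakk> \<Longrightarrow>
        bt_relation (bt_T i \<star> bt_T j) (bt_T j \<star> bt_T i)"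
| E2: "\<lbrakk>i \<in> {1..<n}; j \<in> {1..<n}\<rbrakk> \<Longrightarrow>
        bt_relation (bt_E i \<star> bt_E j) (bt_E j \<star> bt_E i)"
| E3: "\<lbrakk>i \<in> {1..<n}; j \<in> {1..<n}; far i j\<rbrakk> \<Longrightarrow>
        bt_relation (bt_E i \<star> bt_T j) (bt_T j \<star> bt_E i)"
| E4: "i \<in> {1..<n} \<Longrightarrow>
        bt_relation (bt_E i \<star> bt_E i) (bt_E i)"
| E5: "i \<in> {1..<n} \<Longrightarrow>
        bt_relation (bt_E i \<star> bt_T i) (bt_T i \<star> bt_E i)"
| E6: "\<lbrakk>i \<in> {1..<n}; j \<in> {1..<n}; adjacent i j\<rbrakk> \<Longrightarrow>
        bt_relation (bt_T i \<star> bt_T j \<star> bt_T i) (bt_T j \<star> bt_T i \<star> bt_T j)"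
| E7: "\<lbrakk>i \<in> {1..<n}; j \<in> {1..<n}; adjacent i j\<rbrakk> \<Longrightarrow>
        bt_relation (bt_E j \<star> bt_T i \<star> bt_T j) (bt_T i \<star> bt_T j \<star> bt_E i)"
| E8a: "\<lbrakk>i \<in> {1..<n}; j \<in> {1..<n}; adjacent i j\<rbrakk> \<Longrightarrow>
        bt_relation (bt_E i \<star> bt_E j \<star> bt_T j) (bt_E i \<star> bt_T j \<star> bt_E i)"
| E8b: "\<lbrakk>i \<in> {1..<n}; j \<in> {1..<n}; adjacent i j\<rbrakk> \<Longrightarrow>
        bt_relation (bt_E i \<star> bt_T j \<star> bt_E i) (bt_T j \<star> bt_E i \<star> bt_E j)"
| E9: "i \<in> {1..<n} \<Longrightarrow>
        bt_relation (bt_T i \<star> bt_T i)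
          (bt_const 1 + bt_const (u_laurent - 1) \<star> bt_E i \<star> (bt_const 1 + bt_T i))"

definition bt_ideal :: "bt_free set" where
  "bt_ideal = Idl\<^bsub>bt_free_algebra n\<^esub> {x - y | x y. bt_relation x y}"

definition bt_algebra_laurent :: "bt_free set ring" where
  "bt_algebra_laurent = bt_free_algebra n Quot bt_ideal"

definition bt_scalar :: "laurent \<Rightarrow> bt_free set" where
  "bt_scalar a = bt_ideal +>\<^bsub>bt_free_algebra n\<^esub> bt_const a"

definition bt_algebra :: "(bt_free set \<times> ratfun \<Rightarrow>\<^sub>0 int) set ring" where
  "bt_algebra = tensor_algebra bt_scalar bt_algebra_laurent laurent_to_ratfun ring_of_type_algebra"

end

text \<open>The pair \<open>(i, j)\<close> stands for the basis vector of \<open>V\<close> with lower index \<open>i\<close> and upper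
  index \<open>j\<close>, and a list of such pairs for the tensor product of these basis vectors. A tensor
  is a finite linear combination of such lists.\<close>

type_synonym index = "nat \<times> nat"

type_synonym tensor = "index list \<Rightarrow>\<^sub>0 ratfun"

definition scale_tensor :: "ratfun \<Rightarrow> tensor \<Rightarrow> tensor" where
  "scale_tensor c x = Poly_Mapping.map ((*) c) x"

definition linear_extension :: "(index list \<Rightarrow> tensor) \<Rightarrow> tensor \<Rightarrow> tensor" where
  "linear_extension \<phi> x =
     (\<Sum>w\<in>Poly_Mapping.keys x. scale_tensor (Poly_Mapping.lookup x w) (\<phi> w))"

abbreviation pure_tensor :: "index list \<Rightarrow> tensor" where
  "pure_tensor w \<equiv> Poly_Mapping.single w 1"

fun E_basis :: "index \<Rightarrow> index \<Rightarrow> tensor" where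
  "E_basis (i1, j1) (i2, j2) = (if j1 = j2 then pure_tensor [(i1, j1), (i2, j2)] else 0)"

fun T_basis :: "index \<Rightarrow> index \<Rightarrow> tensor" where
  "T_basis (i1, j1) (i2, j2) =
     (if j1 \<noteq> j2 then pure_tensor [(i2, j2), (i1, j1)]
      else if i1 = i2 then scale_tensor u_ratfun (pure_tensor [(i2, j1), (i1, j2)])
      else if i1 < i2 then pure_tensor [(i2, j2), (i1, j1)]
      else scale_tensor u_ratfun (pure_tensor [(i2, j2), (i1, j1)])
         + scale_tensor (u_ratfun - 1) (pure_tensor [(i1, j1), (i2, j2)]))"

text \<open>The endomorphism of tensor space acting by the endomorphism \<open>\<phi>\<close> of \<open>V \<otimes> V\<close> in the
  factors \<open>k\<close> and \<open>k + 1\<close>, counted from 1, whereas list positions are counted from 0.\<close>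

definition act_in_factors :: "nat \<Rightarrow> (index \<Rightarrow> index \<Rightarrow> tensor) \<Rightarrow> tensor \<Rightarrow> tensor" where
  "act_in_factors k \<phi> =
     linear_extension (\<lambda>w.
       linear_extension (\<lambda>z. pure_tensor (take (k - 1) w @ z @ drop (k + 1) w))
         (\<phi> (w ! (k - 1)) (w ! k)))"

fun gen_action :: "bt_gen \<Rightarrow> tensor \<Rightarrow> tensor" where
  "gen_action (TGen k) = act_in_factors k T_basis"
| "gen_action (EGen k) = act_in_factors k E_basis"

definition free_action :: "bt_free \<Rightarrow> tensor \<Rightarrow> tensor" where
  "free_action f x =
     (\<Sum>w\<in>Poly_Mapping.keys f. scale_tensor (laurent_to_ratfun (Poly_Mapping.lookup f w))
        (foldr gen_action w x))"

text \<open>The value on a coset is the common value on its representatives; that there is one is part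
  of the module property.\<close>

definition bt_action_laurent :: "bt_free set \<Rightarrow> tensor \<Rightarrow> tensor" where
  "bt_action_laurent b x = the_elem ((\<lambda>f. free_action f x) ` b)"

definition bt_action :: "(bt_free set \<times> ratfun \<Rightarrow>\<^sub>0 int) set \<Rightarrow> tensor \<Rightarrow> tensor" where
  "bt_action t x =
     the_elem ((\<lambda>g. \<Sum>(b, c)\<in>Poly_Mapping.keys g.
       scale_tensor (of_int (Poly_Mapping.lookup g (b, c)) * c) (bt_action_laurent b x)) ` t)"

text \<open>The fields \<open>mult\<close> and \<open>one\<close> of a module record are not used.\<close>

definition tensor_space ::
  "nat \<Rightarrow> ((bt_free set \<times> ratfun \<Rightarrow>\<^sub>0 int) set, tensor) module" where
  "tensor_space n =
     \<lparr>carrier = {x. \<forall>w\<in>Poly_Mapping.keys x. length w = n \<and> set w \<subseteq> {1..n} \<times> {1..n}},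
      monoid.mult = undefined, monoid.one = undefined,
      ring.zero = 0, ring.add = (+),
      module.smult = bt_action\<rparr>"

text \<open>The library's \<open>module\<close> asks for a commutative ring; its \<open>module_axioms\<close>, the laws of the
  scalar multiplication, do not.\<close>

locale left_module = R?: ring R + M?: abelian_group M
  for R :: "('r, 's) ring_scheme" (structure) and M :: "('r, 'm, 't) module_scheme" (structure) +
  assumes left_module_axioms: "module_axioms R M"

locale faithful_left_module = left_module +
  assumes faithful:
    "\<lbrakk>r \<in> carrier R; \<And>x. x \<in> carrier M \<Longrightarrow> r \<odot>\<^bsub>M\<^esub> x = \<zero>\<^bsub>M\<^esub>\<rbrakk> \<Longrightarrow> r = \<zero>\<^bsub>R\<^esub>"

end

theory Submission
  imports Defs
begin

text \<open>The algebra is spanned over the field \<open>K\<close> of rational functions by elements \<open>E_A T_w\<close>, one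
  for each equivalence relation \<open>A\<close> on the strands \<open>{1..n}\<close> and each permutation \<open>w\<close>, and these
  elements act on tensor space by linearly independent operators. The two facts together give
  faithfulness: an element that annihilates tensor space is a combination of the spanning elements
  whose coefficients all vanish.

  Spanning. Let \<open>E_ij\<close> be the conjugate of \<open>E_i\<close> by \<open>T_(j-1) \<dots> T_(i+1)\<close>; it ties the strands \<open>i\<close>
  and \<open>j\<close>. Conjugation by \<open>T_k\<close> permutes the \<open>E_ij\<close> as the transposition of \<open>k\<close> and
  \<open>k+1\<close> does (\<open>cj_E_pair\<close>). Every permutation of the strands is therefore realised by a unit, and
  identities among the \<open>E_ij\<close> need only be verified on the first strands, where they are the defining
  relations: the \<open>E_ij\<close> are commuting idempotents with \<open>E_ab E_bc = E_ab E_ac\<close>. Consequently a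
  product of them depends only on the equivalence relation of the pairs that it absorbs
  (\<open>E_prod_eq_E_rel\<close>). For the permutations a fixed set of reduced words is enough; the span of
  all \<open>E_A T_w\<close> contains \<open>1\<close> and is closed under left multiplication by the generators.

  Independence. Take a basis tensor whose lower indices are \<open>1, \<dots>, n\<close> in this order. A normal
  word applied to it only ever exchanges neighbours \<open>x, y\<close> with increasing lower indices, and there
  \<open>T (x \<otimes> y) = y \<otimes> x\<close>. Hence \<open>T_w\<close> maps the tensor to another basis tensor, and different \<open>w\<close>
  give different ones (\<open>action_normal_word\<close>, \<open>normal_word_rearrange_inj\<close>). The idempotent \<open>E_A\<close> is
  the projection to the tensors whose upper indices are constant on the classes of \<open>A\<close>
  (\<open>action_E_rel\<close>). Since the upper indices range over a set of \<open>n\<close> elements, the classes of every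
  equivalence relation \<open>B\<close> can be prescribed for them. A vanishing combination with coefficients
  \<open>c\<close> therefore satisfies \<open>\<Sum>\<^bsub>A \<subseteq> B\<^esub> c (A, w) = 0\<close> for all \<open>B\<close> and \<open>w\<close>, which forces
  \<open>c = 0\<close> (\<open>coefficients_vanish\<close>).

  Besides this, the quotient and tensor product in the definition of the algebra have to be shown to
  be rings, and the operators \<open>E\<close> and \<open>T\<close> to satisfy the relations, so that tensor space is a module
  (\<open>tensor_space_module\<close>).\<close>

section \<open>Conjugation by units\<close>

context monoid
begin

definition conjugate :: "'a \<Rightarrow> 'a \<Rightarrow> 'a" where
  "conjugate g x = g \<otimes> x \<otimes> inv g"

lemma conjugate_closed [simp, intro]:
  "g \<in> Units G \<Longrightarrow> x \<in> carrier G \<Longrightarrow> conjugate g x \<in> carrier G"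
  by (simp add: conjugate_def Units_closed)

lemma conjugate_eqI:
  assumes "g \<in> Units G" "x \<in> carrier G" "y \<in> carrier G" "g \<otimes> x = y \<otimes> g"
  shows "conjugate g x = y"
  using assms by (simp add: conjugate_def m_assoc Units_closed)

lemma conjugate_commute:
  assumes "g \<in> Units G" "x \<in> carrier G"
  shows "g \<otimes> x = conjugate g x \<otimes> g"
  using assms by (simp add: conjugate_def m_assoc Units_closed)

lemma conjugate_m:
  assumes "g \<in> Units G" "x \<in> carrier G" "y \<in> carrier G"
  shows "conjugate g (x \<otimes> y) = conjugate g x \<otimes> conjugate g y"
proof (rule conjugate_eqI)
  have "g \<otimes> (x \<otimes> y) = conjugate g x \<otimes> (g \<otimes> y)"
    using assms conjugate_commute[of g x] by (simp add: m_assoc[symmetric] Units_closed)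
  also have "\<dots> = conjugate g x \<otimes> conjugate g y \<otimes> g"
    using assms conjugate_commute[of g y] by (simp add: m_assoc Units_closed)
  finally show "g \<otimes> (x \<otimes> y) = conjugate g x \<otimes> conjugate g y \<otimes> g" .
qed (use assms in auto)

lemma conjugate_unit [simp]: "g \<in> Units G \<Longrightarrow> conjugate g \<one> = \<one>"
  by (rule conjugate_eqI) (auto simp: Units_closed)

lemma conjugate_one [simp]: "x \<in> carrier G \<Longrightarrow> conjugate \<one> x = x"
  by (rule conjugate_eqI) auto

lemma conjugate_conjugate:
  assumes "g \<in> Units G" "h \<in> Units G" "x \<in> carrier G"
  shows "conjugate g (conjugate h x) = conjugate (g \<otimes> h) x"
proof (rule conjugate_eqI[symmetric])
  have "g \<otimes> h \<otimes> x = g \<otimes> (conjugate h x \<otimes> h)"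
    using assms conjugate_commute[of h x] by (simp add: m_assoc Units_closed)
  also have "\<dots> = conjugate g (conjugate h x) \<otimes> (g \<otimes> h)"
    using assms conjugate_commute[of g "conjugate h x"]
    by (simp add: m_assoc[symmetric] Units_closed)
  finally show "g \<otimes> h \<otimes> x = conjugate g (conjugate h x) \<otimes> (g \<otimes> h)" .
qed (use assms in auto)

lemma conjugate_inj:
  assumes "g \<in> Units G" "x \<in> carrier G" "y \<in> carrier G" "conjugate g x = conjugate g y"
  shows "x = y"
proof -
  have "conjugate (inv g) (conjugate g x) = conjugate (inv g) (conjugate g y)"
    using assms(4) by simp
  moreover have "conjugate (inv g) (conjugate g z) = z" if "z \<in> carrier G" for z
    using assms(1) that by (simp add: conjugate_conjugate Units_inv_Units)
  ultimately show ?thesis using assms(2,3) by simp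
qed

end

section \<open>Algebras satisfying the braids and ties relations\<close>

text \<open>The scalars enter through a ring homomorphism \<open>sc\<close> from a field to the centre, so that the algebra
  itself is just a ring and the arithmetic of \<open>ring\<close> applies to it.\<close>

locale braids_and_ties = ring R for R (structure) +
  fixes n :: nat and sc :: "'k::field \<Rightarrow> 'a" and q :: 'k and T E :: "nat \<Rightarrow> 'a"
  assumes sc_closed [simp, intro]: "sc c \<in> carrier R"
    and sc_add: "sc (c + d) = sc c \<oplus> sc d"
    and sc_mult: "sc (c * d) = sc c \<otimes> sc d"
    and sc_one: "sc 1 = \<one>"
    and sc_central: "x \<in> carrier R \<Longrightarrow> x \<otimes> sc c = sc c \<otimes> x"
    and q_nonzero: "q \<noteq> 0"
    and T_closed [simp]: "i \<in> {1..<n} \<Longrightarrow> T i \<in> carrier R"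
    and E_closed [simp]: "i \<in> {1..<n} \<Longrightarrow> E i \<in> carrier R"
    and E1: "\<lbrakk>i \<in> {1..<n}; j \<in> {1..<n}; far i j\<rbrakk> \<Longrightarrow> T i \<otimes> T j = T j \<otimes> T i"
    and E2: "\<lbrakk>i \<in> {1..<n}; j \<in> {1..<n}\<rbrakk> \<Longrightarrow> E i \<otimes> E j = E j \<otimes> E i"
    and E3: "\<lbrakk>i \<in> {1..<n}; j \<in> {1..<n}; far i j\<rbrakk> \<Longrightarrow> E i \<otimes> T j = T j \<otimes> E i"
    and E4: "i \<in> {1..<n} \<Longrightarrow> E i \<otimes> E i = E i"
    and E5: "i \<in> {1..<n} \<Longrightarrow> E i \<otimes> T i = T i \<otimes> E i"
    and E6: "\<lbrakk>i \<in> {1..<n}; j \<in> {1..<n}; adjacent i j\<rbrakk> \<Longrightarrow>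
      T i \<otimes> T j \<otimes> T i = T j \<otimes> T i \<otimes> T j"
    and E7: "\<lbrakk>i \<in> {1..<n}; j \<in> {1..<n}; adjacent i j\<rbrakk> \<Longrightarrow>
      E j \<otimes> T i \<otimes> T j = T i \<otimes> T j \<otimes> E i"
    and E8a: "\<lbrakk>i \<in> {1..<n}; j \<in> {1..<n}; adjacent i j\<rbrakk> \<Longrightarrow>
      E i \<otimes> E j \<otimes> T j = E i \<otimes> T j \<otimes> E i"
    and E8b: "\<lbrakk>i \<in> {1..<n}; j \<in> {1..<n}; adjacent i j\<rbrakk> \<Longrightarrow>
      E i \<otimes> T j \<otimes> E i = T j \<otimes> E i \<otimes> E j"
    and E9: "i \<in> {1..<n} \<Longrightarrow> T i \<otimes> T i = \<one> \<oplus> sc (q - 1) \<otimes> (E i \<otimes> (\<one> \<oplus> T i))"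
begin

lemma sc_zero: "sc 0 = \<zero>"
  using sc_add[of 0 0] by (metis add.inv_closed add_0 l_neg local.add.r_cancel_one' sc_closed)

lemma sc_mult_right:
  "x \<in> carrier R \<Longrightarrow> y \<in> carrier R \<Longrightarrow> x \<otimes> (sc c \<otimes> y) = sc c \<otimes> (x \<otimes> y)"
  using sc_central[of x c] by (simp add: m_assoc[symmetric])

lemma sc_sc: "y \<in> carrier R \<Longrightarrow> sc c \<otimes> (sc d \<otimes> y) = sc (c * d) \<otimes> y"
  by (simp add: sc_mult m_assoc)

lemma sc_plus: "y \<in> carrier R \<Longrightarrow> sc c \<otimes> y \<oplus> sc d \<otimes> y = sc (c + d) \<otimes> y"
  by (simp add: sc_add l_distr)

text \<open>Relation (E9) determines the inverse because \<open>E i \<otimes> (\<one> \<oplus> T i)\<close> is an eigenvector of \<open>T i\<close> with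
  the invertible eigenvalue \<open>q\<close>, as \<open>E_T_T\<close> shows.\<close>

definition T_inverse :: "nat \<Rightarrow> 'a" where
  "T_inverse i = T i \<oplus> sc (inverse q - 1) \<otimes> (E i \<otimes> (\<one> \<oplus> T i))"

lemma T_inverse_closed: "i \<in> {1..<n} \<Longrightarrow> T_inverse i \<in> carrier R"
  by (simp add: T_inverse_def)

lemma E_T_T:
  assumes i: "i \<in> {1..<n}"
  shows "E i \<otimes> (\<one> \<oplus> T i) \<otimes> T i = sc q \<otimes> (E i \<otimes> (\<one> \<oplus> T i))"
proof -
  note [simp] = T_closed[OF i] E_closed[OF i]
  define S where "S = \<one> \<oplus> T i"
  have [simp]: "S \<in> carrier R" by (simp add: S_def)
  have S: "S \<otimes> T i = S \<oplus> sc (q - 1) \<otimes> (E i \<otimes> S)"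
    using E9[OF i] by (simp add: S_def l_distr a_ac)
  have "E i \<otimes> S \<otimes> T i = E i \<otimes> (S \<oplus> sc (q - 1) \<otimes> (E i \<otimes> S))"
    by (simp add: m_assoc S)
  also have "\<dots> = E i \<otimes> S \<oplus> sc (q - 1) \<otimes> (E i \<otimes> S)"
  proof -
    have "E i \<otimes> (E i \<otimes> S) = E i \<otimes> S" using E4[OF i] by (simp add: m_assoc[symmetric])
    then show ?thesis by (simp add: r_distr sc_mult_right)
  qed
  also have "\<dots> = sc 1 \<otimes> (E i \<otimes> S) \<oplus> sc (q - 1) \<otimes> (E i \<otimes> S)"
    by (simp add: sc_one)
  also have "\<dots> = sc q \<otimes> (E i \<otimes> S)" by (subst sc_plus) simp_all
  finally show ?thesis by (simp add: S_def)
qed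

lemma T_commutes_ES:
  assumes i: "i \<in> {1..<n}"
  shows "T i \<otimes> (E i \<otimes> (\<one> \<oplus> T i)) = E i \<otimes> (\<one> \<oplus> T i) \<otimes> T i"
proof -
  note [simp] = T_closed[OF i] E_closed[OF i]
  have "T i \<otimes> (E i \<otimes> S) = E i \<otimes> (T i \<otimes> S)" if "S \<in> carrier R" for S
    using E5[OF i] that by (simp add: m_assoc[symmetric])
  then show ?thesis by (simp add: m_assoc) (simp add: r_distr l_distr)
qed

lemma T_T_inverse:
  assumes i: "i \<in> {1..<n}"
  shows "T_inverse i \<otimes> T i = \<one>" "T i \<otimes> T_inverse i = \<one>"
proof -
  note [simp] = T_closed[OF i] E_closed[OF i]
  define Z where "Z = E i \<otimes> (\<one> \<oplus> T i)"
  have [simp]: "Z \<in> carrier R" by (simp add: Z_def)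
  have Z: "Z \<otimes> T i = sc q \<otimes> Z" "T i \<otimes> Z = sc q \<otimes> Z"
    using E_T_T[OF i] T_commutes_ES[OF i] by (simp_all add: Z_def)
  have sq: "T i \<otimes> T i = \<one> \<oplus> sc (q - 1) \<otimes> Z" using E9[OF i] by (simp add: Z_def)
  have eq: "T i \<otimes> T i \<oplus> sc ((inverse q - 1) * q) \<otimes> Z = \<one>"
    unfolding sq using q_nonzero
    by (simp add: a_assoc sc_plus left_diff_distrib sc_zero)
  show "T_inverse i \<otimes> T i = \<one>"
    unfolding T_inverse_def Z_def[symmetric] using eq Z
    by (simp add: l_distr m_assoc sc_sc)
  show "T i \<otimes> T_inverse i = \<one>"
    unfolding T_inverse_def Z_def[symmetric] using eq Z
    by (simp add: r_distr sc_mult_right[of "T i"] sc_sc)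
qed

lemma T_Units [simp, intro]: "i \<in> {1..<n} \<Longrightarrow> T i \<in> Units R"
  using T_T_inverse T_inverse_closed unfolding Units_def by auto

lemma inv_T: "i \<in> {1..<n} \<Longrightarrow> inv (T i) = T_inverse i"
  using T_T_inverse T_inverse_closed by (intro inv_unique'[symmetric]) auto

abbreviation cj :: "nat \<Rightarrow> 'a \<Rightarrow> 'a" where
  "cj i \<equiv> conjugate (T i)"

lemma cj_far:
  assumes "i \<in> {1..<n}" "j \<in> {1..<n}" "far i j" "x \<in> carrier R"
  shows "cj i (cj j x) = cj j (cj i x)"
  using assms E1[of i j] by (simp add: conjugate_conjugate)

lemma cj_braid:
  assumes "i \<in> {1..<n}" "j \<in> {1..<n}" "adjacent i j" "x \<in> carrier R"
  shows "cj i (cj j (cj i x)) = cj j (cj i (cj j x))"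
  using assms E6[of i j] by (simp add: conjugate_conjugate m_assoc)

lemma cj_E_same: "i \<in> {1..<n} \<Longrightarrow> cj i (E i) = E i"
  using E5 by (intro conjugate_eqI) auto

lemma cj_E_far: "\<lbrakk>i \<in> {1..<n}; j \<in> {1..<n}; far j i\<rbrakk> \<Longrightarrow> cj i (E j) = E j"
  using E3 by (intro conjugate_eqI) auto

lemma adjacent_sym: "adjacent i j \<longleftrightarrow> adjacent j i"
  by (auto simp: adjacent_def)

text \<open>Although \<open>T i\<close> is not an involution, its square commutes with the neighbouring \<open>E j\<close>,
  because by (E8) so does \<open>E i \<otimes> T i\<close>. This is why conjugation by the \<open>T i\<close> permutes the
  idempotents like a symmetric group and not only like a braid group.\<close>

lemma cj_cj_E_adjacent:
  assumes i: "i \<in> {1..<n}" and j: "j \<in> {1..<n}" and adj: "adjacent i j"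
  shows "cj i (cj i (E j)) = E j"
proof -
  note [simp] = T_closed[OF i] E_closed[OF i] T_closed[OF j] E_closed[OF j]
  have adj': "adjacent j i" using adj adjacent_sym by blast
  have "E i \<otimes> T i \<otimes> E j = T i \<otimes> (E j \<otimes> E i)"
    using E5[OF i] E2[OF i j] by (simp add: m_assoc)
  also have "\<dots> = E j \<otimes> E i \<otimes> T i"
    using E8a[OF j i adj'] E8b[OF j i adj'] by (simp add: m_assoc)
  finally have 1: "E i \<otimes> (\<one> \<oplus> T i) \<otimes> E j = E j \<otimes> (E i \<otimes> (\<one> \<oplus> T i))"
    using E2[OF i j] by (simp add: r_distr l_distr m_assoc)
  define S where "S = E i \<otimes> (\<one> \<oplus> T i)"
  have "S \<in> carrier R" "T i \<otimes> T i = \<one> \<oplus> sc (q - 1) \<otimes> S" "S \<otimes> E j = E j \<otimes> S"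
    using E9[OF i] 1 by (simp_all add: S_def)
  then have "T i \<otimes> T i \<otimes> E j = E j \<otimes> (T i \<otimes> T i)"
    by (simp add: r_distr l_distr m_assoc sc_mult_right)
  then show ?thesis using i j
    by (simp add: conjugate_conjugate) (intro conjugate_eqI, auto)
qed

lemma cj_E_adjacent:
  assumes i: "i \<in> {1..<n}" and j: "j \<in> {1..<n}" and adj: "adjacent i j"
  shows "cj i (E j) = cj j (E i)"
proof (rule conjugate_inj[of "T i"])
  have "cj i (cj j (E i)) = E j"
    using i j E7[OF i j adj] by (simp add: conjugate_conjugate) (intro conjugate_eqI, auto simp: m_assoc)
  then show "cj i (cj i (E j)) = cj i (cj j (E i))"
    using cj_cj_E_adjacent[OF i j adj] by simp
qed (use i j in auto)

section \<open>The idempotents attached to pairs of strands\<close>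

text \<open>The strands tied by \<open>E_shift i d\<close> are \<open>i\<close> and \<open>i + d + 1\<close>; recursion on the distance extends
  the pair at its upper end.\<close>

fun E_shift :: "nat \<Rightarrow> nat \<Rightarrow> 'a" where
  "E_shift i 0 = E i"
| "E_shift i (Suc d) = cj (i + d + 1) (E_shift i d)"

lemma E_shift_closed [simp]:
  "1 \<le> i \<Longrightarrow> i + d + 1 \<le> n \<Longrightarrow> E_shift i d \<in> carrier R"
  by (induction d) auto

lemma cj_E_shift_above:
  assumes "1 \<le> i" "i + d + 1 < k" "k < n"
  shows "cj k (E_shift i d) = E_shift i d"
  using assms
proof (induction d)
  case 0
  then show ?case by (simp add: cj_E_far far_def)
next
  case (Suc d)
  then show ?case using cj_far[of k "i + d + 1" "E_shift i d"] by (simp add: far_def)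
qed

lemma cj_E_shift_below:
  assumes "1 \<le> k" "k + 1 < i" "i + d + 1 \<le> n"
  shows "cj k (E_shift i d) = E_shift i d"
  using assms
proof (induction d)
  case 0
  then show ?case by (simp add: cj_E_far far_def)
next
  case (Suc d)
  then show ?case using cj_far[of k "i + d + 1" "E_shift i d"] by (simp add: far_def)
qed

text \<open>A pair of strands at distance at least two can be pulled together from either end.\<close>

lemma E_shift_Suc_lower:
  assumes "1 \<le> i" "i + d + 2 \<le> n"
  shows "E_shift i (Suc d) = cj i (E_shift (Suc i) d)"
  using assms
proof (induction d)
  case 0
  then show ?case using cj_E_adjacent[of "i+1" i] by (simp add: adjacent_def)
next
  case (Suc d)
  have "E_shift i (Suc (Suc d)) = cj (i + d + 2) (cj i (E_shift (Suc i) d))"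
    using Suc by simp
  also have "\<dots> = cj i (cj (i + d + 2) (E_shift (Suc i) d))"
    using Suc.prems by (intro cj_far) (auto simp: far_def)
  finally show ?case by simp
qed

text \<open>Pulling from the other end makes the two conjugations commute past \<open>T i\<close>, which reduces the claim
  to \<open>cj_cj_E_adjacent\<close>.\<close>

lemma cj_cj_E_shift_upper:
  assumes "1 \<le> i" "i + d + 1 < n"
  shows "cj (i + d + 1) (cj (i + d + 1) (E_shift i d)) = E_shift i d"
  using assms
proof (induction d arbitrary: i)
  case 0
  then show ?case using cj_cj_E_adjacent[of "i+1" i] by (simp add: adjacent_def)
next
  case (Suc d)
  let ?k = "i + Suc d + 1"
  have "cj ?k (cj ?k (E_shift i (Suc d))) = cj ?k (cj ?k (cj i (E_shift (Suc i) d)))"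
    using Suc.prems by (subst E_shift_Suc_lower) auto
  also have "\<dots> = cj i (cj ?k (cj ?k (E_shift (Suc i) d)))"
    using Suc.prems by (simp add: cj_far[of "Suc (Suc (i + d))" i] far_def)
  also have "\<dots> = cj i (E_shift (Suc i) d)"
    using Suc.IH[of "Suc i"] Suc.prems by simp
  also have "\<dots> = E_shift i (Suc d)"
    using Suc.prems by (subst E_shift_Suc_lower) auto
  finally show ?case .
qed

lemma cj_cj_E_shift_lower:
  assumes "1 \<le> i" "i + d + 2 \<le> n"
  shows "cj i (cj i (E_shift (Suc i) d)) = E_shift (Suc i) d"
  using assms
proof (induction d)
  case 0
  then show ?case using cj_cj_E_adjacent[of i "i+1"] by (simp add: adjacent_def)
next
  case (Suc d)
  then show ?case
    using cj_far[of i "i + d + 2" "E_shift (Suc i) d"]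
      cj_far[of i "i + d + 2" "cj i (E_shift (Suc i) d)"] by (simp add: far_def)
qed

text \<open>A crossing strictly between the two tied strands is moved by the braid relation to one that lies
  above the part of the pair built so far.\<close>

lemma cj_E_shift_inside:
  assumes "1 \<le> i" "i < k" "k < i + d" "i + d + 1 \<le> n"
  shows "cj k (E_shift i d) = E_shift i d"
  using assms
proof (induction d)
  case 0
  then show ?case by simp
next
  case (Suc d)
  show ?case
  proof (cases "k = i + d")
    case True
    then obtain e where d: "d = Suc e" and k: "k = i + e + 1"
      using Suc.prems by (cases d) auto
    have "cj k (E_shift i (Suc d)) = cj k (cj (k + 1) (cj k (E_shift i e)))"
      by (simp add: d k)
    also have "\<dots> = cj (k + 1) (cj k (cj (k + 1) (E_shift i e)))"
      using Suc.prems by (intro cj_braid) (auto simp: adjacent_def d k)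
    also have "cj (k + 1) (E_shift i e) = E_shift i e"
      using Suc.prems by (intro cj_E_shift_above) (auto simp: d k)
    finally show ?thesis by (simp add: d k)
  next
    case False
    have "cj k (E_shift i (Suc d)) = cj k (cj (i + d + 1) (E_shift i d))"
      by simp
    also have "\<dots> = cj (i + d + 1) (cj k (E_shift i d))"
      using Suc.prems False by (intro cj_far) (auto simp: far_def)
    also have "cj k (E_shift i d) = E_shift i d"
      using Suc False by auto
    finally show ?thesis by simp
  qed
qed

text \<open>A strand is tied to itself by \<open>\<one>\<close>, so that absorbing \<open>E_pair i j\<close> becomes a reflexive relation
  of \<open>i\<close> and \<open>j\<close>.\<close>

definition E_pair :: "nat \<Rightarrow> nat \<Rightarrow> 'a" where
  "E_pair i j = (if i = j then \<one> else E_shift (min i j) (max i j - min i j - 1))"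

lemma E_pair_sym: "E_pair i j = E_pair j i"
  by (simp add: E_pair_def min.commute max.commute)

lemma E_pair_closed [simp]: "i \<in> {1..n} \<Longrightarrow> j \<in> {1..n} \<Longrightarrow> E_pair i j \<in> carrier R"
  by (auto simp: E_pair_def min_def max_def)

lemma E_pair_refl [simp]: "E_pair i i = \<one>"
  by (simp add: E_pair_def)

lemma E_pair_Suc: "E_pair i (Suc i) = E i"
  by (simp add: E_pair_def)

lemma E_pair_less: "i < j \<Longrightarrow> E_pair i j = E_shift i (j - i - 1)"
  by (simp add: E_pair_def)

lemma cj_E_pair_less:
  assumes k: "k \<in> {1..<n}" and ij: "1 \<le> i" "i < j" "j \<le> n"
  shows "cj k (E_pair i j) = E_pair (transpose k (Suc k) i) (transpose k (Suc k) j)"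
proof -
  define d where "d = j - i - 1"
  have j: "j = i + d + 1" using ij by (simp add: d_def)
  have Eij: "E_pair i j = E_shift i d" using ij by (simp add: E_pair_less d_def)
  consider "k > j" | "k = j" | "Suc k = j" "k = i" | "Suc k = j" "i < k" | "i < k" "Suc k < j"
    | "k = i" "Suc k < j" | "Suc k = i" | "Suc k < i" by linarith
  then show ?thesis
  proof cases
    case 1
    have "cj k (E_pair i j) = E_pair i j"
      unfolding Eij using 1 k ij j by (intro cj_E_shift_above) auto
    then show ?thesis using 1 ij by (simp add: transpose_def)
  next
    case 2
    then have "cj k (E_pair i j) = E_pair i (Suc j)"
      using ij j by (simp add: Eij E_pair_less)
    then show ?thesis using 2 ij by (simp add: transpose_def)
  next
    case 3
    then have "d = 0" using j by simp
    with 3 show ?thesis using k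
      by (simp add: Eij cj_E_same E_pair_sym[of j i])
  next
    case 4
    then obtain e where d: "d = Suc e" using j by (cases d) auto
    have kk: "k = i + e + 1" using 4 j d by simp
    have "cj k (E_pair i j) = cj k (cj k (E_shift i e))" by (simp add: Eij d kk)
    also have "\<dots> = E_shift i e" using k ij unfolding kk by (intro cj_cj_E_shift_upper) auto
    finally show ?thesis using 4 by (simp add: E_pair_less kk)
  next
    case 5
    have "cj k (E_pair i j) = E_pair i j"
      unfolding Eij using 5 k ij j by (intro cj_E_shift_inside) auto
    then show ?thesis using 5 by (simp add: transpose_def)
  next
    case 6
    then obtain e where d: "d = Suc e" using j by (cases d) auto
    have "E_pair i j = cj i (E_shift (Suc i) e)"
      unfolding Eij d using ij j d by (intro E_shift_Suc_lower) auto
    then have "cj k (E_pair i j) = cj i (cj i (E_shift (Suc i) e))"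
      using 6 by simp
    also have "\<dots> = E_shift (Suc i) e" using k ij j d by (intro cj_cj_E_shift_lower) auto
    finally show ?thesis using 6 by (simp add: E_pair_less j d)
  next
    case 7
    have "cj k (E_pair i j) = E_shift k (Suc d)"
      unfolding Eij using 7 ij k j E_shift_Suc_lower[of k d] by simp
    then show ?thesis using 7 j by (simp add: E_pair_less transpose_def)
  next
    case 8
    have "cj k (E_pair i j) = E_pair i j"
      unfolding Eij using 8 k ij j by (intro cj_E_shift_below) auto
    then show ?thesis using 8 ij by (simp add: transpose_def)
  qed
qed

lemma cj_E_pair:
  assumes k: "k \<in> {1..<n}" and ij: "i \<in> {1..n}" "j \<in> {1..n}"
  shows "cj k (E_pair i j) = E_pair (transpose k (Suc k) i) (transpose k (Suc k) j)"
proof (cases i j rule: linorder_cases)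
  case less
  then show ?thesis using assms by (intro cj_E_pair_less) auto
next
  case equal
  then show ?thesis using assms by simp
next
  case greater
  then show ?thesis using assms cj_E_pair_less[of k j i]
    by (simp only: E_pair_sym[of i j] E_pair_sym[of "transpose k (Suc k) i"]) simp
qed

end

text \<open>The complements of \<open>A\<close> and of its image have the same size, and any bijection between them
  completes \<open>f\<close>.\<close>

lemma ex_permutes_extending:
  assumes "finite S" "A \<subseteq> S" "inj_on f A" "f ` A \<subseteq> S"
  obtains p where "p permutes S" "\<And>x. x \<in> A \<Longrightarrow> p x = f x"
proof -
  have "card (S - A) = card (S - f ` A)"
    using assms by (simp add: card_Diff_subset finite_subset card_image)
  then obtain g where g: "bij_betw g (S - A) (S - f ` A)"
    using assms(1) by (meson finite_Diff finite_same_card_bij)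
  define p where "p x = (if x \<in> A then f x else if x \<in> S then g x else x)" for x
  have 1: "bij_betw p A (f ` A)"
    using assms(3) by (subst bij_betw_cong[of _ _ f]) (auto simp: p_def inj_on_imp_bij_betw)
  have 2: "bij_betw p (S - A) (S - f ` A)"
    using g by (subst bij_betw_cong[of _ _ g]) (auto simp: p_def)
  have "bij_betw p (A \<union> (S - A)) (f ` A \<union> (S - f ` A))"
    using 1 2 by (rule bij_betw_combine) auto
  moreover have "A \<union> (S - A) = S" "f ` A \<union> (S - f ` A) = S" using assms by auto
  ultimately have "p permutes S"
    using assms(2) by (intro bij_imp_permutes) (auto simp: p_def)
  then show thesis by (rule that) (simp add: p_def)
qed

context braids_and_ties
begin

text \<open>The realised permutations contain the transpositions of neighbouring strands and are closed
  under composition, so all permutations are realised.\<close>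

definition realised :: "(nat \<Rightarrow> nat) \<Rightarrow> bool" where
  "realised p \<longleftrightarrow> p permutes {1..n} \<and>
     (\<exists>g\<in>Units R. \<forall>i\<in>{1..n}. \<forall>j\<in>{1..n}. conjugate g (E_pair i j) = E_pair (p i) (p j))"

lemma realised_id: "realised id"
  unfolding realised_def using permutes_id by (auto intro!: bexI[of _ \<one>])

lemma realised_comp:
  assumes "realised p" "realised p'"
  shows "realised (p \<circ> p')"
proof -
  obtain g g' where g: "g \<in> Units R" "g' \<in> Units R"
    "\<forall>i\<in>{1..n}. \<forall>j\<in>{1..n}. conjugate g (E_pair i j) = E_pair (p i) (p j)"
    "\<forall>i\<in>{1..n}. \<forall>j\<in>{1..n}. conjugate g' (E_pair i j) = E_pair (p' i) (p' j)"
    using assms by (auto simp: realised_def)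
  have p: "p permutes {1..n}" "p' permutes {1..n}" using assms by (auto simp: realised_def)
  have "conjugate (g \<otimes> g') (E_pair i j) = E_pair ((p \<circ> p') i) ((p \<circ> p') j)"
    if "i \<in> {1..n}" "j \<in> {1..n}" for i j
  proof -
    have "p' i \<in> {1..n}" "p' j \<in> {1..n}" using that permutes_in_image[OF p(2)] by blast+
    then show ?thesis using g that by (simp add: conjugate_conjugate[symmetric])
  qed
  then show ?thesis using permutes_compose[OF p(2,1)] g(1,2) unfolding realised_def
    by (auto intro!: bexI[of _ "g \<otimes> g'"])
qed

lemma realised_adjacent: "k \<in> {1..<n} \<Longrightarrow> realised (transpose k (Suc k))"
  unfolding realised_def using cj_E_pair
  by (auto intro!: permutes_swap_id bexI[of _ "T k"])

lemma realised_transpose_less: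
  assumes "1 \<le> a" "a + d < n"
  shows "realised (transpose a (Suc (a + d)))"
  using assms
proof (induction d)
  case 0
  then show ?case using realised_adjacent by simp
next
  case (Suc d)
  let ?b = "Suc (a + d)"
  have "transpose a (Suc ?b) = transpose ?b (Suc ?b) \<circ> transpose a ?b \<circ> transpose ?b (Suc ?b)"
    by (auto simp: fun_eq_iff transpose_def)
  moreover have "realised (transpose ?b (Suc ?b))" using Suc.prems by (intro realised_adjacent) auto
  moreover have "realised (transpose a ?b)" using Suc by simp
  ultimately show ?case by (simp only: realised_comp add_Suc_right)
qed

lemma realised_transpose:
  assumes "a \<in> {1..n}" "b \<in> {1..n}"
  shows "realised (transpose a b)"
proof (cases a b rule: linorder_cases)
  case less
  then show ?thesis using realised_transpose_less[of a "b - a - 1"] assms by auto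
next
  case equal
  then show ?thesis using realised_id by simp
next
  case greater
  then show ?thesis using realised_transpose_less[of b "a - b - 1"] assms
    by (auto simp: transpose_commute[of a])
qed

lemma realised_permutes:
  assumes "p permutes {1..n}"
  shows "realised p"
  using assms finite_atLeastAtMost
proof (induction p rule: permutes_induct)
  case id
  then show ?case by (rule realised_id)
next
  case (swap a b p)
  then show ?case using realised_comp realised_transpose by blast
qed

text \<open>Every identity between the idempotents of pairs may therefore be checked on the first few
  strands.\<close>

lemma ex_conjugate_E_pair:
  assumes "distinct xs" "set xs \<subseteq> {1..n}"
  obtains g where "g \<in> Units R" "length xs \<le> n"
    "\<And>i j. i < length xs \<Longrightarrow> j < length xs \<Longrightarrow>
       E_pair (xs ! i) (xs ! j) = conjugate g (E_pair (Suc i) (Suc j))"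
proof -
  have len: "length xs \<le> n"
    using assms card_mono[of "{1..n}" "set xs"] by (simp add: distinct_card)
  have inj: "inj_on (\<lambda>i. xs ! (i - 1)) {1..length xs}"
    using assms(1) by (auto simp: inj_on_def nth_eq_iff_index_eq)
  have im: "(\<lambda>i. xs ! (i - 1)) ` {1..length xs} \<subseteq> {1..n}"
    using assms(2) by (auto simp: subset_iff)
  obtain p where p: "p permutes {1..n}" "\<And>i. i \<in> {1..length xs} \<Longrightarrow> p i = xs ! (i - 1)"
    using ex_permutes_extending[of "{1..n}" "{1..length xs}", OF _ _ inj im] len by auto
  obtain g where g: "g \<in> Units R"
    "\<forall>i\<in>{1..n}. \<forall>j\<in>{1..n}. conjugate g (E_pair i j) = E_pair (p i) (p j)"
    using realised_permutes[OF p(1)] by (auto simp: realised_def)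
  show thesis
  proof (rule that[OF g(1) len])
    fix i j assume "i < length xs" "j < length xs"
    then show "E_pair (xs ! i) (xs ! j) = conjugate g (E_pair (Suc i) (Suc j))"
      using g(2) len p(2)[of "Suc i"] p(2)[of "Suc j"] by auto
  qed
qed

lemma E_pair_idem:
  assumes "a \<in> {1..n}" "b \<in> {1..n}"
  shows "E_pair a b \<otimes> E_pair a b = E_pair a b"
proof (cases "a = b")
  case False
  obtain g where g: "g \<in> Units R" "length [a, b] \<le> n"
    and conj: "\<And>i j. i < length [a, b] \<Longrightarrow> j < length [a, b] \<Longrightarrow>
      E_pair ([a, b] ! i) ([a, b] ! j) = conjugate g (E_pair (Suc i) (Suc j))"
    by (rule ex_conjugate_E_pair[of "[a, b]"]) (use False assms in auto)
  note g = g[simplified] conj[of 0 1, simplified]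
  have "E_pair 1 2 \<otimes> E_pair 1 2 = E_pair 1 2"
    using g(2) E4[of 1] E_pair_Suc[of 1] by (simp add: numeral_2_eq_2)
  then show ?thesis using g by (simp add: conjugate_m[symmetric] eval_nat_numeral)
qed simp

lemma E_pair_commute_meeting:
  assumes "a \<in> {1..n}" "b \<in> {1..n}" "c \<in> {1..n}"
  shows "E_pair a b \<otimes> E_pair b c = E_pair b c \<otimes> E_pair a b"
proof (cases "distinct [a, b, c]")
  case True
  obtain g where g: "g \<in> Units R" "length [a, b, c] \<le> n"
    and conj: "\<And>i j. i < length [a, b, c] \<Longrightarrow> j < length [a, b, c] \<Longrightarrow>
      E_pair ([a, b, c] ! i) ([a, b, c] ! j) = conjugate g (E_pair (Suc i) (Suc j))"
    by (rule ex_conjugate_E_pair[of "[a, b, c]"]) (use True assms in auto)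
  note g = g[simplified] conj[of 0 1, simplified] conj[of 1 2, simplified]
  have "E_pair 1 2 \<otimes> E_pair 2 3 = E_pair 2 3 \<otimes> E_pair 1 2"
    using g(2) E2[of 1 2] E_pair_Suc[of 1] E_pair_Suc[of 2]
    by (simp add: numeral_2_eq_2 numeral_3_eq_3)
  then show ?thesis using g by (simp add: conjugate_m[symmetric] eval_nat_numeral)
next
  case False
  then show ?thesis using assms E_pair_sym[of a b] by auto
qed

lemma E_pair_commute:
  assumes "a \<in> {1..n}" "b \<in> {1..n}" "c \<in> {1..n}" "d \<in> {1..n}"
  shows "E_pair a b \<otimes> E_pair c d = E_pair c d \<otimes> E_pair a b"
proof -
  consider "a = c" | "a = d" | "b = c" | "b = d" | "a = b" | "c = d" | "distinct [a, b, c, d]"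
    by auto
  then show ?thesis
  proof cases
    case 7
  obtain g where g: "g \<in> Units R" "length [a, b, c, d] \<le> n"
    and conj: "\<And>i j. i < length [a, b, c, d] \<Longrightarrow> j < length [a, b, c, d] \<Longrightarrow>
      E_pair ([a, b, c, d] ! i) ([a, b, c, d] ! j) = conjugate g (E_pair (Suc i) (Suc j))"
    by (rule ex_conjugate_E_pair[of "[a, b, c, d]"]) (use 7 assms in auto)
  note g = g[simplified] conj[of 0 1, simplified] conj[of 2 3, simplified]
    have "E_pair 1 2 \<otimes> E_pair 3 4 = E_pair 3 4 \<otimes> E_pair 1 2"
      using g(2) E2[of 1 3] E_pair_Suc[of 1] E_pair_Suc[of 3]
      by (simp add: eval_nat_numeral)
    then show ?thesis using g by (simp add: conjugate_m[symmetric] eval_nat_numeral)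
  next
    case 1
    then show ?thesis using assms E_pair_commute_meeting[of b a d] by (simp add: E_pair_sym[of b])
  next
    case 2
    then show ?thesis using assms E_pair_commute_meeting[of b a c]
      by (simp add: E_pair_sym[of b] E_pair_sym[of c])
  next
    case 3
    then show ?thesis using assms E_pair_commute_meeting[of a b d] by simp
  next
    case 4
    then show ?thesis using assms E_pair_commute_meeting[of a b c] by (simp add: E_pair_sym[of c])
  qed (use assms in auto)
qed

text \<open>For the strands 1, 2, 3 this is (E8a) multiplied by the inverse of \<open>T 2\<close>.\<close>

lemma E_pair_trans:
  assumes "a \<in> {1..n}" "b \<in> {1..n}" "c \<in> {1..n}"
  shows "E_pair a b \<otimes> E_pair b c = E_pair a b \<otimes> E_pair a c"
proof (cases "distinct [a, b, c]")
  case True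
  obtain g where g: "g \<in> Units R" "length [a, b, c] \<le> n"
    and conj: "\<And>i j. i < length [a, b, c] \<Longrightarrow> j < length [a, b, c] \<Longrightarrow>
      E_pair ([a, b, c] ! i) ([a, b, c] ! j) = conjugate g (E_pair (Suc i) (Suc j))"
    by (rule ex_conjugate_E_pair[of "[a, b, c]"]) (use True assms in auto)
  note g = g[simplified] conj[of 0 1, simplified] conj[of 1 2, simplified] conj[of 0 2, simplified]
  have [simp]: "E 1 \<in> carrier R" "E (Suc 0) \<in> carrier R" "E 2 \<in> carrier R" "T 2 \<in> carrier R" "T 2 \<in> Units R"
    using g(2) by auto
  have "E 1 \<otimes> (T 2 \<otimes> E 1 \<otimes> inv (T 2)) = E 1 \<otimes> T 2 \<otimes> E 1 \<otimes> inv (T 2)"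
    by (simp add: m_assoc)
  also have "\<dots> = E 1 \<otimes> E 2 \<otimes> T 2 \<otimes> inv (T 2)"
    using g(2) E8a[of 1 2] by (simp add: adjacent_def)
  also have "\<dots> = E 1 \<otimes> E 2" by (simp add: m_assoc)
  finally have "E_pair 1 2 \<otimes> E_pair 2 3 = E_pair 1 2 \<otimes> E_pair 1 3"
    by (simp add: E_pair_def eval_nat_numeral conjugate_def)
  then show ?thesis using g by (simp add: conjugate_m[symmetric] eval_nat_numeral)
next
  case False
  then consider "a = b" | "b = c" | "a = c" by auto
  then show ?thesis
    using assms E_pair_idem[of a b] by cases (auto simp: E_pair_sym[of b])
qed


abbreviation pairs :: "(nat \<times> nat) set" where
  "pairs \<equiv> {1..n} \<times> {1..n}"

fun E_prod :: "(nat \<times> nat) list \<Rightarrow> 'a" where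
  "E_prod [] = \<one>"
| "E_prod (p # ps) = E_pair (fst p) (snd p) \<otimes> E_prod ps"

lemma E_prod_closed [simp]: "set ps \<subseteq> pairs \<Longrightarrow> E_prod ps \<in> carrier R"
  by (induction ps) auto

lemma E_pair_E_prod_commute:
  assumes "i \<in> {1..n}" "j \<in> {1..n}" "set ps \<subseteq> pairs"
  shows "E_pair i j \<otimes> E_prod ps = E_prod ps \<otimes> E_pair i j"
  using assms
proof (induction ps)
  case (Cons p ps)
  let ?F = "E_pair (fst p) (snd p)"
  have p: "fst p \<in> {1..n}" "snd p \<in> {1..n}" using Cons.prems by auto
  have "E_pair i j \<otimes> (?F \<otimes> E_prod ps) = E_pair i j \<otimes> ?F \<otimes> E_prod ps"
    using Cons.prems p by (simp add: m_assoc)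
  also have "\<dots> = ?F \<otimes> E_pair i j \<otimes> E_prod ps"
    using Cons.prems p by (simp only: E_pair_commute[of i j])
  also have "\<dots> = ?F \<otimes> (E_pair i j \<otimes> E_prod ps)"
    using Cons.prems p by (simp add: m_assoc)
  also have "\<dots> = ?F \<otimes> E_prod ps \<otimes> E_pair i j"
    using Cons p by (simp add: m_assoc)
  finally show ?case by simp
qed simp

lemma E_prod_absorbs_factor:
  assumes "(i, j) \<in> set ps" "set ps \<subseteq> pairs"
  shows "E_prod ps \<otimes> E_pair i j = E_prod ps"
  using assms
proof (induction ps)
  case (Cons p ps)
  let ?F = "E_pair (fst p) (snd p)"
  have p: "fst p \<in> {1..n}" "snd p \<in> {1..n}" using Cons.prems by auto
  show ?case
  proof (cases "p = (i, j)")
    case True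
    have "?F \<otimes> E_prod ps \<otimes> ?F = ?F \<otimes> ?F \<otimes> E_prod ps"
      using Cons.prems p E_pair_E_prod_commute[of "fst p" "snd p" ps]
      by (simp add: m_assoc) (simp add: m_assoc[symmetric])
    also have "\<dots> = ?F \<otimes> E_prod ps" using p by (simp add: E_pair_idem)
    finally show ?thesis using True by simp
  next
    case False
    then have "E_prod ps \<otimes> E_pair i j = E_prod ps" using Cons by auto
    moreover have "i \<in> {1..n}" "j \<in> {1..n}" using Cons.prems by auto
    ultimately show ?thesis using Cons.prems p by (simp add: m_assoc)
  qed
qed simp

lemma absorbs_E_prod:
  assumes "e \<in> carrier R" "set ps \<subseteq> pairs"
    and "\<And>i j. (i, j) \<in> set ps \<Longrightarrow> e \<otimes> E_pair i j = e"
  shows "e \<otimes> E_prod ps = e"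
  using assms
proof (induction ps)
  case (Cons p ps)
  have "e \<otimes> (E_pair (fst p) (snd p) \<otimes> E_prod ps) = e \<otimes> E_pair (fst p) (snd p) \<otimes> E_prod ps"
    using Cons.prems by (subst m_assoc) auto
  also have "\<dots> = e" using Cons by auto
  finally show ?case by simp
qed simp

lemma E_prod_commute:
  assumes "set ps \<subseteq> pairs" "set rs \<subseteq> pairs"
  shows "E_prod ps \<otimes> E_prod rs = E_prod rs \<otimes> E_prod ps"
  using assms
proof (induction ps)
  case (Cons p ps)
  let ?F = "E_pair (fst p) (snd p)"
  have p: "fst p \<in> {1..n}" "snd p \<in> {1..n}" using Cons.prems by auto
  have "?F \<otimes> E_prod ps \<otimes> E_prod rs = ?F \<otimes> E_prod rs \<otimes> E_prod ps"
    using Cons p by (simp add: m_assoc)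
  also have "\<dots> = E_prod rs \<otimes> (?F \<otimes> E_prod ps)"
    using Cons.prems p by (simp only: E_pair_E_prod_commute) (simp add: m_assoc)
  finally show ?case by simp
qed simp

text \<open>The pairs of strands that a product of \<open>E_pair\<close>s ties. Absorption is transitive because of
  \<open>E_pair_trans\<close>, and two commuting idempotents that absorb each other are equal; hence the product is
  determined by this relation.\<close>

definition absorbed :: "(nat \<times> nat) list \<Rightarrow> (nat \<times> nat) set" where
  "absorbed ps = {(i, j) \<in> pairs. E_prod ps \<otimes> E_pair i j = E_prod ps}"

lemma absorbed_equiv:
  assumes ps: "set ps \<subseteq> pairs"
  shows "equiv {1..n} (absorbed ps)"
proof (rule equivI)
  show "absorbed ps \<subseteq> pairs" by (auto simp: absorbed_def)
  show "refl_on {1..n} (absorbed ps)"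
    using ps by (auto simp: refl_on_def absorbed_def)
  show "sym (absorbed ps)"
    by (auto simp: sym_def absorbed_def E_pair_sym)
  show "trans (absorbed ps)"
  proof (rule transI)
    fix a b c assume ab: "(a, b) \<in> absorbed ps" and bc: "(b, c) \<in> absorbed ps"
    then have abc: "a \<in> {1..n}" "b \<in> {1..n}" "c \<in> {1..n}" by (auto simp: absorbed_def)
    let ?e = "E_prod ps"
    have "?e \<otimes> E_pair a c = ?e \<otimes> E_pair a b \<otimes> E_pair a c"
      using ab by (simp add: absorbed_def)
    also have "\<dots> = ?e \<otimes> (E_pair a b \<otimes> E_pair a c)"
      using abc ps by (simp add: m_assoc)
    also have "\<dots> = ?e \<otimes> (E_pair a b \<otimes> E_pair b c)"
      using E_pair_trans abc by simp
    also have "\<dots> = ?e \<otimes> E_pair a b \<otimes> E_pair b c"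
      using abc ps by (simp add: m_assoc)
    also have "\<dots> = ?e" using ab bc by (simp add: absorbed_def)
    finally show "(a, c) \<in> absorbed ps" using abc by (simp add: absorbed_def)
  qed
qed

text \<open>The choice of the list is immaterial, as its factors commute and are idempotent.\<close>

definition E_rel :: "(nat \<times> nat) set \<Rightarrow> 'a" where
  "E_rel A = E_prod (SOME ps. set ps = A)"

lemma E_rel_list:
  assumes "A \<subseteq> pairs"
  obtains ps where "set ps = A" "E_rel A = E_prod ps"
proof -
  have "\<exists>ps. set ps = A" using assms by (meson finite_SigmaI finite_atLeastAtMost finite_list finite_subset)
  then have "set (SOME ps. set ps = A) = A" by (rule someI_ex)
  then show thesis by (rule that) (simp add: E_rel_def)
qed

lemma E_prod_eq_E_rel:
  assumes ps: "set ps \<subseteq> pairs"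
  shows "E_prod ps = E_rel (absorbed ps)"
proof -
  have "absorbed ps \<subseteq> pairs" by (auto simp: absorbed_def)
  then obtain rs where rs: "set rs = absorbed ps" "E_rel (absorbed ps) = E_prod rs"
    by (rule E_rel_list)
  have rs': "set rs \<subseteq> pairs" using rs by (auto simp: absorbed_def)
  have "E_prod ps \<otimes> E_prod rs = E_prod ps"
    using rs' ps rs(1) by (intro absorbs_E_prod) (auto simp: absorbed_def)
  moreover have "set ps \<subseteq> absorbed ps"
    using ps E_prod_absorbs_factor[of _ _ ps] by (auto simp: absorbed_def)
  then have "E_prod rs \<otimes> E_prod ps = E_prod rs"
    using rs' ps rs(1) E_prod_absorbs_factor[of _ _ rs] by (intro absorbs_E_prod) auto
  ultimately show ?thesis using rs(2) E_prod_commute[OF ps rs'] by simp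
qed

section \<open>Words in the braid generators\<close>

fun T_word :: "nat list \<Rightarrow> 'a" where
  "T_word [] = \<one>"
| "T_word (k # ks) = T k \<otimes> T_word ks"

lemma T_word_closed [simp]: "set ks \<subseteq> {1..<n} \<Longrightarrow> T_word ks \<in> carrier R"
  by (induction ks) auto

lemma T_word_append:
  "set ks \<subseteq> {1..<n} \<Longrightarrow> set ls \<subseteq> {1..<n} \<Longrightarrow> T_word (ks @ ls) = T_word ks \<otimes> T_word ls"
  by (induction ks) (auto simp: m_assoc)

lemma T_word_far_commute:
  assumes "i \<in> {1..<n}" "set ks \<subseteq> {1..<n}" "\<And>k. k \<in> set ks \<Longrightarrow> far i k"
  shows "T i \<otimes> T_word ks = T_word ks \<otimes> T i"
  using assms
proof (induction ks)
  case (Cons k ks)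
  have "T i \<otimes> (T k \<otimes> T_word ks) = T k \<otimes> T i \<otimes> T_word ks"
    using Cons.prems E1[of i k] by (simp add: m_assoc[symmetric])
  also have "\<dots> = T k \<otimes> T_word ks \<otimes> T i"
    using Cons by (simp add: m_assoc)
  finally show ?case by simp
qed simp

text \<open>The word \<open>[k..<Suc m]\<close> carries the last of the strands \<open>k, \<dots>, m + 1\<close> to position \<open>k\<close> and shifts the
  others up by one. A crossing of two shifted strands can thus be done before or after.\<close>

lemma T_past_descent:
  assumes "1 \<le> k" "k < i" "i \<le> m" "m < n"
  shows "T i \<otimes> T_word [k..<Suc m] = T_word [k..<Suc m] \<otimes> T (i - 1)"
proof -
  define p where "p = i - 1"
  have i: "i = Suc p" using assms by (simp add: p_def)
  have split: "[k..<Suc m] = [k..<p] @ p # Suc p # [Suc (Suc p)..<Suc m]"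
  proof -
    have "[k..<Suc m] = [k..<p] @ [p..<Suc m]"
      using assms i upt_add_eq_append[of k p "Suc m - p"] by simp
    also have "[p..<Suc m] = p # Suc p # [Suc (Suc p)..<Suc m]"
      using assms i by (simp add: upt_conv_Cons del: upt_Suc)
    finally show ?thesis .
  qed
  let ?L = "T_word [k..<p]" and ?U = "T_word [Suc (Suc p)..<Suc m]"
  have car [simp]: "?L \<in> carrier R" "?U \<in> carrier R" "T p \<in> carrier R" "T (Suc p) \<in> carrier R"
    using assms i by (auto intro!: T_word_closed T_closed)
  have w: "T_word [k..<Suc m] = ?L \<otimes> (T p \<otimes> (T (Suc p) \<otimes> ?U))"
    unfolding split using assms i by (subst T_word_append) auto
  have 1: "T (Suc p) \<otimes> ?L = ?L \<otimes> T (Suc p)"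
    using assms i by (intro T_word_far_commute) (auto simp: far_def)
  have 2: "T p \<otimes> ?U = ?U \<otimes> T p"
    using assms i by (intro T_word_far_commute) (auto simp: far_def)
  have 3: "T (Suc p) \<otimes> T p \<otimes> T (Suc p) = T p \<otimes> T (Suc p) \<otimes> T p"
    using assms i by (intro E6) (auto simp: adjacent_def)
  have "T (Suc p) \<otimes> (?L \<otimes> (T p \<otimes> (T (Suc p) \<otimes> ?U))) = (T (Suc p) \<otimes> ?L) \<otimes> (T p \<otimes> (T (Suc p) \<otimes> ?U))"
    by (simp add: m_assoc del: upt_Suc)
  also have "\<dots> = ?L \<otimes> ((T (Suc p) \<otimes> T p \<otimes> T (Suc p)) \<otimes> ?U)"
    by (simp add: 1 m_assoc del: upt_Suc)
  also have "\<dots> = ?L \<otimes> (T p \<otimes> (T (Suc p) \<otimes> (T p \<otimes> ?U)))"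
    by (simp add: 3 m_assoc del: upt_Suc)
  also have "\<dots> = ?L \<otimes> (T p \<otimes> (T (Suc p) \<otimes> ?U)) \<otimes> T p"
    by (simp add: 2 m_assoc del: upt_Suc)
  finally show ?thesis by (simp add: w i del: upt_Suc)
qed

text \<open>Conjugation turns a product of \<open>E_pair\<close>s into another one, so idempotents can be collected on the
  left of every word.\<close>

lemma T_word_E_prod:
  assumes "set ks \<subseteq> {1..<n}" "set ps \<subseteq> pairs"
  obtains rs where "set rs \<subseteq> pairs" "T_word ks \<otimes> E_prod ps = E_prod rs \<otimes> T_word ks"
proof -
  have cj_E_prod: "cj k (E_prod ps) = E_prod (map (map_prod (transpose k (Suc k)) (transpose k (Suc k))) ps)"
    if "k \<in> {1..<n}" "set ps \<subseteq> pairs" for k ps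
    using that(2)
  proof (induction ps)
    case (Cons p ps)
    then show ?case using that(1) by (cases p) (simp add: conjugate_m cj_E_pair)
  qed (use that in simp)
  have "\<exists>rs. set rs \<subseteq> pairs \<and> T_word ks \<otimes> E_prod ps = E_prod rs \<otimes> T_word ks"
    using assms
  proof (induction ks)
    case (Cons k ks)
    then obtain rs where rs: "set rs \<subseteq> pairs" "T_word ks \<otimes> E_prod ps = E_prod rs \<otimes> T_word ks"
      by auto
    let ?s = "transpose k (Suc k)"
    let ?rs = "map (map_prod ?s ?s) rs"
    have k: "k \<in> {1..<n}" using Cons.prems by simp
    have "set ?rs \<subseteq> pairs"
      using rs(1) k by (fastforce simp: transpose_def)
    moreover have "T_word (k # ks) \<otimes> E_prod ps = T k \<otimes> E_prod rs \<otimes> T_word ks"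
      using Cons.prems rs by (simp add: m_assoc)
    moreover have "T k \<otimes> E_prod rs = E_prod ?rs \<otimes> T k"
      using conjugate_commute[of "T k" "E_prod rs"] cj_E_prod[of k rs] k rs(1) by auto
    ultimately have "T_word (k # ks) \<otimes> E_prod ps = E_prod ?rs \<otimes> T_word (k # ks)"
      using Cons.prems by (simp add: m_assoc)
    then show ?case using \<open>set ?rs \<subseteq> pairs\<close> by blast
  qed auto
  then show thesis using that by blast
qed

end

text \<open>Reduced words for the symmetric group on \<open>m\<close> letters: a permutation is determined by
  where it puts the last letter and by what it does to the others.\<close>

fun normal_words :: "nat \<Rightarrow> nat list set" where
  "normal_words 0 = {[]}"
| "normal_words (Suc m) = {[k..<Suc m] @ w | k w. k \<in> {1..Suc m} \<and> w \<in> normal_words m}"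

lemma finite_normal_words: "finite (normal_words m)"
proof (induction m)
  case (Suc m)
  have "normal_words (Suc m) = (\<lambda>(k, w). [k..<Suc m] @ w) ` ({1..Suc m} \<times> normal_words m)"
    unfolding normal_words.simps by (force simp del: upt_Suc)
  then show ?case using Suc by (simp del: upt_Suc normal_words.simps)
qed simp

lemma normal_words_set: "w \<in> normal_words m \<Longrightarrow> set w \<subseteq> {1..<m}"
  by (induction m arbitrary: w) fastforce+

lemma normal_words_Suc: "w \<in> normal_words m \<Longrightarrow> w \<in> normal_words (Suc m)"
  by (auto intro!: exI[of _ "Suc m"] exI[of _ w])

lemma Nil_in_normal_words: "[] \<in> normal_words m"
  by (induction m) (auto intro: normal_words_Suc simp del: normal_words.simps(2))

context braids_and_ties
begin

text \<open>Linear combinations of the \<open>E_prod ps \<otimes> T_word w\<close>. Arbitrary lists \<open>ps\<close> are allowed here, which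
  makes multiplication by idempotents a matter of appending lists; the passage to equivalence
  relations is left to \<open>span_normal_forms\<close>.\<close>

inductive_set span :: "nat \<Rightarrow> 'a set" for m where
  zero: "\<zero> \<in> span m"
| add: "\<lbrakk>set ps \<subseteq> pairs; w \<in> normal_words m; x \<in> span m\<rbrakk> \<Longrightarrow>
    sc c \<otimes> (E_prod ps \<otimes> T_word w) \<oplus> x \<in> span m"

lemma normal_word_closed: "w \<in> normal_words m \<Longrightarrow> m \<le> n \<Longrightarrow> T_word w \<in> carrier R"
  by (rule T_word_closed) (use normal_words_set in fastforce)

lemma span_closed: "x \<in> span m \<Longrightarrow> m \<le> n \<Longrightarrow> x \<in> carrier R"
  by (induction rule: span.induct) (auto simp: normal_word_closed)

lemma span_single:
  assumes "m \<le> n" "set ps \<subseteq> pairs" "w \<in> normal_words m"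
  shows "sc c \<otimes> (E_prod ps \<otimes> T_word w) \<in> span m"
  using span.add[OF assms(2,3) span.zero, of c] assms by (simp add: normal_word_closed)

lemma span_add:
  assumes "x \<in> span m" "y \<in> span m" "m \<le> n"
  shows "x \<oplus> y \<in> span m"
  using assms(1)
proof (induction rule: span.induct)
  case zero
  then show ?case using assms by (simp add: span_closed)
next
  case (add ps w x c)
  then show ?case using assms span.add[of ps w m "x \<oplus> y" c]
    by (simp add: a_assoc normal_word_closed span_closed)
qed

lemma span_left_mult:
  assumes m: "m \<le> n" "m' \<le> n" and g: "g \<in> carrier R" and x: "x \<in> span m"
    and *: "\<And>ps w. set ps \<subseteq> pairs \<Longrightarrow> w \<in> normal_words m \<Longrightarrow> g \<otimes> (E_prod ps \<otimes> T_word w) \<in> span m'"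
    and scale: "\<And>c x. x \<in> span m' \<Longrightarrow> sc c \<otimes> x \<in> span m'"
  shows "g \<otimes> x \<in> span m'"
  using x
proof (induction rule: span.induct)
  case zero
  then show ?case using g by (simp add: span.zero)
next
  case (add ps w x c)
  have "sc c \<otimes> (g \<otimes> (E_prod ps \<otimes> T_word w)) \<oplus> g \<otimes> x \<in> span m'"
    using add * m scale by (intro span_add) auto
  then show ?case using add g m
    by (simp add: r_distr sc_mult_right span_closed normal_word_closed)
qed

lemma span_scale:
  assumes "x \<in> span m" "m \<le> n"
  shows "sc c \<otimes> x \<in> span m"
  using assms(1)
proof (induction rule: span.induct)
  case zero
  then show ?case by (simp add: span.zero)
next
  case (add ps w x d)
  then show ?case using assms span.add[of ps w m "sc c \<otimes> x" "c * d"]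
    by (simp add: r_distr sc_sc normal_word_closed span_closed)
qed

lemma span_E_prod:
  assumes ps: "set ps \<subseteq> pairs" and x: "x \<in> span m" and m: "m \<le> n"
  shows "E_prod ps \<otimes> x \<in> span m"
proof (rule span_left_mult[OF m m _ x _ span_scale[OF _ m]])
  fix rs w assume rs: "set rs \<subseteq> pairs" and w: "w \<in> normal_words m"
  have "E_prod (ps @ rs) = E_prod ps \<otimes> E_prod rs"
    using ps by (induction ps) (use rs in \<open>auto simp: m_assoc\<close>)
  then have "E_prod ps \<otimes> (E_prod rs \<otimes> T_word w) = sc 1 \<otimes> (E_prod (ps @ rs) \<otimes> T_word w)"
    using ps rs w m by (simp add: m_assoc normal_word_closed sc_one)
  then show "E_prod ps \<otimes> (E_prod rs \<otimes> T_word w) \<in> span m"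
    using span_single[of m "ps @ rs" w 1] ps rs w m by simp
qed (use ps in simp)

lemma span_descent:
  assumes x: "x \<in> span m" and m: "Suc m \<le> n" and k: "k \<in> {1..Suc m}"
  shows "T_word [k..<Suc m] \<otimes> x \<in> span (Suc m)"
proof (rule span_left_mult[OF _ m _ x _ span_scale[OF _ m]])
  have ks: "set [k..<Suc m] \<subseteq> {1..<n}" using k m by auto
  then show "T_word [k..<Suc m] \<in> carrier R" by (rule T_word_closed)
  fix ps w assume ps: "set ps \<subseteq> pairs" and w: "w \<in> normal_words m"
  obtain rs where rs: "set rs \<subseteq> pairs"
    "T_word [k..<Suc m] \<otimes> E_prod ps = E_prod rs \<otimes> T_word [k..<Suc m]"
    using T_word_E_prod[OF ks ps] by blast
  have w': "set w \<subseteq> {1..<n}" using normal_words_set[OF w] m by auto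
  have car: "T_word [k..<Suc m] \<in> carrier R" "T_word w \<in> carrier R"
    using ks w' T_word_closed by blast+
  have "T_word [k..<Suc m] \<otimes> (E_prod ps \<otimes> T_word w) = T_word [k..<Suc m] \<otimes> E_prod ps \<otimes> T_word w"
    using car ps by (simp add: m_assoc del: upt_Suc)
  also have "\<dots> = E_prod rs \<otimes> T_word ([k..<Suc m] @ w)"
    using car rs ks w' by (simp add: m_assoc T_word_append del: upt_Suc)
  also have "\<dots> = sc 1 \<otimes> (E_prod rs \<otimes> T_word ([k..<Suc m] @ w))"
    using car rs ks w' by (simp add: sc_one T_word_append del: upt_Suc)
  also have "\<dots> \<in> span (Suc m)"
    using rs(1) w k m by (intro span_single) auto
  finally show "T_word [k..<Suc m] \<otimes> (E_prod ps \<otimes> T_word w) \<in> span (Suc m)" .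
qed (use m in auto)

lemma span_normal_word:
  assumes "w \<in> normal_words m" "m \<le> n"
  shows "T_word w \<in> span m"
  using span_single[of m "[]" w 1] assms by (simp add: normal_word_closed sc_one)

text \<open>Let \<open>w\<close> begin with the factor \<open>[k..<Suc m]\<close>. If \<open>i\<close> is far below \<open>k\<close> or above \<open>k\<close>, then
  \<open>T i\<close> passes this factor, as itself or as \<open>T (i - 1)\<close>, and the shorter word is treated by induction.
  If \<open>i = k - 1\<close> the factor is lengthened. If \<open>i = k\<close> the quadratic relation shortens it.\<close>

lemma T_normal_word_in_span:
  assumes "w \<in> normal_words m" "m \<le> n" "i \<in> {1..<m}"
  shows "T i \<otimes> T_word w \<in> span m"
  using assms
proof (induction m arbitrary: w i)
  case 0
  then show ?case by simp
next
  case (Suc m)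
  from Suc.prems(1) obtain k v where w: "w = [k..<Suc m] @ v" and k: "k \<in> {1..Suc m}"
    and v: "v \<in> normal_words m" by auto
  let ?a = "T_word [k..<Suc m]"
  have ks: "set [k..<Suc m] \<subseteq> {1..<n}" and vs: "set v \<subseteq> {1..<n}"
    using k Suc.prems(2) normal_words_set[OF v] by auto
  have car [simp]: "?a \<in> carrier R" "T_word v \<in> carrier R" "T i \<in> carrier R"
    using T_word_closed[OF ks] T_word_closed[OF vs] Suc.prems by auto
  have Tw: "T_word w = ?a \<otimes> T_word v"
    unfolding w by (rule T_word_append[OF ks vs])
  have i: "1 \<le> i" "i \<le> m" using Suc.prems by auto
  consider "Suc i < k" | "Suc i = k" | "i = k" | "k < i" by linarith
  then show ?case
  proof cases
    case 1
    then have "T i \<otimes> ?a = ?a \<otimes> T i"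
      using Suc.prems ks by (intro T_word_far_commute) (auto simp: far_def simp del: upt_Suc)
    then have "T i \<otimes> T_word w = ?a \<otimes> (T i \<otimes> T_word v)"
      unfolding Tw by (simp add: m_assoc[symmetric] del: upt_Suc)
    moreover have "T i \<otimes> T_word v \<in> span m"
      using 1 k Suc.prems(2) v i by (intro Suc.IH) auto
    ultimately show ?thesis using span_descent[OF _ Suc.prems(2) k] by simp
  next
    case 2
    have "[i..<Suc m] @ v \<in> normal_words (Suc m)" using v i by auto
    moreover have "T i \<otimes> T_word w = T_word ([i..<Suc m] @ v)"
      using 2 i by (simp add: w upt_conv_Cons del: upt_Suc)
    ultimately show ?thesis using Suc.prems(2) by (metis span_normal_word)
  next
    case 3
    let ?b = "T_word [Suc k..<Suc m]"
    have b: "?b \<in> carrier R" using ks by (intro T_word_closed) auto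
    have a: "?a = T i \<otimes> ?b" using 3 i by (simp add: upt_conv_Cons del: upt_Suc)
    have inn: "i \<in> {1..<n}" using i Suc.prems(2) by simp
    have car' [simp]: "E i \<in> carrier R" using inn by simp
    define w' where "w' = [Suc k..<Suc m] @ v"
    have w'nf: "w' \<in> normal_words (Suc m)" using v k i 3 by (auto simp: w'_def)
    have w': "T_word w' = ?b \<otimes> T_word v"
      unfolding w'_def using ks vs by (intro T_word_append) auto
    have [simp]: "T_word w' \<in> carrier R" using w' b by simp
    have "T_word w = T i \<otimes> T_word w'" using Tw a w' b by (simp add: m_assoc)
    then have "T i \<otimes> T_word w = T i \<otimes> T i \<otimes> T_word w'"
      by (simp add: m_assoc)
    also have "\<dots> = T_word w' \<oplus> sc (q - 1) \<otimes> (E_prod [(i, Suc i)] \<otimes> (T_word w' \<oplus> T_word w))"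
      using inn E9[OF inn] \<open>T_word w = T i \<otimes> T_word w'\<close>
      by (simp add: l_distr r_distr m_assoc E_pair_Suc)
    also have "\<dots> \<in> span (Suc m)"
      using Suc.prems inn w'nf
      by (intro span_add span_scale span_E_prod span_normal_word) auto
    finally show ?thesis .
  next
    case 4
    have "T i \<otimes> ?a = ?a \<otimes> T (i - 1)"
      using 4 k i Suc.prems(2) by (intro T_past_descent) auto
    moreover have "T (i - 1) \<in> carrier R" using 4 k i Suc.prems(2) by (intro T_closed) auto
    ultimately have "T i \<otimes> T_word w = ?a \<otimes> (T (i - 1) \<otimes> T_word v)"
      unfolding Tw by (simp add: m_assoc[symmetric] del: upt_Suc)
    moreover have "T (i - 1) \<otimes> T_word v \<in> span m"
      using 4 k Suc.prems(2) v i by (intro Suc.IH) auto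
    ultimately show ?thesis using span_descent[OF _ Suc.prems(2) k] by simp
  qed
qed

lemma span_T:
  assumes i: "i \<in> {1..<n}" and x: "x \<in> span n"
  shows "T i \<otimes> x \<in> span n"
proof (rule span_left_mult[OF order.refl order.refl _ x _ span_scale])
  fix ps w assume ps: "set ps \<subseteq> pairs" and w: "w \<in> normal_words n"
  obtain rs where rs: "set rs \<subseteq> pairs" "T_word [i] \<otimes> E_prod ps = E_prod rs \<otimes> T_word [i]"
    using T_word_E_prod[of "[i]" ps] ps i by auto
  have "T i \<otimes> (E_prod ps \<otimes> T_word w) = E_prod rs \<otimes> (T i \<otimes> T_word w)"
    using rs i ps normal_word_closed[OF w] by (simp add: m_assoc[symmetric])
  then show "T i \<otimes> (E_prod ps \<otimes> T_word w) \<in> span n"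
    using rs(1) i w by (simp add: span_E_prod T_normal_word_in_span)
qed (use i in auto)

lemma span_E:
  assumes i: "i \<in> {1..<n}" and x: "x \<in> span n"
  shows "E i \<otimes> x \<in> span n"
  using span_E_prod[of "[(i, Suc i)]" x n] i x by (simp add: E_pair_Suc)

lemma one_in_span: "\<one> \<in> span n"
  using span_normal_word[OF Nil_in_normal_words, of n] by simp

definition equivalences :: "(nat \<times> nat) set set" where
  "equivalences = {A. equiv {1..n} A}"

lemma equivalences_pairs: "A \<in> equivalences \<Longrightarrow> A \<subseteq> pairs"
  unfolding equivalences_def using equiv_type by blast

lemma finite_equivalences: "finite equivalences"
  by (rule finite_subset[of _ "Pow pairs"]) (use equivalences_pairs in auto)

definition normal_form :: "(nat \<times> nat) set \<times> nat list \<Rightarrow> 'a" where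
  "normal_form = (\<lambda>(A, w). E_rel A \<otimes> T_word w)"

abbreviation normal_forms :: "((nat \<times> nat) set \<times> nat list) set" where
  "normal_forms \<equiv> equivalences \<times> normal_words n"

lemma finite_normal_forms: "finite normal_forms"
  by (simp add: finite_equivalences finite_normal_words)

lemma E_rel_closed: "A \<in> equivalences \<Longrightarrow> E_rel A \<in> carrier R"
  using E_rel_list[OF equivalences_pairs] by (metis E_prod_closed equivalences_pairs)

lemma normal_form_closed: "b \<in> normal_forms \<Longrightarrow> normal_form b \<in> carrier R"
  by (auto simp: normal_form_def E_rel_closed normal_word_closed)

lemma span_normal_forms:
  assumes "x \<in> span n"
  obtains c where "x = (\<Oplus>b\<in>normal_forms. sc (c b) \<otimes> normal_form b)"
proof -
  have "\<exists>c. x = (\<Oplus>b\<in>normal_forms. sc (c b) \<otimes> normal_form b)"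
    using assms
  proof (induction rule: span.induct)
    case zero
    have "\<zero> = (\<Oplus>b\<in>normal_forms. sc 0 \<otimes> normal_form b)"
      by (rule add.finprod_one_eqI[symmetric]) (auto simp: sc_zero normal_form_closed)
    then show ?case by (rule exI[of _ "\<lambda>_. 0"])
  next
    case (add ps w x d)
    then obtain c where c: "x = (\<Oplus>b\<in>normal_forms. sc (c b) \<otimes> normal_form b)" by blast
    let ?b0 = "(absorbed ps, w)"
    have b0: "?b0 \<in> normal_forms"
      using add absorbed_equiv by (auto simp: equivalences_def)
    have nf: "normal_form ?b0 = E_prod ps \<otimes> T_word w"
      using add by (simp add: normal_form_def E_prod_eq_E_rel)
    have "sc d \<otimes> normal_form ?b0 = (\<Oplus>b\<in>normal_forms. if ?b0 = b then sc d \<otimes> normal_form b else \<zero>)"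
      by (rule finsum_singleton[symmetric]) (use b0 finite_normal_forms normal_form_closed in auto)
    then have "sc d \<otimes> normal_form ?b0 \<oplus> x =
      (\<Oplus>b\<in>normal_forms. (if ?b0 = b then sc d \<otimes> normal_form b else \<zero>) \<oplus> sc (c b) \<otimes> normal_form b)"
      unfolding c by (subst finsum_addf) (auto simp: normal_form_closed)
    also have "\<dots> = (\<Oplus>b\<in>normal_forms. sc ((if ?b0 = b then d else 0) + c b) \<otimes> normal_form b)"
      by (rule finsum_cong') (auto simp: normal_form_closed sc_add sc_zero l_distr)
    finally show ?case
      unfolding nf by (rule exI[of _ "\<lambda>b. (if ?b0 = b then d else 0) + c b"])
  qed
  then show thesis using that by blast
qed

end

section \<open>Additive maps on finitely supported functions\<close>

text \<open>The maps given by finite sums over the keys of a formal linear combination, namely evaluation of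
  Laurent polynomials, multiplication in a monoid ring, linear extension and the actions on tensors,
  all have this form and are thereby recognised as additive.\<close>

definition lift_sum :: "('k \<Rightarrow> 'v::zero \<Rightarrow> 'c::comm_monoid_add) \<Rightarrow> ('k \<Rightarrow>\<^sub>0 'v) \<Rightarrow> 'c" where
  "lift_sum \<phi> f = (\<Sum>k\<in>Poly_Mapping.keys f. \<phi> k (Poly_Mapping.lookup f k))"

lemma lift_sum_zero [simp]: "lift_sum \<phi> 0 = 0"
  by (simp add: lift_sum_def)

lemma lift_sum_single: "\<phi> k 0 = 0 \<Longrightarrow> lift_sum \<phi> (Poly_Mapping.single k v) = \<phi> k v"
  by (simp add: lift_sum_def)

lemma lift_sum_add:
  fixes f g :: "'k \<Rightarrow>\<^sub>0 'v::monoid_add"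
  assumes "\<And>k. \<phi> k 0 = 0" "\<And>k a b. \<phi> k (a + b) = \<phi> k a + \<phi> k b"
  shows "lift_sum \<phi> (f + g) = lift_sum \<phi> f + lift_sum \<phi> g"
  unfolding lift_sum_def by (rule setsum_keys_plus_distrib) (use assms in auto)

lemma lift_sum_plus: "lift_sum (\<lambda>k v. \<phi> k v + \<psi> k v) f = lift_sum \<phi> f + lift_sum \<psi> f"
  by (simp add: lift_sum_def sum.distrib)

lemma keys_add_subset: "Poly_Mapping.keys f \<subseteq> S \<Longrightarrow> Poly_Mapping.keys g \<subseteq> S \<Longrightarrow> Poly_Mapping.keys (f + g) \<subseteq> S"
  using keys_add[of f g] by blast

lemma poly_mapping_eq_sum_singles:
  fixes f :: "'k \<Rightarrow>\<^sub>0 'v::comm_monoid_add"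
  shows "f = (\<Sum>k\<in>Poly_Mapping.keys f. Poly_Mapping.single k (Poly_Mapping.lookup f k))"
proof (rule poly_mapping_eqI)
  fix x
  have "(\<Sum>k\<in>Poly_Mapping.keys f. Poly_Mapping.lookup (Poly_Mapping.single k (Poly_Mapping.lookup f k)) x) =
    (\<Sum>k\<in>Poly_Mapping.keys f. if k = x then Poly_Mapping.lookup f k else 0)"
    by (rule sum.cong) (auto simp: lookup_single when_def)
  then show "Poly_Mapping.lookup f x =
    Poly_Mapping.lookup (\<Sum>k\<in>Poly_Mapping.keys f. Poly_Mapping.single k (Poly_Mapping.lookup f k)) x"
    by (simp add: lookup_sum in_keys_iff)
qed

lemma poly_mapping_single_induct [consumes 1, case_names zero single_add]:
  fixes f :: "'k \<Rightarrow>\<^sub>0 'v::comm_monoid_add"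
  assumes "Poly_Mapping.keys f \<subseteq> S" "P 0"
    and "\<And>k v f. k \<in> S \<Longrightarrow> Poly_Mapping.keys f \<subseteq> S \<Longrightarrow> P f \<Longrightarrow> P (Poly_Mapping.single k v + f)"
  shows "P f"
proof -
  let ?s = "\<lambda>k. Poly_Mapping.single k (Poly_Mapping.lookup f k)"
  have "P (\<Sum>k\<in>A. ?s k) \<and> Poly_Mapping.keys (\<Sum>k\<in>A. ?s k) \<subseteq> S" if "finite A" "A \<subseteq> S" for A
    using that
  proof (induction A rule: finite_induct)
    case (insert x A)
    then show ?case using assms(3)[of x "\<Sum>k\<in>A. ?s k"]
      by (simp add: keys_add_subset)
  qed (simp add: assms)
  from this[OF finite_keys assms(1)] show ?thesis
    by (simp add: poly_mapping_eq_sum_singles[symmetric])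
qed

section \<open>Evaluation of Laurent polynomials\<close>

lemma laurent_to_ratfun_lift_sum:
  "laurent_to_ratfun = lift_sum (\<lambda>k c. Fract [:c:] 1 * u_ratfun powi k)"
  by (simp add: fun_eq_iff laurent_to_ratfun_def lift_sum_def)

lemma u_ratfun_nonzero: "u_ratfun \<noteq> 0"
  by (simp add: u_ratfun_def Zero_fract_def eq_fract)

lemma Fract_const: "Fract (0 :: complex poly) 1 = 0" "Fract [:1::complex:] 1 = 1"
  "Fract [:a + b :: complex:] 1 = Fract [:a:] 1 + Fract [:b:] 1"
  "Fract [:a * b :: complex:] 1 = Fract [:a:] 1 * Fract [:b:] 1"
  by (simp_all add: Zero_fract_def One_fract_def mult.commute flip: one_pCons)

lemma laurent_to_ratfun_add: "laurent_to_ratfun (a + b) = laurent_to_ratfun a + laurent_to_ratfun b"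
  unfolding laurent_to_ratfun_lift_sum
  by (rule lift_sum_add) (simp_all only: pCons_0_0 Fract_const mult_zero_left distrib_right)

lemma laurent_to_ratfun_single:
  "laurent_to_ratfun (Poly_Mapping.single k c) = Fract [:c:] 1 * u_ratfun powi k"
  unfolding laurent_to_ratfun_lift_sum by (subst lift_sum_single) (simp_all add: Fract_const(1))

lemma laurent_to_ratfun_zero [simp]: "laurent_to_ratfun 0 = 0"
  by (simp add: laurent_to_ratfun_def)

lemma laurent_to_ratfun_mult: "laurent_to_ratfun (a * b) = laurent_to_ratfun a * laurent_to_ratfun b"
proof -
  have two_singles: "laurent_to_ratfun (Poly_Mapping.single k c * Poly_Mapping.single l d) =
    laurent_to_ratfun (Poly_Mapping.single k c) * laurent_to_ratfun (Poly_Mapping.single l d)" for k l c d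
    by (simp only: mult_single laurent_to_ratfun_single Fract_const power_int_add u_ratfun_nonzero
        simp_thms mult_ac)
  have single: "laurent_to_ratfun (Poly_Mapping.single k c * b) =
    laurent_to_ratfun (Poly_Mapping.single k c) * laurent_to_ratfun b" for k c b
    using subset_UNIV[of "Poly_Mapping.keys b"]
    by (induction rule: poly_mapping_single_induct)
      (simp_all add: distrib_left laurent_to_ratfun_add two_singles)
  show ?thesis
    using subset_UNIV[of "Poly_Mapping.keys a"]
    by (induction rule: poly_mapping_single_induct)
      (simp_all add: distrib_right laurent_to_ratfun_add single)
qed

lemma laurent_to_ratfun_one [simp]: "laurent_to_ratfun 1 = 1"
  using laurent_to_ratfun_single[of 0 1] by (simp add: Fract_const(1,2))

lemma laurent_to_ratfun_minus: "laurent_to_ratfun (a - b) = laurent_to_ratfun a - laurent_to_ratfun b"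
  using laurent_to_ratfun_add[of "a - b" b] by simp

lemma laurent_to_ratfun_u: "laurent_to_ratfun u_laurent = u_ratfun"
  by (simp add: u_laurent_def laurent_to_ratfun_single Fract_const(1,2))

section \<open>The monoid ring\<close>

context
  fixes M :: "('m, 's) monoid_scheme"
begin

lemma carrier_monoid_ring: "carrier (monoid_ring M) = {f. Poly_Mapping.keys f \<subseteq> carrier M}"
  and zero_monoid_ring: "\<zero>\<^bsub>monoid_ring M\<^esub> = 0"
  and add_monoid_ring: "f \<oplus>\<^bsub>monoid_ring M\<^esub> g = f + g"
  and one_monoid_ring: "\<one>\<^bsub>monoid_ring M\<^esub> = Poly_Mapping.single \<one>\<^bsub>M\<^esub> 1"
  by (simp_all add: monoid_ring_def)

lemma mult_monoid_ring:
  "f \<otimes>\<^bsub>monoid_ring M\<^esub> g =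
     lift_sum (\<lambda>x a. lift_sum (\<lambda>y b. Poly_Mapping.single (x \<otimes>\<^bsub>M\<^esub> y) (a * b)) g) f"
  by (simp add: monoid_ring_def lift_sum_def)

lemma monoid_ring_distrib_right:
  fixes f g h :: "'m \<Rightarrow>\<^sub>0 'r::comm_ring_1"
  shows "(f + g) \<otimes>\<^bsub>monoid_ring M\<^esub> h = f \<otimes>\<^bsub>monoid_ring M\<^esub> h + g \<otimes>\<^bsub>monoid_ring M\<^esub> h"
  unfolding mult_monoid_ring
  by (subst lift_sum_add) (simp_all add: lift_sum_def distrib_right single_add sum.distrib)

lemma monoid_ring_distrib_left:
  fixes f g h :: "'m \<Rightarrow>\<^sub>0 'r::comm_ring_1"
  shows "h \<otimes>\<^bsub>monoid_ring M\<^esub> (f + g) = h \<otimes>\<^bsub>monoid_ring M\<^esub> f + h \<otimes>\<^bsub>monoid_ring M\<^esub> g"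
proof -
  have "lift_sum (\<lambda>y b. Poly_Mapping.single (x \<otimes>\<^bsub>M\<^esub> y) (a * b)) (f + g) =
    lift_sum (\<lambda>y b. Poly_Mapping.single (x \<otimes>\<^bsub>M\<^esub> y) (a * b)) f +
    lift_sum (\<lambda>y b. Poly_Mapping.single (x \<otimes>\<^bsub>M\<^esub> y) (a * b)) g" for x and a :: 'r
    by (rule lift_sum_add) (simp_all add: distrib_left single_add)
  then show ?thesis unfolding mult_monoid_ring by (simp add: lift_sum_plus)
qed

lemma monoid_ring_mult_zero [simp]:
  fixes f :: "'m \<Rightarrow>\<^sub>0 'r::comm_ring_1"
  shows "0 \<otimes>\<^bsub>monoid_ring M\<^esub> f = 0" "f \<otimes>\<^bsub>monoid_ring M\<^esub> 0 = 0"
  by (simp_all add: mult_monoid_ring) (simp add: lift_sum_def)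

lemma monoid_ring_mult_single:
  "Poly_Mapping.single x a \<otimes>\<^bsub>monoid_ring M\<^esub> Poly_Mapping.single y b =
     Poly_Mapping.single (x \<otimes>\<^bsub>M\<^esub> y) (a * b)"
  by (simp add: mult_monoid_ring lift_sum_single)

end

lemma monoid_ring_is_ring:
  assumes "monoid M"
  shows "ring (monoid_ring M :: ('m \<Rightarrow>\<^sub>0 'r::comm_ring_1) ring)"
proof -
  interpret M: monoid M by fact
  let ?R = "monoid_ring M :: ('m \<Rightarrow>\<^sub>0 'r) ring"
  note simps = carrier_monoid_ring zero_monoid_ring add_monoid_ring one_monoid_ring
  note distribs = monoid_ring_distrib_right monoid_ring_distrib_left
  show ?thesis
  proof (rule ringI)
    show "abelian_group ?R"
    proof (rule abelian_groupI)
      fix x assume "x \<in> carrier ?R"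
      then have "- x \<in> carrier ?R" by (auto simp: simps in_keys_iff)
      then show "\<exists>y\<in>carrier ?R. y \<oplus>\<^bsub>?R\<^esub> x = \<zero>\<^bsub>?R\<^esub>"
        by (intro bexI[of _ "- x"]) (simp_all add: simps)
    qed (simp_all add: simps keys_add_subset add.assoc add.commute)
    have closed_single: "Poly_Mapping.keys (Poly_Mapping.single k v \<otimes>\<^bsub>?R\<^esub> g) \<subseteq> carrier M"
      if "k \<in> carrier M" "Poly_Mapping.keys g \<subseteq> carrier M" for k v and g :: "'m \<Rightarrow>\<^sub>0 'r"
      using that(2)
      by (induction rule: poly_mapping_single_induct)
        (use that(1) in \<open>simp_all add: distribs monoid_ring_mult_single keys_add_subset\<close>)
    have closed: "Poly_Mapping.keys (f \<otimes>\<^bsub>?R\<^esub> g) \<subseteq> carrier M"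
      if "Poly_Mapping.keys f \<subseteq> carrier M" "Poly_Mapping.keys g \<subseteq> carrier M" for f g :: "'m \<Rightarrow>\<^sub>0 'r"
      using that(1)
      by (induction rule: poly_mapping_single_induct)
        (use that(2) closed_single in \<open>simp_all add: distribs keys_add_subset\<close>)
    have assoc1: "Poly_Mapping.single x a \<otimes>\<^bsub>?R\<^esub> Poly_Mapping.single y b \<otimes>\<^bsub>?R\<^esub> h =
      Poly_Mapping.single x a \<otimes>\<^bsub>?R\<^esub> (Poly_Mapping.single y b \<otimes>\<^bsub>?R\<^esub> h)"
      if "x \<in> carrier M" "y \<in> carrier M" "Poly_Mapping.keys h \<subseteq> carrier M" for x y a b and h :: "'m \<Rightarrow>\<^sub>0 'r"
      using that(3)
      by (induction rule: poly_mapping_single_induct)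
        (use that(1,2) in \<open>simp_all add: distribs monoid_ring_mult_single M.m_assoc mult.assoc\<close>)
    have assoc2: "Poly_Mapping.single x a \<otimes>\<^bsub>?R\<^esub> g \<otimes>\<^bsub>?R\<^esub> h = Poly_Mapping.single x a \<otimes>\<^bsub>?R\<^esub> (g \<otimes>\<^bsub>?R\<^esub> h)"
      if "x \<in> carrier M" "Poly_Mapping.keys g \<subseteq> carrier M" "Poly_Mapping.keys h \<subseteq> carrier M" for x a and g h :: "'m \<Rightarrow>\<^sub>0 'r"
      using that(2)
      by (induction rule: poly_mapping_single_induct) (use that(1,3) in \<open>simp_all add: distribs assoc1\<close>)
    have assoc: "f \<otimes>\<^bsub>?R\<^esub> g \<otimes>\<^bsub>?R\<^esub> h = f \<otimes>\<^bsub>?R\<^esub> (g \<otimes>\<^bsub>?R\<^esub> h)"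
      if "Poly_Mapping.keys f \<subseteq> carrier M" "Poly_Mapping.keys g \<subseteq> carrier M" "Poly_Mapping.keys h \<subseteq> carrier M"
      for f g h :: "'m \<Rightarrow>\<^sub>0 'r"
      using that(1)
      by (induction rule: poly_mapping_single_induct) (use that(2,3) in \<open>simp_all add: distribs assoc2\<close>)
    have one: "\<one>\<^bsub>?R\<^esub> \<otimes>\<^bsub>?R\<^esub> f = f \<and> f \<otimes>\<^bsub>?R\<^esub> \<one>\<^bsub>?R\<^esub> = f" if "Poly_Mapping.keys f \<subseteq> carrier M" for f
      using that
      by (induction rule: poly_mapping_single_induct)
        (simp_all add: distribs monoid_ring_mult_single one_monoid_ring)
    show "monoid ?R"
      by (rule monoidI) (use closed assoc one in \<open>auto simp: simps split: if_splits\<close>)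
  qed (simp_all add: simps distribs)
qed

section \<open>Tensor products of algebras\<close>

text \<open>The formal combinations of pairs form a ring, and centrality of the images of \<open>f\<close> and \<open>g\<close> is what
  makes the bilinearity relations generate an ideal and not only a subgroup.\<close>

locale algebra_tensor = B?: ring B + C?: ring C
  for B :: "('b, 's) ring_scheme" and C :: "('c, 't) ring_scheme" +
  fixes f :: "'a \<Rightarrow> 'b" and g :: "'a \<Rightarrow> 'c"
  assumes f_closed [simp]: "f a \<in> carrier B" and g_closed [simp]: "g a \<in> carrier C"
    and f_central: "b \<in> carrier B \<Longrightarrow> b \<otimes>\<^bsub>B\<^esub> f a = f a \<otimes>\<^bsub>B\<^esub> b"
    and g_central: "c \<in> carrier C \<Longrightarrow> c \<otimes>\<^bsub>C\<^esub> g a = g a \<otimes>\<^bsub>C\<^esub> c"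
begin

abbreviation free :: "('b \<times> 'c \<Rightarrow>\<^sub>0 int) ring" where
  "free \<equiv> monoid_ring (B \<times>\<times> C)"

abbreviation rels :: "('b \<times> 'c \<Rightarrow>\<^sub>0 int) set" where
  "rels \<equiv> tensor_relations f B g C"

definition relators :: "('b \<times> 'c \<Rightarrow>\<^sub>0 int) set" where
  "relators = generate (add_monoid free) rels"

lemma free_ring: "ring free"
  by (intro monoid_ring_is_ring DirProd_monoid B.monoid_axioms C.monoid_axioms)

sublocale free: ring free by (rule free_ring)

lemmas free_simps = carrier_monoid_ring zero_monoid_ring add_monoid_ring one_monoid_ring

lemma free_a_inv: "x \<in> carrier free \<Longrightarrow> \<ominus>\<^bsub>free\<^esub> x = - x"
  by (rule free.minus_equality) (auto simp: free_simps in_keys_iff)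

lemma free_minus: "x \<in> carrier free \<Longrightarrow> y \<in> carrier free \<Longrightarrow> x \<ominus>\<^bsub>free\<^esub> y = x - y"
  by (simp add: a_minus_def free_a_inv add_monoid_ring)

lemma single_closed: "b \<in> carrier B \<Longrightarrow> c \<in> carrier C \<Longrightarrow> Poly_Mapping.single (b, c) v \<in> carrier free"
  by (auto simp: free_simps split: if_splits)

lemma rels_closed: "x \<in> rels \<Longrightarrow> x \<in> carrier free"
  by (induction rule: tensor_relations.induct)
    (simp_all add: free_minus[symmetric] single_closed)

lemma relators_subgroup: "subgroup relators (add_monoid free)"
  unfolding relators_def using rels_closed by (intro free.add.generate_is_subgroup) auto

lemma relators_additive: "additive_subgroup relators free"
  by (rule additive_subgroupI) (rule relators_subgroup)

lemma relators_incl: "x \<in> rels \<Longrightarrow> x \<in> relators"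
  unfolding relators_def by (rule generate.incl)

lemma relators_zero: "0 \<in> relators"
  using additive_subgroup.zero_closed[OF relators_additive] by (simp add: zero_monoid_ring)

lemma relators_closed: "x \<in> relators \<Longrightarrow> x \<in> carrier free"
  using additive_subgroup.a_subset[OF relators_additive] by blast

lemma relators_diff:
  assumes "x \<in> relators" "y \<in> relators"
  shows "x - y \<in> relators"
proof -
  have "\<ominus>\<^bsub>free\<^esub> y \<in> relators"
    using assms(2) additive_subgroup.a_inv_closed[OF relators_additive] free.abelian_group_axioms by blast
  then have "x \<oplus>\<^bsub>free\<^esub> \<ominus>\<^bsub>free\<^esub> y \<in> relators"
    using assms(1) additive_subgroup.a_closed[OF relators_additive] by blast
  then show ?thesis using assms(2) by (simp add: free_a_inv relators_closed add_monoid_ring)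
qed

text \<open>A subgroup is closed under differences, and closure under differences is all that a property has to
  have in order to be inherited by the subgroup from its generators.\<close>

lemma relators_minimal:
  assumes "x \<in> relators"
    and "\<And>h. h \<in> rels \<Longrightarrow> P h" and "P 0"
    and "\<And>x y. x \<in> relators \<Longrightarrow> y \<in> relators \<Longrightarrow> P x \<Longrightarrow> P y \<Longrightarrow> P (x - y)"
  shows "P x"
proof -
  have neg: "P (- y)" if "y \<in> relators" "P y" for y
    using assms(4)[OF relators_zero that(1) assms(3) that(2)] by simp
  have "x \<in> relators \<and> P x"
    using assms(1) unfolding relators_def
  proof (induction rule: generate.induct)
    case one
    then show ?case using relators_zero assms(3) by (simp add: zero_monoid_ring relators_def)
  next
    case (incl h)
    then show ?case using assms(2) by (simp add: generate.incl)
  next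
    case (inv h)
    have "inv\<^bsub>add_monoid free\<^esub> h = - h"
      using inv rels_closed free_a_inv by (simp only: a_inv_def)
    then show ?case
      using neg[OF relators_incl assms(2)] inv relators_diff[OF relators_zero relators_incl]
      by (simp add: relators_def)
  next
    case (eng h1 h2)
    then have h: "h1 \<in> relators" "h2 \<in> relators" "P h1" "P h2" by (simp_all add: relators_def)
    have "P (h1 - (- h2))"
      using h neg relators_diff[OF relators_zero h(2)] by (intro assms(4)) auto
    moreover have "h1 \<oplus>\<^bsub>free\<^esub> h2 \<in> relators"
      using h additive_subgroup.a_closed[OF relators_additive] by blast
    ultimately have "h1 \<oplus>\<^bsub>free\<^esub> h2 \<in> relators \<and> P (h1 \<oplus>\<^bsub>free\<^esub> h2)"
      by (simp add: add_monoid_ring)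
    then show ?case unfolding relators_def by simp
  qed
  then show ?thesis by blast
qed

lemma mult_diff_left:
  fixes x y z :: "'b \<times> 'c \<Rightarrow>\<^sub>0 int"
  shows "(x - y) \<otimes>\<^bsub>free\<^esub> z = x \<otimes>\<^bsub>free\<^esub> z - y \<otimes>\<^bsub>free\<^esub> z"
  using monoid_ring_distrib_right[where M = "B \<times>\<times> C" and f = "x - y" and g = y and h = z] by simp

lemma mult_diff_right:
  fixes x y z :: "'b \<times> 'c \<Rightarrow>\<^sub>0 int"
  shows "z \<otimes>\<^bsub>free\<^esub> (x - y) = z \<otimes>\<^bsub>free\<^esub> x - z \<otimes>\<^bsub>free\<^esub> y"
  using monoid_ring_distrib_left[where M = "B \<times>\<times> C" and f = "x - y" and g = y and h = z] by simp

lemma frag_of_mult_rel: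
  assumes "b0 \<in> carrier B" "c0 \<in> carrier C" "x \<in> rels"
  shows "frag_of (b0, c0) \<otimes>\<^bsub>free\<^esub> x \<in> rels" "x \<otimes>\<^bsub>free\<^esub> frag_of (b0, c0) \<in> rels"
  using assms(3,1,2)
proof (induction rule: tensor_relations.induct)
  case (balanced b c a)
  {
    case 1
    then have "b0 \<otimes>\<^bsub>B\<^esub> (f a \<otimes>\<^bsub>B\<^esub> b) = f a \<otimes>\<^bsub>B\<^esub> (b0 \<otimes>\<^bsub>B\<^esub> b)"
      using balanced f_central[of b0 a] by (simp add: B.m_assoc[symmetric])
    moreover have "c0 \<otimes>\<^bsub>C\<^esub> (g a \<otimes>\<^bsub>C\<^esub> c) = g a \<otimes>\<^bsub>C\<^esub> (c0 \<otimes>\<^bsub>C\<^esub> c)"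
      using 1 balanced g_central[of c0 a] by (simp add: C.m_assoc[symmetric])
    ultimately show ?case using 1 balanced
      by (simp add: mult_diff_right monoid_ring_mult_single tensor_relations.balanced)
  next
    case 2
    then show ?case using balanced
      by (simp add: mult_diff_left monoid_ring_mult_single tensor_relations.balanced B.m_assoc C.m_assoc)
  }
qed (auto simp: mult_diff_left mult_diff_right monoid_ring_mult_single B.r_distr B.l_distr
      C.r_distr C.l_distr intro: tensor_relations.intros)

lemma mult_rel:
  assumes "x \<in> carrier free" "h \<in> rels"
  shows "x \<otimes>\<^bsub>free\<^esub> h \<in> relators \<and> h \<otimes>\<^bsub>free\<^esub> x \<in> relators"
proof (rule frag_induction[of x "carrier B \<times> carrier C"])
  show "Poly_Mapping.keys x \<subseteq> carrier B \<times> carrier C" using assms(1) by (simp add: free_simps)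
qed (use assms(2) relators_zero frag_of_mult_rel in
    \<open>auto simp: mult_diff_left mult_diff_right intro: relators_diff relators_incl\<close>)

lemma relators_ideal: "ideal relators free"
proof (rule idealI)
  have "x \<otimes>\<^bsub>free\<^esub> a \<in> relators \<and> a \<otimes>\<^bsub>free\<^esub> x \<in> relators"
    if "a \<in> relators" and x: "x \<in> carrier free" for a x
    using that(1)
    by (rule relators_minimal)
      (use mult_rel[OF x] relators_zero relators_diff in \<open>auto simp: mult_diff_left mult_diff_right\<close>)
  then show "x \<otimes>\<^bsub>free\<^esub> a \<in> relators" "a \<otimes>\<^bsub>free\<^esub> x \<in> relators"
    if "a \<in> relators" "x \<in> carrier free" for a x using that by blast+
qed (use free_ring relators_subgroup in auto)

sublocale relators: ideal relators free by (rule relators_ideal)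

abbreviation tensor_alg :: "('b \<times> 'c \<Rightarrow>\<^sub>0 int) set ring" where
  "tensor_alg \<equiv> tensor_algebra f B g C"

lemma tensor_alg_quotient: "tensor_alg = free Quot relators"
  by (simp add: tensor_algebra_def relators_def)

lemma tensor_alg_ring: "ring tensor_alg"
  unfolding tensor_alg_quotient by (rule relators.quotient_is_ring)

sublocale T: ring tensor_alg by (rule tensor_alg_ring)

definition coset :: "('b \<times> 'c \<Rightarrow>\<^sub>0 int) \<Rightarrow> ('b \<times> 'c \<Rightarrow>\<^sub>0 int) set" where
  "coset x = relators +>\<^bsub>free\<^esub> x"

lemma coset_hom: "coset \<in> ring_hom free tensor_alg"
  unfolding coset_def[abs_def] tensor_alg_quotient by (rule relators.rcos_ring_hom)

sublocale coset: ring_hom_ring free tensor_alg coset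
  by (rule ring_hom_ringI2) (use coset_hom free_ring tensor_alg_ring in auto)

definition tens :: "'b \<Rightarrow> 'c \<Rightarrow> ('b \<times> 'c \<Rightarrow>\<^sub>0 int) set" where
  "tens b c = coset (frag_of (b, c))"

lemma coset_eqI: "x - y \<in> relators \<Longrightarrow> x \<in> carrier free \<Longrightarrow> y \<in> carrier free \<Longrightarrow> coset x = coset y"
  unfolding coset_def by (rule free.quotient_eq_iff_same_a_r_cos[OF relators_ideal, THEN iffD1]) (auto simp: free_minus)

lemma tens_closed [simp]: "b \<in> carrier B \<Longrightarrow> c \<in> carrier C \<Longrightarrow> tens b c \<in> carrier tensor_alg"
  unfolding tens_def by (simp add: single_closed)

lemma tens_add_left:
  assumes "b \<in> carrier B" "b' \<in> carrier B" "c \<in> carrier C"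
  shows "tens (b \<oplus>\<^bsub>B\<^esub> b') c = tens b c \<oplus>\<^bsub>tensor_alg\<^esub> tens b' c"
proof -
  have "coset (frag_of (b \<oplus>\<^bsub>B\<^esub> b', c)) = coset (frag_of (b, c) \<oplus>\<^bsub>free\<^esub> frag_of (b', c))"
    using relators_incl[OF tensor_relations.add_left[of b B b' c C f g]] assms
    by (intro coset_eqI free.add.m_closed) (auto simp: single_closed add_monoid_ring algebra_simps)
  then show ?thesis using assms by (simp add: tens_def single_closed)
qed

lemma tens_add_right:
  assumes "b \<in> carrier B" "c \<in> carrier C" "c' \<in> carrier C"
  shows "tens b (c \<oplus>\<^bsub>C\<^esub> c') = tens b c \<oplus>\<^bsub>tensor_alg\<^esub> tens b c'"
proof -
  have "coset (frag_of (b, c \<oplus>\<^bsub>C\<^esub> c')) = coset (frag_of (b, c) \<oplus>\<^bsub>free\<^esub> frag_of (b, c'))"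
    using relators_incl[OF tensor_relations.add_right[of b B c C c' f g]] assms
    by (intro coset_eqI free.add.m_closed) (auto simp: single_closed add_monoid_ring algebra_simps)
  then show ?thesis using assms by (simp add: tens_def single_closed)
qed

lemma tens_balanced:
  assumes "b \<in> carrier B" "c \<in> carrier C"
  shows "tens (f a \<otimes>\<^bsub>B\<^esub> b) c = tens b (g a \<otimes>\<^bsub>C\<^esub> c)"
  unfolding tens_def using assms
  by (intro coset_eqI relators_incl tensor_relations.balanced) (auto simp: single_closed)

lemma tens_mult:
  assumes "b \<in> carrier B" "c \<in> carrier C" "b' \<in> carrier B" "c' \<in> carrier C"
  shows "tens b c \<otimes>\<^bsub>tensor_alg\<^esub> tens b' c' = tens (b \<otimes>\<^bsub>B\<^esub> b') (c \<otimes>\<^bsub>C\<^esub> c')"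
  using assms coset.hom_mult[of "frag_of (b, c)" "frag_of (b', c')"]
  by (simp add: tens_def single_closed monoid_ring_mult_single)

lemma tens_one: "\<one>\<^bsub>tensor_alg\<^esub> = tens \<one>\<^bsub>B\<^esub> \<one>\<^bsub>C\<^esub>"
  using coset.hom_one by (simp add: tens_def one_monoid_ring)

lemma carrier_tensor_alg: "carrier tensor_alg = coset ` carrier free"
  by (auto simp: tensor_alg_quotient FactRing_def A_RCOSETS_def' coset_def)

text \<open>The differences in the induction step spare a separate case for integer multiples.\<close>

lemma tensor_alg_induct [consumes 1, case_names zero tens diff]:
  assumes t: "t \<in> carrier tensor_alg"
    and zero: "P \<zero>\<^bsub>tensor_alg\<^esub>"
    and tens: "\<And>b c. b \<in> carrier B \<Longrightarrow> c \<in> carrier C \<Longrightarrow> P (tens b c)"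
    and diff: "\<And>s t. s \<in> carrier tensor_alg \<Longrightarrow> t \<in> carrier tensor_alg \<Longrightarrow> P s \<Longrightarrow> P t \<Longrightarrow>
      P (s \<ominus>\<^bsub>tensor_alg\<^esub> t)"
  shows "P t"
proof -
  obtain x where x: "t = coset x" "x \<in> carrier free" using t by (auto simp: carrier_tensor_alg)
  have "x \<in> carrier free \<and> P (coset x)"
  proof (rule frag_induction[of x "carrier B \<times> carrier C"])
    show "Poly_Mapping.keys x \<subseteq> carrier B \<times> carrier C" using x by (simp add: free_simps)
    show "0 \<in> carrier free \<and> P (coset 0)"
      using zero coset.hom_zero free.zero_closed by (simp add: zero_monoid_ring)
    show "frag_of p \<in> carrier free \<and> P (coset (frag_of p))" if "p \<in> carrier B \<times> carrier C" for p
      using that tens single_closed by (cases p) (auto simp: tens_def)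
    fix a b assume a: "a \<in> carrier free \<and> P (coset a)" and b: "b \<in> carrier free \<and> P (coset b)"
    then have "P (coset (a \<ominus>\<^bsub>free\<^esub> b))"
      using diff[of "coset a" "coset b"] by (simp add: a_minus_def)
    then show "a - b \<in> carrier free \<and> P (coset (a - b))"
      using a b free.minus_closed[of a b] by (simp add: free_minus)
  qed
  then show ?thesis using x by simp
qed

end

section \<open>The braids and ties algebra satisfies its relations\<close>

lemma word_monoid_is_monoid: "monoid (word_monoid G)"
  by (rule monoidI) (auto simp: word_monoid_def)

abbreviation bt_gens :: "nat \<Rightarrow> bt_gen set" where
  "bt_gens n \<equiv> TGen ` {1..<n} \<union> EGen ` {1..<n}"

lemma bt_free_carrier: "carrier (bt_free_algebra n) = {f. Poly_Mapping.keys f \<subseteq> lists (bt_gens n)}"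
  by (simp add: bt_free_algebra_def carrier_monoid_ring word_monoid_def)

lemma bt_free_single: "Poly_Mapping.single v a \<otimes>\<^bsub>bt_free_algebra n\<^esub> Poly_Mapping.single w b =
    Poly_Mapping.single (v @ w) (a * b)"
  by (simp add: bt_free_algebra_def monoid_ring_mult_single word_monoid_def)

lemma bt_free_add: "x \<oplus>\<^bsub>bt_free_algebra n\<^esub> y = x + y"
  and bt_free_zero: "\<zero>\<^bsub>bt_free_algebra n\<^esub> = 0"
  and bt_free_one: "\<one>\<^bsub>bt_free_algebra n\<^esub> = bt_const 1"
  by (simp_all add: bt_free_algebra_def add_monoid_ring zero_monoid_ring one_monoid_ring word_monoid_def)

lemma bt_free_single_closed [simp]:
  "w \<in> lists (bt_gens n) \<Longrightarrow> Poly_Mapping.single w a \<in> carrier (bt_free_algebra n)"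
  by (simp add: bt_free_carrier)

lemma bt_free_distribs:
  "(f + g) \<otimes>\<^bsub>bt_free_algebra n\<^esub> h = f \<otimes>\<^bsub>bt_free_algebra n\<^esub> h + g \<otimes>\<^bsub>bt_free_algebra n\<^esub> h"
  "h \<otimes>\<^bsub>bt_free_algebra n\<^esub> (f + g) = h \<otimes>\<^bsub>bt_free_algebra n\<^esub> f + h \<otimes>\<^bsub>bt_free_algebra n\<^esub> g"
  "0 \<otimes>\<^bsub>bt_free_algebra n\<^esub> f = 0" "f \<otimes>\<^bsub>bt_free_algebra n\<^esub> 0 = 0"
  by (simp_all add: bt_free_algebra_def monoid_ring_distrib_right monoid_ring_distrib_left)

text \<open>Within this context \<open>F\<close> is the free algebra, \<open>A\<close> its quotient over the Laurent polynomials, \<open>R\<close> the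
  algebra over the rational functions and, later, \<open>V\<close> the tensor space.\<close>

locale bt_setting =
  fixes n :: nat
begin

abbreviation F :: "bt_free ring" where "F \<equiv> bt_free_algebra n"

sublocale F: ring F
  unfolding bt_free_algebra_def by (intro monoid_ring_is_ring word_monoid_is_monoid)

lemma F_minus: "x \<in> carrier F \<Longrightarrow> y \<in> carrier F \<Longrightarrow> x \<ominus>\<^bsub>F\<^esub> y = x - y"
proof -
  assume xy: "x \<in> carrier F" "y \<in> carrier F"
  have "\<ominus>\<^bsub>F\<^esub> y = - y"
    using xy by (intro F.minus_equality) (auto simp: bt_free_add bt_free_zero bt_free_carrier in_keys_iff)
  then show ?thesis by (simp add: a_minus_def bt_free_add)
qed

lemma F_generator_closed [simp]:
  "i \<in> {1..<n} \<Longrightarrow> bt_T i \<in> carrier F" "i \<in> {1..<n} \<Longrightarrow> bt_E i \<in> carrier F" "bt_const a \<in> carrier F"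
  by auto

lemma F_plus_closed [simp]: "x \<in> carrier F \<Longrightarrow> y \<in> carrier F \<Longrightarrow> x + y \<in> carrier F"
  using F.a_closed[of x y] by (simp add: bt_free_add)

lemma bt_relation_closed: "bt_relation n x y \<Longrightarrow> x \<in> carrier F \<and> y \<in> carrier F"
  by (induction rule: bt_relation.induct) (simp_all del: atLeastLessThan_iff)

lemma bt_relators_closed: "{x - y | x y. bt_relation n x y} \<subseteq> carrier F"
  using bt_relation_closed F.minus_closed by (fastforce simp: F_minus[symmetric])

sublocale I: ideal "bt_ideal n" F
  unfolding bt_ideal_def by (rule F.genideal_ideal[OF bt_relators_closed])

abbreviation A :: "bt_free set ring" where "A \<equiv> bt_algebra_laurent n"

sublocale A: ring A
  unfolding bt_algebra_laurent_def by (rule I.quotient_is_ring)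

definition cl :: "bt_free \<Rightarrow> bt_free set" where
  "cl x = bt_ideal n +>\<^bsub>F\<^esub> x"

sublocale cl: ring_hom_ring F A cl
proof (rule ring_hom_ringI2)
  show "cl \<in> ring_hom F A"
    unfolding cl_def[abs_def] bt_algebra_laurent_def by (rule I.rcos_ring_hom)
qed (rule F.ring_axioms A.ring_axioms)+

lemma cl_relation:
  assumes "bt_relation n x y"
  shows "cl x = cl y"
proof -
  have "x \<ominus>\<^bsub>F\<^esub> y \<in> bt_ideal n"
    using assms bt_relation_closed[OF assms] F.genideal_self[OF bt_relators_closed]
    unfolding bt_ideal_def by (auto simp: F_minus)
  then show ?thesis
    unfolding cl_def using bt_relation_closed[OF assms]
    by (intro F.quotient_eq_iff_same_a_r_cos[OF I.ideal_axioms, THEN iffD1]) auto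
qed

lemma carrier_A: "carrier A = cl ` carrier F"
  by (auto simp: bt_algebra_laurent_def FactRing_def A_RCOSETS_def' cl_def)

lemma bt_scalar_cl: "bt_scalar n a = cl (bt_const a)"
  by (simp add: bt_scalar_def cl_def)

lemma bt_const_central:
  "x \<otimes>\<^bsub>F\<^esub> bt_const a = bt_const a \<otimes>\<^bsub>F\<^esub> x"
proof -
  have "Poly_Mapping.keys x \<subseteq> UNIV" by simp
  then show ?thesis
    by (induction rule: poly_mapping_single_induct)
      (simp_all add: bt_free_single mult.commute bt_free_distribs)
qed

lemma bt_scalar_central: "b \<in> carrier A \<Longrightarrow> b \<otimes>\<^bsub>A\<^esub> bt_scalar n a = bt_scalar n a \<otimes>\<^bsub>A\<^esub> b"
  unfolding carrier_A bt_scalar_cl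
  using bt_const_central by (auto simp flip: cl.hom_mult)

sublocale K: ring "ring_of_type_algebra :: ratfun ring"
  by (rule ring_from_type_algebra)

lemma K_simps: "carrier (ring_of_type_algebra :: ratfun ring) = UNIV"
  "x \<otimes>\<^bsub>ring_of_type_algebra\<^esub> y = x * (y :: ratfun)"
  "x \<oplus>\<^bsub>ring_of_type_algebra\<^esub> y = x + (y :: ratfun)"
  "\<one>\<^bsub>ring_of_type_algebra\<^esub> = (1 :: ratfun)"
  "\<zero>\<^bsub>ring_of_type_algebra\<^esub> = (0 :: ratfun)"
  by (simp_all add: ring_of_type_algebra_def)

sublocale tp: algebra_tensor A "ring_of_type_algebra :: ratfun ring" "bt_scalar n" laurent_to_ratfun
  by unfold_locales (auto simp: bt_scalar_central K_simps mult.commute, simp add: bt_scalar_cl)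

abbreviation R :: "(bt_free set \<times> ratfun \<Rightarrow>\<^sub>0 int) set ring" where "R \<equiv> bt_algebra n"

lemma R_eq: "R = tp.tensor_alg"
  by (simp add: bt_algebra_def)

sublocale R: ring R
  unfolding R_eq by (rule tp.tensor_alg_ring)

definition scalar :: "ratfun \<Rightarrow> (bt_free set \<times> ratfun \<Rightarrow>\<^sub>0 int) set" where
  "scalar c = tp.tens \<one>\<^bsub>A\<^esub> c"

text \<open>The class of an element of the free algebra in the algebra over the field of rational functions.\<close>

definition bt_class :: "bt_free \<Rightarrow> (bt_free set \<times> ratfun \<Rightarrow>\<^sub>0 int) set" where
  "bt_class x = tp.tens (cl x) 1"

lemma scalar_closed [simp]: "scalar c \<in> carrier R"
  by (simp add: scalar_def R_eq K_simps)

lemma bt_class_closed [simp]: "x \<in> carrier F \<Longrightarrow> bt_class x \<in> carrier R"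
  by (simp add: bt_class_def R_eq K_simps)

lemma scalar_add: "scalar (c + d) = scalar c \<oplus>\<^bsub>R\<^esub> scalar d"
  using tp.tens_add_right[of "\<one>\<^bsub>A\<^esub>" c d] by (simp add: scalar_def R_eq K_simps)

lemma scalar_mult: "scalar (c * d) = scalar c \<otimes>\<^bsub>R\<^esub> scalar d"
  by (simp add: scalar_def R_eq K_simps tp.tens_mult)

lemma scalar_one: "scalar 1 = \<one>\<^bsub>R\<^esub>"
  by (simp add: scalar_def R_eq K_simps tp.tens_one)

lemma scalar_tens: "b \<in> carrier A \<Longrightarrow> scalar c \<otimes>\<^bsub>R\<^esub> tp.tens b d = tp.tens b (c * d)"
  by (simp add: scalar_def R_eq K_simps tp.tens_mult)

lemma scalar_central: "x \<in> carrier R \<Longrightarrow> x \<otimes>\<^bsub>R\<^esub> scalar c = scalar c \<otimes>\<^bsub>R\<^esub> x"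
  unfolding R_eq
proof (induction rule: tp.tensor_alg_induct)
  case (tens b d)
  then show ?case by (simp add: scalar_def K_simps tp.tens_mult mult.commute)
next
  case (diff s t)
  then show ?case using scalar_closed[of c]
    by (simp add: R_eq a_minus_def tp.T.r_distr tp.T.l_distr tp.T.l_minus tp.T.r_minus)
qed (use scalar_closed in \<open>simp add: R_eq\<close>)

lemma bt_class_mult:
  "x \<in> carrier F \<Longrightarrow> y \<in> carrier F \<Longrightarrow> bt_class (x \<otimes>\<^bsub>F\<^esub> y) = bt_class x \<otimes>\<^bsub>R\<^esub> bt_class y"
  by (simp add: bt_class_def R_eq K_simps tp.tens_mult)

lemma bt_class_add:
  "x \<in> carrier F \<Longrightarrow> y \<in> carrier F \<Longrightarrow> bt_class (x + y) = bt_class x \<oplus>\<^bsub>R\<^esub> bt_class y"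
  using tp.tens_add_left[of "cl x" "cl y" 1] cl.hom_add[of x y]
  by (simp add: bt_class_def R_eq K_simps bt_free_add)

lemma bt_class_const: "bt_class (bt_const a) = scalar (laurent_to_ratfun a)"
  using tp.tens_balanced[of "\<one>\<^bsub>A\<^esub>" 1 a]
  by (simp add: bt_class_def scalar_def K_simps bt_scalar_cl)

lemma bt_class_relation: "bt_relation n x y \<Longrightarrow> bt_class x = bt_class y"
  by (simp add: bt_class_def cl_relation)

lemmas bt_class_simps = bt_class_mult bt_class_add bt_class_const scalar_one laurent_to_ratfun_minus
  laurent_to_ratfun_u

sublocale bt: braids_and_ties R n scalar u_ratfun "\<lambda>i. bt_class (bt_T i)" "\<lambda>i. bt_class (bt_E i)"
proof unfold_locales
  fix i j assume i: "i \<in> {1..<n}" and j: "j \<in> {1..<n}"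
  note [simp] = F_generator_closed(1,2)[OF i] F_generator_closed(1,2)[OF j]
  let ?T = "\<lambda>i. bt_class (bt_T i)" and ?E = "\<lambda>i. bt_class (bt_E i)"
  show "?E i \<otimes>\<^bsub>R\<^esub> ?E j = ?E j \<otimes>\<^bsub>R\<^esub> ?E i"
    using bt_class_relation[OF bt_relation.E2[OF i j]] by (simp add: bt_class_simps)
  {
    assume far: "far i j"
    show "?T i \<otimes>\<^bsub>R\<^esub> ?T j = ?T j \<otimes>\<^bsub>R\<^esub> ?T i"
      using bt_class_relation[OF bt_relation.E1[OF i j far]] by (simp add: bt_class_simps)
    show "?E i \<otimes>\<^bsub>R\<^esub> ?T j = ?T j \<otimes>\<^bsub>R\<^esub> ?E i"
      using bt_class_relation[OF bt_relation.E3[OF i j far]] by (simp add: bt_class_simps)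
  }
  {
    assume adj: "adjacent i j"
    show "?T i \<otimes>\<^bsub>R\<^esub> ?T j \<otimes>\<^bsub>R\<^esub> ?T i = ?T j \<otimes>\<^bsub>R\<^esub> ?T i \<otimes>\<^bsub>R\<^esub> ?T j"
      using bt_class_relation[OF bt_relation.E6[OF i j adj]] by (simp add: bt_class_simps)
    show "?E j \<otimes>\<^bsub>R\<^esub> ?T i \<otimes>\<^bsub>R\<^esub> ?T j = ?T i \<otimes>\<^bsub>R\<^esub> ?T j \<otimes>\<^bsub>R\<^esub> ?E i"
      using bt_class_relation[OF bt_relation.E7[OF i j adj]] by (simp add: bt_class_simps)
    show "?E i \<otimes>\<^bsub>R\<^esub> ?E j \<otimes>\<^bsub>R\<^esub> ?T j = ?E i \<otimes>\<^bsub>R\<^esub> ?T j \<otimes>\<^bsub>R\<^esub> ?E i"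
      using bt_class_relation[OF bt_relation.E8a[OF i j adj]] by (simp add: bt_class_simps)
    show "?E i \<otimes>\<^bsub>R\<^esub> ?T j \<otimes>\<^bsub>R\<^esub> ?E i = ?T j \<otimes>\<^bsub>R\<^esub> ?E i \<otimes>\<^bsub>R\<^esub> ?E j"
      using bt_class_relation[OF bt_relation.E8b[OF i j adj]] by (simp add: bt_class_simps)
  }
next
  fix i assume i: "i \<in> {1..<n}"
  note [simp] = F_generator_closed(1,2)[OF i]
  let ?T = "bt_class (bt_T i)" and ?E = "bt_class (bt_E i)"
  show "?T \<in> carrier R" "?E \<in> carrier R" by simp_all
  show "?E \<otimes>\<^bsub>R\<^esub> ?E = ?E"
    using bt_class_relation[OF bt_relation.E4[OF i]] by (simp add: bt_class_simps)
  show "?E \<otimes>\<^bsub>R\<^esub> ?T = ?T \<otimes>\<^bsub>R\<^esub> ?E"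
    using bt_class_relation[OF bt_relation.E5[OF i]] by (simp add: bt_class_simps)
  show "?T \<otimes>\<^bsub>R\<^esub> ?T = \<one>\<^bsub>R\<^esub> \<oplus>\<^bsub>R\<^esub> scalar (u_ratfun - 1) \<otimes>\<^bsub>R\<^esub> (?E \<otimes>\<^bsub>R\<^esub> (\<one>\<^bsub>R\<^esub> \<oplus>\<^bsub>R\<^esub> ?T))"
    using bt_class_relation[OF bt_relation.E9[OF i]]
    by (simp add: bt_class_simps R.m_assoc)
qed (rule scalar_closed scalar_add scalar_mult scalar_one scalar_central u_ratfun_nonzero, assumption?)+

lemma bt_class_word_in_span: "w \<in> lists (bt_gens n) \<Longrightarrow> bt_class (Poly_Mapping.single w 1) \<in> bt.span n"
proof (induction w)
  case Nil
  then show ?case using bt.one_in_span bt_class_const[of 1] by (simp add: scalar_one)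
next
  case (Cons g w)
  then have g: "g \<in> bt_gens n" and w: "w \<in> lists (bt_gens n)" by auto
  have "bt_class (Poly_Mapping.single (g # w) 1) =
    bt_class (Poly_Mapping.single [g] 1) \<otimes>\<^bsub>R\<^esub> bt_class (Poly_Mapping.single w 1)"
    using bt_class_mult[of "Poly_Mapping.single [g] 1" "Poly_Mapping.single w 1"] g w
    by (simp add: bt_free_single)
  moreover have IH: "bt_class (Poly_Mapping.single w 1) \<in> bt.span n" using Cons.IH w by blast
  moreover have "bt_class (Poly_Mapping.single [g] 1) \<otimes>\<^bsub>R\<^esub> bt_class (Poly_Mapping.single w 1) \<in> bt.span n"
    using g bt.span_T[OF _ IH] bt.span_E[OF _ IH] by blast
  ultimately show ?case by simp
qed

text \<open>The coefficients of a word, which are Laurent polynomials, are moved by balancing to the second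
  tensor factor, where they become scalars.\<close>

lemma tens_in_span:
  assumes "x \<in> carrier F"
  shows "tp.tens (cl x) c \<in> bt.span n"
proof -
  have "Poly_Mapping.keys x \<subseteq> lists (bt_gens n)" using assms by (simp add: bt_free_carrier)
  then show ?thesis
  proof (induction rule: poly_mapping_single_induct)
    case zero
    have "cl 0 = \<zero>\<^bsub>A\<^esub>" using cl.hom_zero by (simp add: bt_free_zero)
    moreover have "tp.tens \<zero>\<^bsub>A\<^esub> c \<oplus>\<^bsub>R\<^esub> tp.tens \<zero>\<^bsub>A\<^esub> c = tp.tens \<zero>\<^bsub>A\<^esub> c"
      using tp.tens_add_left[of "\<zero>\<^bsub>A\<^esub>" "\<zero>\<^bsub>A\<^esub>" c] by (simp add: R_eq K_simps)
    moreover have "tp.tens \<zero>\<^bsub>A\<^esub> c \<in> carrier R" by (simp add: R_eq K_simps)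
    ultimately have "tp.tens (cl 0) c = \<zero>\<^bsub>R\<^esub>" using R.add.r_cancel_one[of "tp.tens \<zero>\<^bsub>A\<^esub> c" "tp.tens \<zero>\<^bsub>A\<^esub> c"] by simp
    then show ?case by (simp add: bt.span.zero)
  next
    case (single_add w a f)
    have f: "f \<in> carrier F" and w: "Poly_Mapping.single w a \<in> carrier F"
      and w1: "Poly_Mapping.single w 1 \<in> carrier F"
      using single_add by (simp_all add: bt_free_carrier)
    have "Poly_Mapping.single w a = bt_const a \<otimes>\<^bsub>F\<^esub> Poly_Mapping.single w 1"
      by (simp add: bt_free_single)
    then have "tp.tens (cl (Poly_Mapping.single w a)) c =
      tp.tens (bt_scalar n a \<otimes>\<^bsub>A\<^esub> cl (Poly_Mapping.single w 1)) c"
      using w1 by (simp add: bt_scalar_cl)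
    also have "\<dots> = tp.tens (cl (Poly_Mapping.single w 1)) (laurent_to_ratfun a * c)"
      using w1 by (subst tp.tens_balanced) (simp_all add: K_simps)
    also have "\<dots> = scalar (laurent_to_ratfun a * c) \<otimes>\<^bsub>R\<^esub> bt_class (Poly_Mapping.single w 1)"
      using w1 by (simp add: bt_class_def scalar_tens)
    also have "\<dots> \<in> bt.span n"
      using single_add(1) by (intro bt.span_scale bt_class_word_in_span) auto
    finally have "tp.tens (cl (Poly_Mapping.single w a)) c \<in> bt.span n" .
    moreover have "tp.tens (cl (Poly_Mapping.single w a + f)) c =
      tp.tens (cl (Poly_Mapping.single w a)) c \<oplus>\<^bsub>R\<^esub> tp.tens (cl f) c"
      using tp.tens_add_left[of "cl (Poly_Mapping.single w a)" "cl f" c] w f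
        cl.hom_add[of "Poly_Mapping.single w a" f] by (simp add: R_eq K_simps bt_free_add)
    ultimately show ?case using single_add.IH by (simp add: bt.span_add)
  qed
qed

lemma carrier_R_in_span:
  assumes "t \<in> carrier R"
  shows "t \<in> bt.span n"
proof -
  have "t \<in> carrier tp.tensor_alg" using assms by (simp add: R_eq)
  then show ?thesis
  proof (induction rule: tp.tensor_alg_induct)
  case zero
  then show ?case unfolding R_eq[symmetric] by (rule bt.span.zero)
next
  case (tens b c)
  then show ?case using tens_in_span by (auto simp: carrier_A)
next
  case (diff s t)
  note st = diff[folded R_eq]
  have "scalar (- 1) \<oplus>\<^bsub>R\<^esub> scalar 1 = scalar 0"
    by (simp flip: scalar_add)
  then have "scalar (- 1) \<oplus>\<^bsub>R\<^esub> \<one>\<^bsub>R\<^esub> = \<zero>\<^bsub>R\<^esub>"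
    by (simp only: scalar_one bt.sc_zero)
  then have "scalar (- 1) = \<ominus>\<^bsub>R\<^esub> \<one>\<^bsub>R\<^esub>" by (intro R.minus_equality[symmetric]) auto
  then have "s \<ominus>\<^bsub>R\<^esub> t = s \<oplus>\<^bsub>R\<^esub> scalar (- 1) \<otimes>\<^bsub>R\<^esub> t"
    using st(1,2) by (simp add: a_minus_def R.l_minus)
  then show ?case unfolding R_eq[symmetric] using st by (simp add: bt.span_add bt.span_scale)
  qed
qed

end

section \<open>Linear operators on tensor space\<close>

lemma lookup_scale_tensor: "Poly_Mapping.lookup (scale_tensor c x) w = c * Poly_Mapping.lookup x w"
  by (simp add: scale_tensor_def Poly_Mapping.map.rep_eq when_def)

lemma scale_tensor_add_right: "scale_tensor c (x + y) = scale_tensor c x + scale_tensor c y"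
  by (rule poly_mapping_eqI) (simp add: lookup_scale_tensor lookup_add distrib_left)

lemma scale_tensor_add_left: "scale_tensor (c + d) x = scale_tensor c x + scale_tensor d x"
  by (rule poly_mapping_eqI) (simp add: lookup_scale_tensor lookup_add distrib_right)

lemma scale_tensor_scale: "scale_tensor c (scale_tensor d x) = scale_tensor (c * d) x"
  by (rule poly_mapping_eqI) (simp add: lookup_scale_tensor)

lemma scale_tensor_one [simp]: "scale_tensor 1 x = x"
  by (rule poly_mapping_eqI) (simp add: lookup_scale_tensor)

lemma scale_tensor_zero [simp]: "scale_tensor 0 x = 0" "scale_tensor c 0 = 0"
  by (rule poly_mapping_eqI, simp add: lookup_scale_tensor)+

lemma scale_tensor_single [simp]:
  "scale_tensor c (Poly_Mapping.single w d) = Poly_Mapping.single w (c * d)"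
  by (rule poly_mapping_eqI) (simp add: lookup_scale_tensor lookup_single when_def)

lemma scale_tensor_sum: "scale_tensor c (\<Sum>i\<in>I. f i) = (\<Sum>i\<in>I. scale_tensor c (f i))"
  by (induction I rule: infinite_finite_induct) (simp_all add: scale_tensor_add_right)

lemma scale_tensor_diff: "scale_tensor c (x - y) = scale_tensor c x - scale_tensor c y"
  by (rule poly_mapping_eqI) (simp add: lookup_scale_tensor lookup_minus right_diff_distrib)

lemma keys_scale_tensor: "Poly_Mapping.keys (scale_tensor c x) \<subseteq> Poly_Mapping.keys x"
  by (auto simp: in_keys_iff lookup_scale_tensor)

definition tensor_linear :: "(tensor \<Rightarrow> tensor) \<Rightarrow> bool" where
  "tensor_linear h \<longleftrightarrow> (\<forall>x y. h (x + y) = h x + h y) \<and> (\<forall>c x. h (scale_tensor c x) = scale_tensor c (h x))"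

lemma tensor_linearD:
  assumes "tensor_linear h"
  shows "h (x + y) = h x + h y" "h (scale_tensor c x) = scale_tensor c (h x)" "h 0 = 0"
proof -
  show "h (x + y) = h x + h y" "h (scale_tensor c x) = scale_tensor c (h x)"
    using assms by (auto simp: tensor_linear_def)
  have "h (scale_tensor 0 0) = scale_tensor 0 (h 0)"
    using assms unfolding tensor_linear_def by blast
  then show "h 0 = 0" by simp
qed

lemma tensor_linear_compose: "tensor_linear h \<Longrightarrow> tensor_linear h' \<Longrightarrow> tensor_linear (\<lambda>x. h (h' x))"
  by (simp add: tensor_linear_def)

lemma tensor_linear_scale: "tensor_linear h \<Longrightarrow> tensor_linear (\<lambda>x. scale_tensor c (h x))"
  by (simp add: tensor_linear_def scale_tensor_add_right scale_tensor_scale mult.commute)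

lemma tensor_linear_id: "tensor_linear (\<lambda>x. x)"
  by (simp add: tensor_linear_def)

lemma tensor_linear_sum: "(\<And>i. i \<in> I \<Longrightarrow> tensor_linear (h i)) \<Longrightarrow> tensor_linear (\<lambda>x. \<Sum>i\<in>I. h i x)"
  by (simp add: tensor_linear_def scale_tensor_sum sum.distrib)

lemma tensor_linear_eqI:
  assumes "tensor_linear h" "tensor_linear h'" "Poly_Mapping.keys x \<subseteq> S"
    and "\<And>w. w \<in> S \<Longrightarrow> h (pure_tensor w) = h' (pure_tensor w)"
  shows "h x = h' x"
  using assms(3)
proof (induction rule: poly_mapping_single_induct)
  case (single_add w c x)
  have "Poly_Mapping.single w c = scale_tensor c (pure_tensor w)" by simp
  then show ?case
    using single_add assms(4)[of w]
    by (simp only: tensor_linearD[OF assms(1)] tensor_linearD[OF assms(2)])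
qed (simp add: tensor_linearD[OF assms(1)] tensor_linearD[OF assms(2)])

lemma tensor_linear_keys:
  assumes "tensor_linear h" "Poly_Mapping.keys x \<subseteq> S"
    and "\<And>w. w \<in> S \<Longrightarrow> Poly_Mapping.keys (h (pure_tensor w)) \<subseteq> S'"
  shows "Poly_Mapping.keys (h x) \<subseteq> S'"
  using assms(2)
proof (induction rule: poly_mapping_single_induct)
  case (single_add w c x)
  have "Poly_Mapping.single w c = scale_tensor c (pure_tensor w)" by simp
  then have "h (Poly_Mapping.single w c + x) = scale_tensor c (h (pure_tensor w)) + h x"
    by (simp only: tensor_linearD[OF assms(1)])
  then show ?case
    using single_add assms(3)[of w] keys_scale_tensor by (simp only:) (intro keys_add_subset, blast+)
qed (simp add: tensor_linearD[OF assms(1)])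

lemma linear_extension_lift_sum:
  "linear_extension \<phi> = lift_sum (\<lambda>w c. scale_tensor c (\<phi> w))"
  by (simp add: fun_eq_iff linear_extension_def lift_sum_def)

lemma linear_extension_add: "linear_extension \<phi> (x + y) = linear_extension \<phi> x + linear_extension \<phi> y"
  unfolding linear_extension_lift_sum by (rule lift_sum_add) (simp_all add: scale_tensor_add_left)

lemma linear_extension_single: "linear_extension \<phi> (Poly_Mapping.single w c) = scale_tensor c (\<phi> w)"
  unfolding linear_extension_lift_sum by (rule lift_sum_single) simp

lemma linear_extension_zero [simp]: "linear_extension \<phi> 0 = 0"
  by (simp add: linear_extension_def)

lemma tensor_linear_linear_extension: "tensor_linear (linear_extension \<phi>)"
proof -
  have "linear_extension \<phi> (scale_tensor c x) = scale_tensor c (linear_extension \<phi> x)" for c x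
  proof -
    have "Poly_Mapping.keys x \<subseteq> UNIV" by simp
    then show ?thesis
      by (induction rule: poly_mapping_single_induct)
        (simp_all add: scale_tensor_add_right linear_extension_add linear_extension_single scale_tensor_scale)
  qed
  then show ?thesis by (simp add: tensor_linear_def linear_extension_add)
qed

lemma tensor_linear_gen_action: "tensor_linear (gen_action g)"
  by (cases g) (simp_all add: act_in_factors_def tensor_linear_linear_extension)

lemma tensor_linear_word: "tensor_linear (foldr gen_action w)"
proof (induction w)
  case Nil
  then show ?case by (simp add: tensor_linear_def)
next
  case (Cons g w)
  then show ?case using tensor_linear_compose[OF tensor_linear_gen_action] by (simp add: comp_def)
qed

section \<open>The operators in coordinates\<close>

text \<open>\<open>T (x \<otimes> y) = T_swap x y \<cdot> (y \<otimes> x) + T_stay x y \<cdot> (x \<otimes> y)\<close>. For \<open>x = y\<close>, where the two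
  tensors on the right coincide, the whole eigenvalue is put into \<open>T_stay\<close>; with this choice the
  relations of the algebra hold coefficient by coefficient, as if the permutations of a tensor
  were always distinct.\<close>

definition T_swap :: "index \<Rightarrow> index \<Rightarrow> ratfun" where
  "T_swap x y = (if snd x \<noteq> snd y then 1 else if fst x < fst y then 1 else if fst x = fst y then 0 else u_ratfun)"

definition T_stay :: "index \<Rightarrow> index \<Rightarrow> ratfun" where
  "T_stay x y = (if snd x \<noteq> snd y then 0 else if fst x < fst y then 0 else if fst x = fst y then u_ratfun else u_ratfun - 1)"

definition E_stay :: "index \<Rightarrow> index \<Rightarrow> ratfun" where
  "E_stay x y = (if snd x = snd y then 1 else 0)"

lemma T_basis_coeffs:
  "T_basis x y = Poly_Mapping.single [y, x] (T_swap x y) + Poly_Mapping.single [x, y] (T_stay x y)"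
  by (cases x; cases y) (auto simp: T_swap_def T_stay_def)

lemma E_basis_coeffs: "E_basis x y = Poly_Mapping.single [x, y] (E_stay x y)"
  by (cases x; cases y) (auto simp: E_stay_def)

lemma act_in_factors_single:
  assumes "k = Suc (length p)"
  shows "act_in_factors k \<phi> (Poly_Mapping.single (p @ x # y # s) c) =
    scale_tensor c (linear_extension (\<lambda>z. pure_tensor (p @ z @ s)) (\<phi> x y))"
  using assms by (simp add: act_in_factors_def linear_extension_single nth_append)

lemma T_action_single:
  assumes "k = Suc (length p)"
  shows "gen_action (TGen k) (Poly_Mapping.single (p @ x # y # s) c) =
    Poly_Mapping.single (p @ y # x # s) (c * T_swap x y) + Poly_Mapping.single (p @ x # y # s) (c * T_stay x y)"
  using act_in_factors_single[OF assms, of T_basis x y s c]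
  by (simp add: T_basis_coeffs linear_extension_add linear_extension_single scale_tensor_add_right)

lemma E_action_single:
  assumes "k = Suc (length p)"
  shows "gen_action (EGen k) (Poly_Mapping.single (p @ x # y # s) c) =
    Poly_Mapping.single (p @ x # y # s) (c * E_stay x y)"
  using act_in_factors_single[OF assms, of E_basis x y s c]
  by (simp add: E_basis_coeffs linear_extension_single)

lemma T_action_single':
  assumes "k = Suc (Suc (length p))"
  shows "gen_action (TGen k) (Poly_Mapping.single (p @ x # y # z # s) c) =
    Poly_Mapping.single (p @ x # z # y # s) (c * T_swap y z) + Poly_Mapping.single (p @ x # y # z # s) (c * T_stay y z)"
  using T_action_single[of k "p @ [x]" y z s c] assms by simp

lemma E_action_single':
  assumes "k = Suc (Suc (length p))"
  shows "gen_action (EGen k) (Poly_Mapping.single (p @ x # y # z # s) c) =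
    Poly_Mapping.single (p @ x # y # z # s) (c * E_stay y z)"
  using E_action_single[of k "p @ [x]" y z s c] assms by simp

lemma T_action_single_far:
  assumes "k = length p + length r + 3"
  shows "gen_action (TGen k) (Poly_Mapping.single (p @ x # y # r @ z # t # s) c) =
    Poly_Mapping.single (p @ x # y # r @ t # z # s) (c * T_swap z t) + Poly_Mapping.single (p @ x # y # r @ z # t # s) (c * T_stay z t)"
  using T_action_single[of k "p @ x # y # r" z t s c] assms by simp

lemma E_action_single_far:
  assumes "k = length p + length r + 3"
  shows "gen_action (EGen k) (Poly_Mapping.single (p @ x # y # r @ z # t # s) c) =
    Poly_Mapping.single (p @ x # y # r @ z # t # s) (c * E_stay z t)"
  using E_action_single[of k "p @ x # y # r" z t s c] assms by simp

lemmas gen_action_add = tensor_linearD(1)[OF tensor_linear_gen_action]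
lemmas gen_action_scale = tensor_linearD(2)[OF tensor_linear_gen_action]
lemmas gen_action_zero [simp] = tensor_linearD(3)[OF tensor_linear_gen_action]

definition words :: "nat \<Rightarrow> index list set" where
  "words n = {w. length w = n \<and> set w \<subseteq> {1..n} \<times> {1..n}}"

lemma split_word_at:
  assumes "i \<in> {1..<length w}"
  obtains p x y s where "w = p @ x # y # s" "i = Suc (length p)"
proof -
  have "drop i w = w ! i # drop (Suc i) w" using assms Cons_nth_drop_Suc[of i w] by simp
  moreover have "i - 1 < length w" "Suc (i - 1) = i" using assms by auto
  ultimately have "w = take (i - 1) w @ w ! (i - 1) # w ! i # drop (Suc i) w"
    by (metis id_take_nth_drop)
  moreover have "i = Suc (length (take (i - 1) w))" using assms by auto
  ultimately show thesis by (rule that)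
qed

lemma split_word_at_two:
  assumes "i \<in> {1..<length w}" "j \<in> {1..<length w}" "j = Suc i"
  obtains p x y z s where "w = p @ x # y # z # s" "i = Suc (length p)" "j = Suc (Suc (length p))"
proof -
  obtain p x y s where w: "w = p @ x # y # s" "i = Suc (length p)"
    using split_word_at[OF assms(1)] by blast
  obtain z s' where "s = z # s'" using w assms by (cases s) auto
  then show thesis using that[of p x y z s'] w assms(3) by simp
qed

lemma split_word_far:
  assumes "i \<in> {1..<length w}" "j \<in> {1..<length w}" "Suc i < j"
  obtains p x y r z t s where "w = p @ x # y # r @ z # t # s" "i = Suc (length p)" "j = length p + length r + 3"
proof -
  obtain p x y s where w: "w = p @ x # y # s" and i: "i = Suc (length p)"
    using split_word_at[OF assms(1)] by blast
  have "j - i - 1 \<in> {1..<length s}" using w i assms by auto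
  then obtain r z t s' where "s = r @ z # t # s'" "j - i - 1 = Suc (length r)"
    by (rule split_word_at)
  then show thesis using that[of p x y r z t s'] w i assms(3) by simp
qed

lemma gen_action_words:
  assumes "g \<in> bt_gens n" "w \<in> words n"
  shows "Poly_Mapping.keys (gen_action g (pure_tensor w)) \<subseteq> words n"
proof -
  obtain k where k: "g = TGen k \<or> g = EGen k" "k \<in> {1..<length w}"
    using assms by (auto simp: words_def)
  obtain p x y s where w: "w = p @ x # y # s" "k = Suc (length p)"
    using split_word_at[OF k(2)] by blast
  have "p @ y # x # s \<in> words n" using assms(2) w by (auto simp: words_def)
  then show ?thesis using k(1) assms(2) unfolding w(1)
    by (elim disjE) (simp_all add: T_action_single[OF w(2)] E_action_single[OF w(2)] keys_add_subset
      del: gen_action.simps)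
qed

section \<open>The operators satisfy the relations\<close>

lemmas action_single = T_action_single E_action_single T_action_single' E_action_single'
  T_action_single_far E_action_single_far gen_action_add

lemma far_action:
  assumes "i = Suc (length p)" "j = length p + length r + 3"
  shows "gen_action (TGen i) (gen_action (TGen j) (pure_tensor (p @ x # y # r @ z # t # s))) =
      gen_action (TGen j) (gen_action (TGen i) (pure_tensor (p @ x # y # r @ z # t # s)))"
    "gen_action (EGen i) (gen_action (TGen j) (pure_tensor (p @ x # y # r @ z # t # s))) =
      gen_action (TGen j) (gen_action (EGen i) (pure_tensor (p @ x # y # r @ z # t # s)))"
    "gen_action (TGen i) (gen_action (EGen j) (pure_tensor (p @ x # y # r @ z # t # s))) =
      gen_action (EGen j) (gen_action (TGen i) (pure_tensor (p @ x # y # r @ z # t # s)))"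
    "gen_action (EGen i) (gen_action (EGen j) (pure_tensor (p @ x # y # r @ z # t # s))) =
      gen_action (EGen j) (gen_action (EGen i) (pure_tensor (p @ x # y # r @ z # t # s)))"
  by (simp_all add: assms action_single add_ac mult_ac del: gen_action.simps)

lemma same_action:
  assumes "i = Suc (length p)"
  shows "gen_action (EGen i) (gen_action (EGen i) (pure_tensor (p @ x # y # s))) =
      gen_action (EGen i) (pure_tensor (p @ x # y # s))"
    "gen_action (EGen i) (gen_action (TGen i) (pure_tensor (p @ x # y # s))) =
      gen_action (TGen i) (gen_action (EGen i) (pure_tensor (p @ x # y # s)))"
  by (simp_all add: assms action_single E_stay_def del: gen_action.simps)

lemma quadratic_action:
  assumes "i = Suc (length p)"
  shows "gen_action (TGen i) (gen_action (TGen i) (pure_tensor (p @ x # y # s))) =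
      pure_tensor (p @ x # y # s) + scale_tensor (u_ratfun - 1)
        (gen_action (EGen i) (pure_tensor (p @ x # y # s) + gen_action (TGen i) (pure_tensor (p @ x # y # s))))"
    (is "?l = ?r")
proof -
  have "T_swap x y * T_swap y x + T_stay x y * T_stay x y = 1 + (u_ratfun - 1) * (E_stay x y + T_stay x y * E_stay x y)"
    by (auto simp: T_swap_def T_stay_def E_stay_def algebra_simps)
  moreover have "T_swap x y * T_stay y x + T_stay x y * T_swap x y = (u_ratfun - 1) * (T_swap x y * E_stay y x)"
    by (auto simp: T_swap_def T_stay_def E_stay_def algebra_simps)
  moreover have "?l = Poly_Mapping.single (p @ x # y # s) (T_swap x y * T_swap y x + T_stay x y * T_stay x y)
    + Poly_Mapping.single (p @ y # x # s) (T_swap x y * T_stay y x + T_stay x y * T_swap x y)"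
    by (simp add: assms action_single single_add add_ac del: gen_action.simps)
  moreover have "?r = Poly_Mapping.single (p @ x # y # s) (1 + (u_ratfun - 1) * (E_stay x y + T_stay x y * E_stay x y))
    + Poly_Mapping.single (p @ y # x # s) ((u_ratfun - 1) * (T_swap x y * E_stay y x))"
    by (simp add: assms action_single single_add add_ac distrib_left scale_tensor_add_right mult.assoc del: gen_action.simps)
  ultimately show ?thesis by simp
qed

lemma braid_action:
  assumes "i = Suc (length p)" "j = Suc (Suc (length p))"
  shows "gen_action (TGen i) (gen_action (TGen j) (gen_action (TGen i) (pure_tensor (p @ x # y # z # s)))) =
      gen_action (TGen j) (gen_action (TGen i) (gen_action (TGen j) (pure_tensor (p @ x # y # z # s))))"
    (is "?l = ?r")
proof -
  let ?a = T_swap and ?b = T_stay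
  let ?A = "?a x y * ?a x z * ?a y z" and ?B = "?a x y * ?a x z * ?b y z" and ?C = "?b x y * ?a y z * ?a x z"
  have l: "?l = Poly_Mapping.single (p @ z # y # x # s) ?A + Poly_Mapping.single (p @ y # z # x # s) ?B
    + Poly_Mapping.single (p @ z # x # y # s) ?C
    + Poly_Mapping.single (p @ y # x # z # s) (?a x y * ?b x z * ?b y x + ?b x y * ?b y z * ?a x y)
    + Poly_Mapping.single (p @ x # z # y # s) (?b x y * ?a y z * ?b x z)
    + Poly_Mapping.single (p @ x # y # z # s) (?a x y * ?b x z * ?a y x + ?b x y * ?b y z * ?b x y)"
    by (simp add: assms action_single single_add add_ac mult_ac del: gen_action.simps)
  have r: "?r = Poly_Mapping.single (p @ z # y # x # s) ?A + Poly_Mapping.single (p @ y # z # x # s) ?B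
    + Poly_Mapping.single (p @ z # x # y # s) ?C
    + Poly_Mapping.single (p @ y # x # z # s) (?b y z * ?a x y * ?b x z)
    + Poly_Mapping.single (p @ x # z # y # s) (?a y z * ?b x z * ?b z y + ?b y z * ?b x y * ?a y z)
    + Poly_Mapping.single (p @ x # y # z # s) (?a y z * ?b x z * ?a z y + ?b y z * ?b x y * ?b y z)"
    by (simp add: assms action_single single_add add_ac mult_ac del: gen_action.simps)
  \<comment> \<open>The six rearrangements of \<open>x, y, z\<close> are compared one by one. The coefficients of three of them
    agree literally; these are the other three.\<close>
  have 1: "?a x y * ?b x z * ?b y x + ?b x y * ?b y z * ?a x y = ?b y z * ?a x y * ?b x z"
    by (auto simp: T_swap_def T_stay_def algebra_simps)
  have 2: "?b x y * ?a y z * ?b x z = ?a y z * ?b x z * ?b z y + ?b y z * ?b x y * ?a y z"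
    by (auto simp: T_swap_def T_stay_def algebra_simps)
  have 3: "?a x y * ?b x z * ?a y x + ?b x y * ?b y z * ?b x y = ?a y z * ?b x z * ?a z y + ?b y z * ?b x y * ?b y z"
    by (auto simp: T_swap_def T_stay_def algebra_simps)
  show ?thesis unfolding l r 1 2 3 ..
qed

lemma tie_action:
  assumes "i = Suc (length p)" "j = Suc (Suc (length p))"
  shows
    "gen_action (EGen i) (gen_action (EGen j) (pure_tensor (p @ x # y # z # s))) =
      gen_action (EGen j) (gen_action (EGen i) (pure_tensor (p @ x # y # z # s)))"
    "gen_action (EGen j) (gen_action (TGen i) (gen_action (TGen j) (pure_tensor (p @ x # y # z # s)))) =
      gen_action (TGen i) (gen_action (TGen j) (gen_action (EGen i) (pure_tensor (p @ x # y # z # s))))"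
    "gen_action (EGen i) (gen_action (TGen j) (gen_action (TGen i) (pure_tensor (p @ x # y # z # s)))) =
      gen_action (TGen j) (gen_action (TGen i) (gen_action (EGen j) (pure_tensor (p @ x # y # z # s))))"
    "gen_action (EGen i) (gen_action (EGen j) (gen_action (TGen j) (pure_tensor (p @ x # y # z # s)))) =
      gen_action (EGen i) (gen_action (TGen j) (gen_action (EGen i) (pure_tensor (p @ x # y # z # s))))"
    "gen_action (EGen j) (gen_action (EGen i) (gen_action (TGen i) (pure_tensor (p @ x # y # z # s)))) =
      gen_action (EGen j) (gen_action (TGen i) (gen_action (EGen j) (pure_tensor (p @ x # y # z # s))))"
    "gen_action (EGen i) (gen_action (TGen j) (gen_action (EGen i) (pure_tensor (p @ x # y # z # s)))) =
      gen_action (TGen j) (gen_action (EGen i) (gen_action (EGen j) (pure_tensor (p @ x # y # z # s))))"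
    "gen_action (EGen j) (gen_action (TGen i) (gen_action (EGen j) (pure_tensor (p @ x # y # z # s)))) =
      gen_action (TGen i) (gen_action (EGen j) (gen_action (EGen i) (pure_tensor (p @ x # y # z # s))))"
  by (cases "snd x = snd y"; cases "snd y = snd z"; cases "snd x = snd z";
    simp add: assms action_single E_stay_def T_stay_def del: gen_action.simps)+

lemma far_action_word:
  assumes ij: "i \<in> {1..<length w}" "j \<in> {1..<length w}" and far: "far i j"
  shows
    "gen_action (TGen i) (gen_action (TGen j) (pure_tensor w)) =
      gen_action (TGen j) (gen_action (TGen i) (pure_tensor w))"
      (is ?P1)
    "gen_action (EGen i) (gen_action (TGen j) (pure_tensor w)) =
      gen_action (TGen j) (gen_action (EGen i) (pure_tensor w))"
      (is ?P2)
    "gen_action (EGen i) (gen_action (EGen j) (pure_tensor w)) =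
      gen_action (EGen j) (gen_action (EGen i) (pure_tensor w))"
      (is ?P3)
proof -
  consider "Suc i < j" | "Suc j < i" using far by (force simp: far_def)
  then have "?P1 \<and> ?P2 \<and> ?P3"
  proof cases
    case 1
    then obtain p x y r z t s where w: "w = p @ x # y # r @ z # t # s"
      and "i = Suc (length p)" "j = length p + length r + 3"
      using split_word_far[OF ij] by blast
    then show ?thesis unfolding w by (intro conjI far_action)
  next
    case 2
    then obtain p x y r z t s where w: "w = p @ x # y # r @ z # t # s"
      and "j = Suc (length p)" "i = length p + length r + 3"
      using split_word_far[OF ij(2,1)] by blast
    then show ?thesis unfolding w by (intro conjI far_action[symmetric])
  qed
  then show ?P1 ?P2 ?P3 by blast+
qed

lemma adjacent_action_word:
  assumes ij: "i \<in> {1..<length w}" "j \<in> {1..<length w}" and adj: "adjacent i j"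
  shows
    "gen_action (TGen i) (gen_action (TGen j) (gen_action (TGen i) (pure_tensor w))) =
      gen_action (TGen j) (gen_action (TGen i) (gen_action (TGen j) (pure_tensor w)))"
      (is ?P1)
    "gen_action (EGen i) (gen_action (EGen j) (pure_tensor w)) =
      gen_action (EGen j) (gen_action (EGen i) (pure_tensor w))"
      (is ?P2)
    "gen_action (EGen j) (gen_action (TGen i) (gen_action (TGen j) (pure_tensor w))) =
      gen_action (TGen i) (gen_action (TGen j) (gen_action (EGen i) (pure_tensor w)))"
      (is ?P3)
    "gen_action (EGen i) (gen_action (EGen j) (gen_action (TGen j) (pure_tensor w))) =
      gen_action (EGen i) (gen_action (TGen j) (gen_action (EGen i) (pure_tensor w)))"
      (is ?P4)
    "gen_action (EGen i) (gen_action (TGen j) (gen_action (EGen i) (pure_tensor w))) =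
      gen_action (TGen j) (gen_action (EGen i) (gen_action (EGen j) (pure_tensor w)))"
      (is ?P5)
proof -
  consider "j = Suc i" | "i = Suc j" using adj by (force simp: adjacent_def)
  then have "?P1 \<and> ?P2 \<and> ?P3 \<and> ?P4 \<and> ?P5"
  proof cases
    case 1
    then obtain p x y z s where w: "w = p @ x # y # z # s"
      and "i = Suc (length p)" "j = Suc (Suc (length p))"
      using split_word_at_two[OF ij] by blast
    then show ?thesis unfolding w by (intro conjI braid_action tie_action)
  next
    case 2
    then obtain p x y z s where w: "w = p @ x # y # z # s"
      and "j = Suc (length p)" "i = Suc (Suc (length p))"
      using split_word_at_two[OF ij(2,1)] by blast
    then show ?thesis unfolding w
      by (intro conjI braid_action[symmetric] tie_action tie_action(1)[symmetric])
  qed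
  then show ?P1 ?P2 ?P3 ?P4 ?P5 by blast+
qed

lemma same_action_word:
  assumes i: "i \<in> {1..<length w}"
  shows
    "gen_action (EGen i) (gen_action (EGen i) (pure_tensor w)) =
      gen_action (EGen i) (pure_tensor w)"
      (is ?P1)
    "gen_action (EGen i) (gen_action (TGen i) (pure_tensor w)) =
      gen_action (TGen i) (gen_action (EGen i) (pure_tensor w))"
      (is ?P2)
    "gen_action (TGen i) (gen_action (TGen i) (pure_tensor w)) =
      pure_tensor w + scale_tensor (u_ratfun - 1)
        (gen_action (EGen i) (pure_tensor w + gen_action (TGen i) (pure_tensor w)))"
      (is ?P3)
proof -
  obtain p x y s where w: "w = p @ x # y # s" and ip: "i = Suc (length p)"
    using split_word_at[OF i] by blast
  show ?P1 ?P2 ?P3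
    unfolding w by (rule same_action[OF ip] quadratic_action[OF ip])+
qed

section \<open>Tensor space is a module\<close>

lemma free_action_lift_sum:
  "free_action f x = lift_sum (\<lambda>w a. scale_tensor (laurent_to_ratfun a) (foldr gen_action w x)) f"
  by (simp add: free_action_def lift_sum_def)

lemma free_action_add: "free_action (f + g) x = free_action f x + free_action g x"
  unfolding free_action_lift_sum
  by (rule lift_sum_add) (simp_all add: laurent_to_ratfun_add scale_tensor_add_left)

lemma free_action_zero [simp]: "free_action 0 x = 0"
  by (simp add: free_action_def)

lemma free_action_single:
  "free_action (Poly_Mapping.single w a) x = scale_tensor (laurent_to_ratfun a) (foldr gen_action w x)"
  unfolding free_action_lift_sum by (rule lift_sum_single) simp

lemma tensor_linear_free_action: "tensor_linear (free_action f)"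
  unfolding free_action_def
  by (intro tensor_linear_sum tensor_linear_scale tensor_linear_word)

lemma free_action_mult:
  "free_action (f \<otimes>\<^bsub>bt_free_algebra n\<^esub> g) x = free_action f (free_action g x)"
proof -
  note lin = tensor_linearD[OF tensor_linear_free_action]
  have single: "free_action (Poly_Mapping.single v a \<otimes>\<^bsub>bt_free_algebra n\<^esub> g) x =
    free_action (Poly_Mapping.single v a) (free_action g x)" for v a g
  proof -
    have "Poly_Mapping.keys g \<subseteq> UNIV" by simp
    then show ?thesis
      by (induction rule: poly_mapping_single_induct)
        (simp_all add: bt_free_distribs bt_free_single free_action_add free_action_single lin
          laurent_to_ratfun_mult scale_tensor_scale tensor_linearD[OF tensor_linear_word]
          scale_tensor_add_right mult.commute)
  qed
  have "Poly_Mapping.keys f \<subseteq> UNIV" by simp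
  then show ?thesis
    by (induction rule: poly_mapping_single_induct)
      (simp_all add: bt_free_distribs free_action_add single)
qed

context bt_setting
begin

abbreviation V where "V \<equiv> tensor_space n"

lemma carrier_V: "x \<in> carrier V \<longleftrightarrow> Poly_Mapping.keys x \<subseteq> words n"
  by (auto simp: tensor_space_def words_def)

lemma V_simps: "x \<oplus>\<^bsub>V\<^esub> y = x + y" "\<zero>\<^bsub>V\<^esub> = 0" "t \<odot>\<^bsub>V\<^esub> x = bt_action t x"
  by (simp_all add: tensor_space_def)

lemma V_closed: "0 \<in> carrier V" "x \<in> carrier V \<Longrightarrow> y \<in> carrier V \<Longrightarrow> x + y \<in> carrier V"
  "x \<in> carrier V \<Longrightarrow> scale_tensor c x \<in> carrier V"
  using keys_scale_tensor by (auto simp: carrier_V keys_add_subset simp del: subset_eq)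

lemma V_abelian_group: "abelian_group V"
proof (rule abelian_groupI)
  fix x assume "x \<in> carrier V"
  then have "- x \<in> carrier V" by (auto simp: carrier_V in_keys_iff)
  then show "\<exists>y\<in>carrier V. y \<oplus>\<^bsub>V\<^esub> x = \<zero>\<^bsub>V\<^esub>"
    by (intro bexI[of _ "- x"]) (simp_all add: V_simps)
qed (simp_all add: V_simps V_closed add_ac)

lemma word_action_closed:
  assumes "v \<in> lists (bt_gens n)" "x \<in> carrier V"
  shows "foldr gen_action v x \<in> carrier V"
  using assms(1)
proof (induction v)
  case (Cons g v)
  then have "foldr gen_action v x \<in> carrier V" by simp
  then show ?case
    using tensor_linear_keys[OF tensor_linear_gen_action, of _ "words n" g "words n"]
      gen_action_words[of g n] Cons(1) by (simp add: carrier_V del: gen_action.simps)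
qed (use assms in simp)

lemma free_action_closed:
  assumes "f \<in> carrier F" "x \<in> carrier V"
  shows "free_action f x \<in> carrier V"
proof -
  have "Poly_Mapping.keys f \<subseteq> lists (bt_gens n)" using assms(1) by (simp add: bt_free_carrier)
  then show ?thesis
    by (induction rule: poly_mapping_single_induct)
      (simp_all add: V_closed free_action_add free_action_single word_action_closed assms(2))
qed

lemma free_action_relation:
  assumes "bt_relation n f g" "x \<in> carrier V"
  shows "free_action f x = free_action g x"
proof (rule tensor_linear_eqI[OF tensor_linear_free_action tensor_linear_free_action, of _ "words n"])
  show "Poly_Mapping.keys x \<subseteq> words n" using assms(2) by (simp add: carrier_V)
  fix w assume "w \<in> words n"
  then have len: "length w = n" by (simp add: words_def)
  note simps = free_action_mult free_action_add free_action_single gen_action_add gen_action_scale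
  show "free_action f (pure_tensor w) = free_action g (pure_tensor w)"
    using assms(1)
  proof cases
    case (E1 i j)
    have ij: "i \<in> {1..<length w}" "j \<in> {1..<length w}" using E1 len by auto
    show ?thesis using far_action_word(1)[OF ij E1(5)] by (simp add: E1 simps del: gen_action.simps)
  next
    case (E2 i j)
    have ij: "i \<in> {1..<length w}" "j \<in> {1..<length w}" using E2 len by auto
    consider "i = j" | "far i j" | "adjacent i j" by (fastforce simp: far_def adjacent_def)
    then have "gen_action (EGen i) (gen_action (EGen j) (pure_tensor w)) =
      gen_action (EGen j) (gen_action (EGen i) (pure_tensor w))"
      by cases (simp, (rule far_action_word(3)[OF ij] adjacent_action_word(2)[OF ij], assumption)+)
    then show ?thesis by (simp add: E2 simps del: gen_action.simps)
  next
    case (E3 i j)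
    have ij: "i \<in> {1..<length w}" "j \<in> {1..<length w}" using E3 len by auto
    show ?thesis using far_action_word(2)[OF ij E3(5)] by (simp add: E3 simps del: gen_action.simps)
  next
    case (E4 i)
    have i: "i \<in> {1..<length w}" using E4 len by auto
    show ?thesis using same_action_word(1)[OF i] by (simp add: E4 simps del: gen_action.simps)
  next
    case (E5 i)
    have i: "i \<in> {1..<length w}" using E5 len by auto
    show ?thesis using same_action_word(2)[OF i] by (simp add: E5 simps del: gen_action.simps)
  next
    case (E6 i j)
    have ij: "i \<in> {1..<length w}" "j \<in> {1..<length w}" using E6 len by auto
    show ?thesis using adjacent_action_word(1)[OF ij E6(5)] by (simp add: E6 simps del: gen_action.simps)
  next
    case (E7 i j)
    have ij: "i \<in> {1..<length w}" "j \<in> {1..<length w}" using E7 len by auto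
    show ?thesis using adjacent_action_word(3)[OF ij E7(5)] by (simp add: E7 simps del: gen_action.simps)
  next
    case (E8a i j)
    have ij: "i \<in> {1..<length w}" "j \<in> {1..<length w}" using E8a len by auto
    show ?thesis using adjacent_action_word(4)[OF ij E8a(5)] by (simp add: E8a simps del: gen_action.simps)
  next
    case (E8b i j)
    have ij: "i \<in> {1..<length w}" "j \<in> {1..<length w}" using E8b len by auto
    show ?thesis using adjacent_action_word(5)[OF ij E8b(5)] by (simp add: E8b simps del: gen_action.simps)
  next
    case (E9 i)
    have i: "i \<in> {1..<length w}" using E9 len by auto
    show ?thesis using same_action_word(3)[OF i] by (simp add: E9 simps laurent_to_ratfun_minus laurent_to_ratfun_u del: gen_action.simps)
  qed
qed

end

text \<open>The actions are defined through the value on an arbitrary representative of a coset.\<close>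

lemma the_elem_image_eqI:
  assumes "y \<in> S" "\<And>z. z \<in> S \<Longrightarrow> h z = h y"
  shows "the_elem (h ` S) = h y"
proof -
  have "h ` S = {h y}" using assms by blast
  then show ?thesis by simp
qed

context bt_setting
begin

lemma free_action_minus: "free_action (f - g) x = free_action f x - free_action g x"
  using free_action_add[of "f - g" g x] by (simp only: diff_add_cancel eq_diff_eq)

text \<open>The elements of the free algebra that annihilate tensor space form an ideal, and the defining
  relations lie in it.\<close>

lemma free_action_ideal:
  assumes "h \<in> bt_ideal n" "x \<in> carrier V"
  shows "free_action h x = 0"
proof -
  let ?J = "{h \<in> carrier F. \<forall>x\<in>carrier V. free_action h x = 0}"
  have J: "h \<in> ?J \<longleftrightarrow> h \<in> carrier F \<and> (\<forall>x\<in>carrier V. free_action h x = 0)" for h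
    by simp
  have neg: "\<ominus>\<^bsub>F\<^esub> a = 0 - a" if "a \<in> carrier F" for a
    using F_minus[OF F.zero_closed that] F.a_inv_closed[OF that]
    by (simp only: a_minus_def bt_free_zero bt_free_add add_0_left)
  have "ideal ?J F"
  proof (rule idealI)
    show "ring F" by (rule F.ring_axioms)
    show "subgroup ?J (add_monoid F)"
    proof (rule F.add.subgroupI)
      have "0 \<in> ?J" using F.zero_closed by (simp add: bt_free_zero)
      then show "?J \<noteq> {}" by blast
    next
      fix a b assume "a \<in> ?J" "b \<in> ?J"
      then show "a \<oplus>\<^bsub>F\<^esub> b \<in> ?J" by (simp add: bt_free_add free_action_add)
    next
      fix a assume "a \<in> ?J"
      then show "\<ominus>\<^bsub>F\<^esub> a \<in> ?J"
        using F.a_inv_closed[of a] by (simp only: J neg free_action_minus free_action_zero diff_self) simp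
    qed blast
  next
    fix a x assume a: "a \<in> ?J" and x: "x \<in> carrier F"
    then show "x \<otimes>\<^bsub>F\<^esub> a \<in> ?J"
      by (simp add: free_action_mult tensor_linearD(3)[OF tensor_linear_free_action])
    show "a \<otimes>\<^bsub>F\<^esub> x \<in> ?J"
      using a x by (simp add: free_action_mult free_action_closed)
  qed
  moreover have "{x - y | x y. bt_relation n x y} \<subseteq> ?J"
    using bt_relators_closed free_action_relation by (auto simp: free_action_minus)
  ultimately have "bt_ideal n \<subseteq> ?J"
    unfolding bt_ideal_def by (rule F.genideal_minimal)
  then show ?thesis using assms by blast
qed

lemma bt_action_laurent_cl:
  assumes "f \<in> carrier F" "x \<in> carrier V"
  shows "bt_action_laurent (cl f) x = free_action f x"
proof -
  have "free_action g x = free_action f x" if g: "g \<in> cl f" for g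
  proof -
    obtain h where "h \<in> bt_ideal n" "g = h + f"
      using g by (auto simp: cl_def a_r_coset_def' bt_free_add)
    then show ?thesis using assms by (simp add: free_action_add free_action_ideal)
  qed
  moreover have "f \<in> cl f" unfolding cl_def by (rule I.a_rcos_self[OF assms(1)])
  ultimately show ?thesis unfolding bt_action_laurent_def by (rule the_elem_image_eqI[rotated])
qed

lemma bt_action_laurent_closed: "b \<in> carrier A \<Longrightarrow> x \<in> carrier V \<Longrightarrow> bt_action_laurent b x \<in> carrier V"
  by (auto simp: carrier_A bt_action_laurent_cl free_action_closed)

lemma bt_action_laurent_add:
  assumes "b \<in> carrier A" "b' \<in> carrier A" "x \<in> carrier V"
  shows "bt_action_laurent (b \<oplus>\<^bsub>A\<^esub> b') x = bt_action_laurent b x + bt_action_laurent b' x"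
proof -
  obtain f f' where f: "b = cl f" "f \<in> carrier F" "b' = cl f'" "f' \<in> carrier F"
    using assms(1,2) by (auto simp: carrier_A)
  have "b \<oplus>\<^bsub>A\<^esub> b' = cl (f + f')"
    using f cl.hom_add[of f f'] by (simp only: bt_free_add)
  then show ?thesis using f assms(3) by (simp only: bt_action_laurent_cl F_plus_closed free_action_add)
qed

lemma bt_action_laurent_mult:
  assumes "b \<in> carrier A" "b' \<in> carrier A" "x \<in> carrier V"
  shows "bt_action_laurent (b \<otimes>\<^bsub>A\<^esub> b') x = bt_action_laurent b (bt_action_laurent b' x)"
proof -
  obtain f f' where f: "b = cl f" "f \<in> carrier F" "b' = cl f'" "f' \<in> carrier F"
    using assms(1,2) by (auto simp: carrier_A)
  then have "b \<otimes>\<^bsub>A\<^esub> b' = cl (f \<otimes>\<^bsub>F\<^esub> f')" by simp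
  then show ?thesis
    using f assms(3) by (simp only: bt_action_laurent_cl F.m_closed free_action_mult free_action_closed)
qed

lemma bt_action_laurent_linear:
  assumes "b \<in> carrier A" "x \<in> carrier V"
  shows "y \<in> carrier V \<Longrightarrow> bt_action_laurent b (x + y) = bt_action_laurent b x + bt_action_laurent b y"
    "bt_action_laurent b (scale_tensor c x) = scale_tensor c (bt_action_laurent b x)"
    "bt_action_laurent b 0 = 0"
  using assms by (auto simp: carrier_A bt_action_laurent_cl V_closed tensor_linearD[OF tensor_linear_free_action])

lemma bt_action_laurent_scalar:
  assumes "b \<in> carrier A" "x \<in> carrier V"
  shows "bt_action_laurent (bt_scalar n a \<otimes>\<^bsub>A\<^esub> b) x =
    scale_tensor (laurent_to_ratfun a) (bt_action_laurent b x)"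
proof -
  have "bt_action_laurent (bt_scalar n a) y = scale_tensor (laurent_to_ratfun a) y"
    if "y \<in> carrier V" for y
    using that by (simp add: bt_scalar_cl bt_action_laurent_cl free_action_single)
  then show ?thesis using assms by (simp add: bt_action_laurent_mult bt_action_laurent_closed)
qed

text \<open>The sum that defines the action of a coset, for a given representative.\<close>

definition formal_action :: "(bt_free set \<times> ratfun \<Rightarrow>\<^sub>0 int) \<Rightarrow> tensor \<Rightarrow> tensor" where
  "formal_action g x = lift_sum (\<lambda>(b, c) m. scale_tensor (of_int m * c) (bt_action_laurent b x)) g"

lemma formal_action_add: "formal_action (g + h) x = formal_action g x + formal_action h x"
  unfolding formal_action_def
  by (rule lift_sum_add) (auto simp: distrib_right scale_tensor_add_left)

lemma formal_action_minus: "formal_action (g - h) x = formal_action g x - formal_action h x"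
  using formal_action_add[of "g - h" h x] by (simp only: diff_add_cancel eq_diff_eq)

lemma formal_action_zero [simp]: "formal_action 0 x = 0"
  by (simp add: formal_action_def)

lemma formal_action_frag_of: "formal_action (frag_of (b, c)) x = scale_tensor c (bt_action_laurent b x)"
  unfolding formal_action_def by (subst lift_sum_single) auto

lemma formal_action_relators:
  assumes "h \<in> tp.relators" "x \<in> carrier V"
  shows "formal_action h x = 0"
  using assms(1)
proof (rule tp.relators_minimal)
  fix h assume "h \<in> tp.rels"
  then show "formal_action h x = 0"
    using assms(2)
    by (induction rule: tensor_relations.induct)
      (simp_all add: formal_action_minus formal_action_frag_of bt_action_laurent_add
        bt_action_laurent_scalar scale_tensor_add_right scale_tensor_add_left scale_tensor_scale
        K_simps mult.commute)
qed (simp_all add: formal_action_minus)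

lemma bt_action_coset:
  assumes "g \<in> carrier tp.free" "x \<in> carrier V"
  shows "bt_action (tp.coset g) x = formal_action g x"
proof -
  have bt_action: "bt_action t x = the_elem ((\<lambda>g. formal_action g x) ` t)" for t
    unfolding bt_action_def formal_action_def lift_sum_def by (simp add: case_prod_unfold)
  have "formal_action k x = formal_action g x" if k: "k \<in> tp.coset g" for k
  proof -
    obtain h where "h \<in> tp.relators" "k = h + g"
      using k by (auto simp: tp.coset_def a_r_coset_def' add_monoid_ring)
    then show ?thesis using assms(2) by (simp add: formal_action_add formal_action_relators)
  qed
  moreover have "g \<in> tp.coset g" unfolding tp.coset_def by (rule tp.relators.a_rcos_self[OF assms(1)])
  ultimately show ?thesis unfolding bt_action by (rule the_elem_image_eqI[rotated])
qed

lemma bt_action_tens: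
  "b \<in> carrier A \<Longrightarrow> x \<in> carrier V \<Longrightarrow> bt_action (tp.tens b c) x = scale_tensor c (bt_action_laurent b x)"
  by (simp add: tp.tens_def bt_action_coset tp.single_closed K_simps formal_action_frag_of)

lemma bt_action_add:
  assumes "s \<in> carrier R" "t \<in> carrier R" "x \<in> carrier V"
  shows "bt_action (s \<oplus>\<^bsub>R\<^esub> t) x = bt_action s x + bt_action t x"
proof -
  obtain g h where "s = tp.coset g" "g \<in> carrier tp.free" "t = tp.coset h" "h \<in> carrier tp.free"
    using assms(1,2) unfolding R_eq tp.carrier_tensor_alg by blast
  then show ?thesis
    using assms(3) tp.free.a_closed[of g h] unfolding R_eq
    by (simp add: bt_action_coset formal_action_add add_monoid_ring flip: tp.coset.hom_add)
qed

lemma bt_action_zero: "x \<in> carrier V \<Longrightarrow> bt_action \<zero>\<^bsub>R\<^esub> x = 0"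
  using bt_action_add[of "\<zero>\<^bsub>R\<^esub>" "\<zero>\<^bsub>R\<^esub>" x] by simp

lemma bt_action_minus:
  assumes "s \<in> carrier R" "t \<in> carrier R" "x \<in> carrier V"
  shows "bt_action (s \<ominus>\<^bsub>R\<^esub> t) x = bt_action s x - bt_action t x"
proof -
  have "s \<ominus>\<^bsub>R\<^esub> t \<oplus>\<^bsub>R\<^esub> t = s" using assms by (simp add: a_minus_def R.a_assoc R.l_neg)
  then show ?thesis using bt_action_add[of "s \<ominus>\<^bsub>R\<^esub> t" t x] assms by simp
qed

lemma R_induct [consumes 1, case_names zero tens diff]:
  assumes "t \<in> carrier R" "P \<zero>\<^bsub>R\<^esub>" "\<And>b c. b \<in> carrier A \<Longrightarrow> P (tp.tens b c)"
    "\<And>s t. s \<in> carrier R \<Longrightarrow> t \<in> carrier R \<Longrightarrow> P s \<Longrightarrow> P t \<Longrightarrow> P (s \<ominus>\<^bsub>R\<^esub> t)"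
  shows "P t"
  using assms unfolding R_eq by (rule tp.tensor_alg_induct) auto

lemma tens_in_R [simp]: "b \<in> carrier A \<Longrightarrow> tp.tens b c \<in> carrier R"
  by (simp add: R_eq K_simps)

lemma V_minus_closed: "x \<in> carrier V \<Longrightarrow> y \<in> carrier V \<Longrightarrow> x - y \<in> carrier V"
  using V_closed(2)[of x "scale_tensor (-1) y"] V_closed(3)[of y "-1"]
    scale_tensor_add_left[of "-1" 1 y] by (simp add: eq_neg_iff_add_eq_0[symmetric])

lemma bt_action_closed: "t \<in> carrier R \<Longrightarrow> x \<in> carrier V \<Longrightarrow> bt_action t x \<in> carrier V"
  by (induction rule: R_induct)
    (simp_all add: bt_action_zero bt_action_tens bt_action_minus V_closed V_minus_closed bt_action_laurent_closed)

lemma bt_action_linear: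
  assumes "t \<in> carrier R" "x \<in> carrier V"
  shows "y \<in> carrier V \<Longrightarrow> bt_action t (x + y) = bt_action t x + bt_action t y"
    and "bt_action t (scale_tensor c x) = scale_tensor c (bt_action t x)"
proof -
  show "bt_action t (x + y) = bt_action t x + bt_action t y" if "y \<in> carrier V"
    using assms(1)
    by (induction rule: R_induct)
      (simp_all add: bt_action_zero bt_action_tens bt_action_minus V_closed bt_action_laurent_linear
        scale_tensor_add_right assms that)
  show "bt_action t (scale_tensor c x) = scale_tensor c (bt_action t x)"
    using assms(1)
  proof (induction rule: R_induct)
    case (diff s t)
    then show ?case using assms(2) by (simp add: bt_action_minus V_closed scale_tensor_diff)
  qed (simp_all add: bt_action_zero bt_action_tens V_closed bt_action_laurent_linear
        scale_tensor_scale mult.commute assms)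
qed

lemma bt_action_zero_right: "t \<in> carrier R \<Longrightarrow> bt_action t 0 = 0"
  using bt_action_linear(2)[of t 0 0] V_closed by simp

lemma bt_action_mult:
  assumes s: "s \<in> carrier R" and t: "t \<in> carrier R" and x: "x \<in> carrier V"
  shows "bt_action (s \<otimes>\<^bsub>R\<^esub> t) x = bt_action s (bt_action t x)"
proof -
  have pure: "bt_action (tp.tens b c \<otimes>\<^bsub>R\<^esub> t) x = bt_action (tp.tens b c) (bt_action t x)"
    if b: "b \<in> carrier A" for b c
    using t
  proof (induction rule: R_induct)
    case zero
    then show ?case using b x by (simp add: bt_action_zero bt_action_zero_right)
  next
    case (tens b' c')
    then have "tp.tens b c \<otimes>\<^bsub>R\<^esub> tp.tens b' c' = tp.tens (b \<otimes>\<^bsub>A\<^esub> b') (c * c')"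
      using b by (simp add: R_eq tp.tens_mult K_simps)
    then show ?case using b x tens
      by (simp add: bt_action_tens bt_action_laurent_mult bt_action_laurent_closed V_closed
          bt_action_laurent_linear scale_tensor_scale)
  next
    case (diff s t)
    have "bt_action (tp.tens b c \<otimes>\<^bsub>R\<^esub> s) x = bt_action (tp.tens b c \<otimes>\<^bsub>R\<^esub> (s \<ominus>\<^bsub>R\<^esub> t) \<oplus>\<^bsub>R\<^esub> tp.tens b c \<otimes>\<^bsub>R\<^esub> t) x"
      using diff b by (simp add: a_minus_def R.a_assoc R.l_neg flip: R.r_distr)
    also have "\<dots> = bt_action (tp.tens b c \<otimes>\<^bsub>R\<^esub> (s \<ominus>\<^bsub>R\<^esub> t)) x + bt_action (tp.tens b c \<otimes>\<^bsub>R\<^esub> t) x"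
      using diff b x by (intro bt_action_add) auto
    finally have 1: "bt_action (tp.tens b c \<otimes>\<^bsub>R\<^esub> (s \<ominus>\<^bsub>R\<^esub> t)) x =
      bt_action (tp.tens b c) (bt_action s x) - bt_action (tp.tens b c) (bt_action t x)"
      using diff by simp
    have "bt_action (tp.tens b c) (bt_action s x) =
      bt_action (tp.tens b c) (bt_action (s \<ominus>\<^bsub>R\<^esub> t) x + bt_action t x)"
      using diff x by (simp add: bt_action_minus)
    also have "\<dots> = bt_action (tp.tens b c) (bt_action (s \<ominus>\<^bsub>R\<^esub> t) x) + bt_action (tp.tens b c) (bt_action t x)"
      using diff b x by (intro bt_action_linear) (auto intro: bt_action_closed)
    finally show ?case using 1 by simp
  qed
  show ?thesis
    using s
  proof (induction rule: R_induct)
    case zero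
    then show ?case using t x by (simp add: bt_action_zero bt_action_closed)
  next
    case (tens b c)
    then show ?case by (rule pure)
  next
    case (diff s s')
    have "(s \<ominus>\<^bsub>R\<^esub> s') \<otimes>\<^bsub>R\<^esub> t = s \<otimes>\<^bsub>R\<^esub> t \<ominus>\<^bsub>R\<^esub> s' \<otimes>\<^bsub>R\<^esub> t"
      using diff t by (simp add: a_minus_def R.l_distr R.l_minus)
    then show ?case using diff t x by (simp add: bt_action_minus bt_action_closed)
  qed
qed

lemma bt_action_scalar: "x \<in> carrier V \<Longrightarrow> bt_action (scalar c) x = scale_tensor c x"
proof -
  assume x: "x \<in> carrier V"
  have "\<one>\<^bsub>A\<^esub> = cl (bt_const 1)" using cl.hom_one by (simp add: bt_free_one)
  then have "bt_action_laurent \<one>\<^bsub>A\<^esub> x = x"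
    using x by (simp add: bt_action_laurent_cl free_action_single)
  then show ?thesis using x by (simp add: scalar_def bt_action_tens)
qed

lemma bt_action_class:
  "f \<in> carrier F \<Longrightarrow> x \<in> carrier V \<Longrightarrow> bt_action (bt_class f) x = free_action f x"
  by (simp add: bt_class_def bt_action_tens bt_action_laurent_cl)

lemma tensor_space_module: "left_module R V"
proof (intro left_module.intro left_module_axioms.intro module_axioms.intro)
  show "ring R" by (rule R.ring_axioms)
  show "abelian_group V" by (rule V_abelian_group)
  show "\<one>\<^bsub>R\<^esub> \<odot>\<^bsub>V\<^esub> x = x" if "x \<in> carrier V" for x
    using bt_action_scalar[OF that, of 1] by (simp add: V_simps scalar_one)
qed (simp_all add: V_simps bt_action_closed bt_action_add bt_action_linear bt_action_mult)

end

section \<open>Rearrangements of words\<close>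

definition swap_at :: "nat \<Rightarrow> 'a list \<Rightarrow> 'a list" where
  "swap_at k l = l[k - 1 := l ! k, k := l ! (k - 1)]"

lemma swap_at_append: "k = Suc (length p) \<Longrightarrow> swap_at k (p @ x # y # s) = p @ y # x # s"
  by (simp add: swap_at_def list_update_append nth_append)

lemma length_swap_at [simp]: "length (swap_at k l) = length l"
  by (simp add: swap_at_def)

abbreviation rearrange :: "nat list \<Rightarrow> 'a list \<Rightarrow> 'a list" where
  "rearrange \<equiv> foldr swap_at"

lemma length_rearrange [simp]: "length (rearrange w l) = length l"
  by (induction w) auto

lemma rearrange_descent:
  "k = Suc (length a) \<Longrightarrow> m = length a + length b \<Longrightarrow>
    rearrange [k..<Suc m] (a @ b @ z # s) = a @ z # b @ s"
proof (induction b arbitrary: a k)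
  case Nil
  then show ?case by simp
next
  case (Cons x b)
  have "rearrange [Suc k..<Suc m] ((a @ [x]) @ b @ z # s) = (a @ [x]) @ z # b @ s"
    using Cons.prems by (intro Cons.IH) auto
  moreover have "[k..<Suc m] = k # [Suc k..<Suc m]" using Cons.prems by (intro upt_conv_Cons) simp
  ultimately show ?case using Cons.prems swap_at_append[of k a x z "b @ s"] by (simp del: upt_Suc)
qed

lemma map_rearrange:
  assumes "set w \<subseteq> {1..<length l}"
  shows "map f (rearrange w l) = rearrange w (map f l)"
  using assms
proof (induction w)
  case (Cons k w)
  have "map f (swap_at k l') = swap_at k (map f l')" if "length l' = length l" for l' :: "'a list"
    using Cons.prems that by (auto simp: swap_at_def map_update)
  then show ?case using Cons by simp
qed simp

lemma normal_word_cases: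
  assumes "w \<in> normal_words (Suc m)"
  obtains k v where "w = [k..<Suc m] @ v" "k \<in> {1..Suc m}" "v \<in> normal_words m"
  using assms by auto

lemma normal_word_rearrange:
  assumes "w \<in> normal_words m" "m \<le> length l"
  obtains t where "rearrange w l = t @ drop m l" "mset t = mset (take m l)"
proof -
  have "\<exists>t. rearrange w l = t @ drop m l \<and> mset t = mset (take m l)"
    using assms
  proof (induction m arbitrary: w)
    case (Suc m)
    obtain k v where w: "w = [k..<Suc m] @ v" and k: "k \<in> {1..Suc m}" and v: "v \<in> normal_words m"
      using Suc.prems(1) by (rule normal_word_cases)
    obtain t where t: "rearrange v l = t @ drop m l" "mset t = mset (take m l)"
      using Suc.IH[OF v] Suc.prems by auto
    have len: "length t = m" using t(2) Suc.prems(2) by (metis length_take min.absorb2 mset_eq_length Suc_leD)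
    let ?a = "take (k - 1) t" and ?b = "drop (k - 1) t"
    have l: "drop m l = l ! m # drop (Suc m) l" using Suc.prems(2) by (simp add: Cons_nth_drop_Suc)
    have "rearrange v l = ?a @ ?b @ l ! m # drop (Suc m) l"
      unfolding t(1) l by (simp only: append_assoc[symmetric] append_take_drop_id)
    then have "rearrange w l = rearrange [k..<Suc m] (?a @ ?b @ l ! m # drop (Suc m) l)"
      by (simp only: w foldr_append o_apply)
    also have "\<dots> = ?a @ l ! m # ?b @ drop (Suc m) l"
      by (rule rearrange_descent) (use k len in auto)
    finally have "rearrange w l = ?a @ l ! m # ?b @ drop (Suc m) l" .
    moreover have "mset (?a @ l ! m # ?b) = mset (take (Suc m) l)"
    proof -
      have "mset (?a @ l ! m # ?b) = add_mset (l ! m) (mset (?a @ ?b))"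
        by (simp only: mset_append mset.simps union_mset_add_mset_right)
      also have "\<dots> = add_mset (l ! m) (mset (take m l))"
        by (simp only: append_take_drop_id t(2))
      also have "\<dots> = mset (take (Suc m) l)"
        using Suc.prems(2) by (simp add: take_Suc_conv_app_nth)
      finally show ?thesis .
    qed
    ultimately show ?case by (intro exI[of _ "?a @ l ! m # ?b"] conjI) (simp_all only: append.simps append_assoc)
  qed simp
  then show thesis using that by blast
qed

text \<open>The position of the letter \<open>l ! m\<close>, which the first factor \<open>[k..<Suc m]\<close> of the word puts in
  place, reveals \<open>k\<close>; without this letter the result of the remaining word is left.\<close>

lemma normal_word_rearrange_inj:
  assumes "distinct l" "m \<le> length l" "w \<in> normal_words m" "w' \<in> normal_words m"
    "rearrange w l = rearrange w' l"
  shows "w = w'"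
  using assms(2-5)
proof (induction m arbitrary: w w')
  case (Suc m)
  have split: "\<exists>k v a b. u = [k..<Suc m] @ v \<and> v \<in> normal_words m \<and> k = Suc (length a) \<and>
      rearrange v l = a @ b @ drop m l \<and> rearrange u l = a @ l ! m # b @ drop (Suc m) l \<and>
      length a + length b = m \<and> l ! m \<notin> set a \<and> l ! m \<notin> set b"
    if u: "u \<in> normal_words (Suc m)" for u
  proof -
    obtain k v where w: "u = [k..<Suc m] @ v" and k: "k \<in> {1..Suc m}" and v: "v \<in> normal_words m"
      using u by (rule normal_word_cases)
    have "m \<le> length l" using Suc.prems by simp
    with v obtain t where t: "rearrange v l = t @ drop m l" "mset t = mset (take m l)"
      by (rule normal_word_rearrange)
    have len: "length t = m" using t(2) Suc.prems(1) by (metis length_take min.absorb2 mset_eq_length Suc_leD)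
    have "l ! m \<notin> set (take m l)"
      using assms(1) Suc.prems(1) by (auto simp: in_set_conv_nth nth_eq_iff_index_eq)
    then have notin: "l ! m \<notin> set t" using t(2) mset_eq_setD by metis
    let ?a = "take (k - 1) t" and ?b = "drop (k - 1) t"
    have l: "drop m l = l ! m # drop (Suc m) l" using Suc.prems(1) by (simp add: Cons_nth_drop_Suc)
    have v': "rearrange v l = ?a @ ?b @ drop m l"
      unfolding t(1) by (simp only: append_assoc[symmetric] append_take_drop_id)
    then have "rearrange u l = rearrange [k..<Suc m] (?a @ ?b @ l ! m # drop (Suc m) l)"
      by (simp only: w l foldr_append o_apply)
    also have "\<dots> = ?a @ l ! m # ?b @ drop (Suc m) l"
      by (rule rearrange_descent) (use k len in auto)
    finally have u': "rearrange u l = ?a @ l ! m # ?b @ drop (Suc m) l" .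
    have "k = Suc (length ?a)" "length ?a + length ?b = m" "l ! m \<notin> set ?a" "l ! m \<notin> set ?b"
      using k len notin by (auto dest: in_set_takeD in_set_dropD)
    with w v v' u' show ?thesis by blast
  qed
  obtain k v a b where 1: "w = [k..<Suc m] @ v" "v \<in> normal_words m" "k = Suc (length a)"
    "rearrange v l = a @ b @ drop m l" "rearrange w l = a @ l ! m # b @ drop (Suc m) l"
    "length a + length b = m" "l ! m \<notin> set a" "l ! m \<notin> set b"
    using split[OF Suc.prems(2)] by blast
  obtain k' v' a' b' where 2: "w' = [k'..<Suc m] @ v'" "v' \<in> normal_words m" "k' = Suc (length a')"
    "rearrange v' l = a' @ b' @ drop m l" "rearrange w' l = a' @ l ! m # b' @ drop (Suc m) l"
    "length a' + length b' = m" "l ! m \<notin> set a'" "l ! m \<notin> set b'"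
    using split[OF Suc.prems(3)] by blast
  have "a @ l ! m # b = a' @ l ! m # b'"
    using 1(5,6) 2(5,6) Suc.prems(4) by simp
  then have "a = a'" "b = b'"
    using 1(7,8) by (simp_all add: append_Cons_eq_iff)
  then have "v = v'" using Suc.IH[of v v'] 1(2,4) 2(2,4) Suc.prems(1) by simp
  then show ?case using 1 2 \<open>a = a'\<close> by simp
qed simp

section \<open>Sums over subsets\<close>

text \<open>Only values at proper subsets of \<open>B\<close> occur in the sum besides \<open>c B\<close>; these vanish by induction.\<close>

lemma moebius_vanishing:
  fixes c :: "(nat \<times> nat) set \<Rightarrow> 'b::ab_group_add"
  assumes sum: "\<And>B. B \<in> S \<Longrightarrow> (\<Sum>A | A \<in> S \<and> A \<subseteq> B. c A) = 0"
    and fin: "\<And>B. B \<in> S \<Longrightarrow> finite B" and B: "B \<in> S" and S: "finite S"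
  shows "c B = 0"
  using B
proof (induction "card B" arbitrary: B rule: less_induct)
  case less
  have zero: "c A = 0" if "A \<in> S" "A \<subset> B" for A
    using less.hyps[of A] that psubset_card_mono[OF fin[OF less.prems]] by blast
  have "{A. A \<in> S \<and> A \<subseteq> B} = insert B {A. A \<in> S \<and> A \<subset> B}" using less.prems by blast
  then have "(\<Sum>A | A \<in> S \<and> A \<subseteq> B. c A) = c B + (\<Sum>A | A \<in> S \<and> A \<subset> B. c A)"
    using S by simp
  also have "\<dots> = c B" using zero by simp
  finally show ?case using sum[OF less.prems] by simp
qed

section \<open>The action of the spanning set\<close>

context bt_setting
begin

abbreviation T_act :: "nat \<Rightarrow> tensor \<Rightarrow> tensor" where "T_act k \<equiv> gen_action (TGen k)"
abbreviation E_act :: "nat \<Rightarrow> tensor \<Rightarrow> tensor" where "E_act k \<equiv> gen_action (EGen k)"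

lemma action_T: "k \<in> {1..<n} \<Longrightarrow> x \<in> carrier V \<Longrightarrow> bt_action (bt_class (bt_T k)) x = T_act k x"
  and action_E: "k \<in> {1..<n} \<Longrightarrow> x \<in> carrier V \<Longrightarrow> bt_action (bt_class (bt_E k)) x = E_act k x"
  by (simp_all add: bt_action_class free_action_single del: gen_action.simps)

lemma gen_act_closed: "g \<in> bt_gens n \<Longrightarrow> x \<in> carrier V \<Longrightarrow> gen_action g x \<in> carrier V"
  using word_action_closed[of "[g]" x] by simp

text \<open>Tensor space is graded by the word of upper indices. The operators \<open>T\<close> permute the homogeneous parts
  and the idempotents act on each of them by 0 or 1, so that the idempotents can be computed without
  knowledge of the lower indices.\<close>

definition upper_space :: "nat list \<Rightarrow> tensor set" where
  "upper_space J = {x. Poly_Mapping.keys x \<subseteq> {w \<in> words n. map snd w = J}}"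

lemma upper_space_carrier: "x \<in> upper_space J \<Longrightarrow> x \<in> carrier V"
  by (auto simp: upper_space_def carrier_V)

lemma upper_space_closed:
  "0 \<in> upper_space J" "x \<in> upper_space J \<Longrightarrow> y \<in> upper_space J \<Longrightarrow> x + y \<in> upper_space J"
  "x \<in> upper_space J \<Longrightarrow> scale_tensor c x \<in> upper_space J"
  using keys_scale_tensor[of c x]
  by (auto simp: upper_space_def keys_add_subset simp del: subset_eq)

lemma T_act_upper_space:
  assumes k: "k \<in> {1..<n}" and x: "x \<in> upper_space J"
  shows "T_act k x \<in> upper_space (swap_at k J)"
proof -
  have "Poly_Mapping.keys (T_act k (pure_tensor w)) \<subseteq> {w \<in> words n. map snd w = swap_at k J}"
    if w: "w \<in> {w \<in> words n. map snd w = J}" for w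
  proof -
    have "k \<in> {1..<length w}" using k w by (simp add: words_def)
    then obtain p y z s where ws: "w = p @ y # z # s" "k = Suc (length p)"
      by (rule split_word_at)
    have sw: "swap_at k J = map snd p @ snd z # snd y # map snd s"
      using w ws swap_at_append[of k "map snd p" "snd y" "snd z" "map snd s"] by auto
    have "p @ z # y # s \<in> words n" "p @ y # z # s \<in> words n"
      using w ws by (auto simp: words_def)
    then show ?thesis
      unfolding ws(1) T_action_single[OF ws(2)] sw
      by (intro keys_add_subset) (auto simp: T_stay_def)
  qed
  then show ?thesis
    using x tensor_linear_keys[OF tensor_linear_gen_action] unfolding upper_space_def by blast
qed

lemma E_act_upper_space:
  assumes k: "k \<in> {1..<n}" and x: "x \<in> upper_space J"
  shows "E_act k x = (if J ! (k - 1) = J ! k then x else 0)"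
proof -
  let ?c = "if J ! (k - 1) = J ! k then 1 else 0"
  have pure: "E_act k (pure_tensor w) = scale_tensor ?c (pure_tensor w)"
    if w: "w \<in> {w \<in> words n. map snd w = J}" for w
  proof -
    have "k \<in> {1..<length w}" using k w by (simp add: words_def)
    then obtain p y z s where ws: "w = p @ y # z # s" "k = Suc (length p)"
      by (rule split_word_at)
    have "J = map snd p @ snd y # snd z # map snd s" using w ws by auto
    then have "?c = E_stay y z" using ws(2) by (simp add: E_stay_def nth_append)
    then show ?thesis unfolding ws(1) E_action_single[OF ws(2)] by simp
  qed
  have "E_act k x = scale_tensor ?c x"
  proof (rule tensor_linear_eqI[OF tensor_linear_gen_action])
    show "tensor_linear (scale_tensor ?c)"
      using tensor_linear_scale[OF tensor_linear_id, of ?c] by simp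
    show "Poly_Mapping.keys x \<subseteq> {w \<in> words n. map snd w = J}"
      using x by (simp add: upper_space_def)
  qed (rule pure)
  then show ?thesis by simp
qed

text \<open>By its formula the inverse is \<open>T\<close> plus a multiple of \<open>E\<close> applied to \<open>x + T x\<close>. If the two upper
  indices in question agree, nothing is moved; if they differ, the second summand vanishes.\<close>

lemma T_inverse_upper_space:
  assumes k: "k \<in> {1..<n}" and x: "x \<in> upper_space J" and J: "length J = n"
  shows "bt_action (inv\<^bsub>R\<^esub> bt_class (bt_T k)) x \<in> upper_space (swap_at k J)"
proof -
  have x': "x \<in> carrier V" using x by (rule upper_space_carrier)
  have Tx: "T_act k x \<in> upper_space (swap_at k J)" using k x by (rule T_act_upper_space)
  have TxV: "T_act k x \<in> carrier V" using Tx by (rule upper_space_carrier)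
  have cl [simp]: "bt_class (bt_T k) \<in> carrier R" "bt_class (bt_E k) \<in> carrier R" using k by auto
  have "bt_action (bt.T_inverse k) x =
    T_act k x + scale_tensor (inverse u_ratfun - 1) (E_act k (x + T_act k x))"
    unfolding bt.T_inverse_def using k x' TxV gen_act_closed[of "EGen k"]
    by (simp add: bt_action_add bt_action_mult bt_action_scalar action_T action_E V_closed bt_action_closed
        bt_action_linear gen_action_add scale_tensor_add_right scalar_one[symmetric] del: gen_action.simps)
  moreover have "E_act k (x + T_act k x) \<in> upper_space (swap_at k J)"
  proof (cases "J ! (k - 1) = J ! k")
    case True
    then have "swap_at k J = J[k - 1 := J ! (k - 1), k := J ! k]" by (simp add: swap_at_def)
    then have "swap_at k J = J" by (simp only: list_update_id)
    then show ?thesis using Tx x E_act_upper_space[OF k, of "x + T_act k x" J] True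
      by (simp add: upper_space_closed del: gen_action.simps)
  next
    case False
    moreover have "swap_at k J ! (k - 1) = J ! k" "swap_at k J ! k = J ! (k - 1)"
      using k J by (auto simp: swap_at_def nth_list_update)
    ultimately show ?thesis
      using E_act_upper_space[OF k x] E_act_upper_space[OF k Tx]
      by (simp add: gen_action_add upper_space_closed del: gen_action.simps)
  qed
  ultimately show ?thesis using Tx k by (simp add: bt.inv_T upper_space_closed)
qed

lemma action_E_shift:
  assumes "1 \<le> i" "i + d + 1 \<le> n" "x \<in> upper_space J" "length J = n"
  shows "bt_action (bt.E_shift i d) x = (if J ! (i - 1) = J ! (i + d) then x else 0)"
  using assms
proof (induction d arbitrary: x J)
  case 0
  then show ?case
    using action_E[of i x] E_act_upper_space[of i x J] upper_space_carrier
    by (simp del: gen_action.simps)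
next
  case (Suc d)
  let ?k = "i + d + 1"
  let ?T = "bt_class (bt_T ?k)"
  let ?y = "bt_action (inv\<^bsub>R\<^esub> ?T) x"
  have k: "?k \<in> {1..<n}" using Suc.prems by simp
  have x: "x \<in> carrier V" using Suc.prems by (simp add: upper_space_carrier)
  have T: "?T \<in> Units R" using k by (rule bt.T_Units)
  have y: "?y \<in> upper_space (swap_at ?k J)" using T_inverse_upper_space k Suc.prems by blast
  then have yV: "?y \<in> carrier V" by (rule upper_space_carrier)
  have Ty: "bt_action ?T ?y = x"
    using T x by (simp add: bt_action_scalar R.Units_closed flip: bt_action_mult scalar_one)
  have swap: "swap_at ?k J ! (i - 1) = J ! (i - 1)" "swap_at ?k J ! (i + d) = J ! (i + Suc d)"
    using Suc.prems by (auto simp: swap_at_def nth_list_update)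
  have "bt_action (bt.E_shift i (Suc d)) x = bt_action ?T (bt_action (bt.E_shift i d) ?y)"
    using T x yV Suc.prems
    by (simp add: R.conjugate_def bt_action_mult bt_action_closed R.Units_closed)
  also have "bt_action (bt.E_shift i d) ?y = (if J ! (i - 1) = J ! (i + Suc d) then ?y else 0)"
    using Suc.IH[OF _ _ y] Suc.prems swap by simp
  finally show ?case using Ty T by (simp add: bt_action_zero_right R.Units_closed)
qed

lemma action_E_pair:
  assumes "i \<in> {1..n}" "j \<in> {1..n}" "x \<in> upper_space J" "length J = n"
  shows "bt_action (bt.E_pair i j) x = (if J ! (i - 1) = J ! (j - 1) then x else 0)"
proof -
  have one: "bt_action \<one>\<^bsub>R\<^esub> x = x"
    using bt_action_scalar[OF upper_space_carrier[OF assms(3)], of 1] by (simp add: scalar_one)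
  have less: "bt_action (bt.E_pair i j) x = (if J ! (i - 1) = J ! (j - 1) then x else 0)"
    if "i < j" "i \<in> {1..n}" "j \<in> {1..n}" for i j
    using that action_E_shift[of i "j - i - 1" x J] assms(3,4) by (simp add: bt.E_pair_less)
  show ?thesis
    using less[of i j] less[of j i] assms(1,2) one
    by (cases i j rule: linorder_cases) (auto simp: bt.E_pair_sym[of i j])
qed

lemma action_one: "x \<in> carrier V \<Longrightarrow> bt_action \<one>\<^bsub>R\<^esub> x = x"
  using bt_action_scalar[of x 1] by (simp add: scalar_one)

lemma action_E_prod:
  assumes "set ps \<subseteq> bt.pairs" "x \<in> upper_space J" "length J = n"
  shows "bt_action (bt.E_prod ps) x =
    (if \<forall>(i, j)\<in>set ps. J ! (i - 1) = J ! (j - 1) then x else 0)"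
  using assms(1)
proof (induction ps)
  case Nil
  then show ?case using assms(2) by (simp add: action_one upper_space_carrier)
next
  case (Cons p ps)
  obtain i j where p: "p = (i, j)" "i \<in> {1..n}" "j \<in> {1..n}" using Cons.prems by (cases p) auto
  have "bt_action (bt.E_prod (p # ps)) x = bt_action (bt.E_pair i j) (bt_action (bt.E_prod ps) x)"
    using Cons.prems p assms(2) by (simp add: bt_action_mult upper_space_carrier)
  then show ?case using Cons p assms
    by (auto simp: action_E_pair bt_action_zero_right)
qed

definition kernel :: "nat list \<Rightarrow> (nat \<times> nat) set" where
  "kernel J = {(i, j) \<in> bt.pairs. J ! (i - 1) = J ! (j - 1)}"

lemma action_E_rel:
  assumes "P \<in> bt.equivalences" "x \<in> upper_space J" "length J = n"
  shows "bt_action (bt.E_rel P) x = (if P \<subseteq> kernel J then x else 0)"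
proof -
  have P: "P \<subseteq> bt.pairs" using assms(1) by (rule bt.equivalences_pairs)
  obtain ps where ps: "set ps = P" "bt.E_rel P = bt.E_prod ps" using bt.E_rel_list[OF P] by blast
  have "(\<forall>(i, j)\<in>P. J ! (i - 1) = J ! (j - 1)) \<longleftrightarrow> P \<subseteq> kernel J"
    using P by (auto simp: kernel_def)
  then show ?thesis using action_E_prod[of ps x J] ps P assms by simp
qed

lemma action_T_word_append:
  assumes "set v \<subseteq> {1..<n}" "set w \<subseteq> {1..<n}" "x \<in> carrier V"
  shows "bt_action (bt.T_word (v @ w)) x = bt_action (bt.T_word v) (bt_action (bt.T_word w) x)"
  using assms bt.T_word_closed by (simp add: bt.T_word_append bt_action_mult)

lemma pure_closed: "w \<in> words n \<Longrightarrow> pure_tensor w \<in> carrier V"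
  by (simp add: carrier_V)

text \<open>The letter \<open>z\<close> travels to the left past letters with smaller lower index, and for such neighbours
  \<open>T\<close> is the exchange of the two factors, whatever their upper indices are.\<close>

lemma action_descent:
  assumes "a @ b @ z # s \<in> words n" "k = Suc (length a)" "m = length a + length b"
    "\<forall>x\<in>set b. fst x < fst z"
  shows "bt_action (bt.T_word [k..<Suc m]) (pure_tensor (a @ b @ z # s)) = pure_tensor (a @ z # b @ s)"
  using assms
proof (induction b arbitrary: a k)
  case Nil
  then show ?case by (simp add: action_one pure_closed)
next
  case (Cons x b)
  have len: "length a + length b + length s + 2 = n" using Cons.prems(1) by (simp add: words_def)
  have k: "k \<in> {1..<n}" and ks: "set [Suc k..<Suc m] \<subseteq> {1..<n}" using Cons.prems len by auto
  have V: "pure_tensor (a @ (x # b) @ z # s) \<in> carrier V" using Cons.prems(1) by (rule pure_closed)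
  have "a @ x # z # b @ s \<in> words n" using Cons.prems(1) by (auto simp: words_def)
  then have V': "pure_tensor (a @ x # z # b @ s) \<in> carrier V" by (rule pure_closed)
  have IH: "bt_action (bt.T_word [Suc k..<Suc m]) (pure_tensor ((a @ [x]) @ b @ z # s)) =
      pure_tensor ((a @ [x]) @ z # b @ s)"
    using Cons.prems by (intro Cons.IH) auto
  have "[k..<Suc m] = k # [Suc k..<Suc m]" using Cons.prems by (intro upt_conv_Cons) simp
  then have "bt_action (bt.T_word [k..<Suc m]) (pure_tensor (a @ (x # b) @ z # s)) =
      bt_action (bt_class (bt_T k)) (bt_action (bt.T_word [Suc k..<Suc m]) (pure_tensor (a @ (x # b) @ z # s)))"
    using k bt.T_word_closed[OF ks] V by (simp add: bt_action_mult del: upt_Suc)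
  also have "\<dots> = T_act k (pure_tensor (a @ x # z # b @ s))"
    using IH action_T[OF k V'] by (simp del: upt_Suc gen_action.simps)
  also have "\<dots> = pure_tensor (a @ z # (x # b) @ s)"
    unfolding T_action_single[OF Cons.prems(2)] using Cons.prems(4)
    by (simp add: T_swap_def T_stay_def)
  finally show ?case .
qed

lemma action_normal_word:
  assumes "w \<in> normal_words m" "m \<le> n" "l \<in> words n" "map fst l = [1..<Suc n]"
  shows "bt_action (bt.T_word w) (pure_tensor l) = pure_tensor (rearrange w l)"
  using assms(1,2)
proof (induction m arbitrary: w)
  case 0
  then show ?case using assms(3) by (simp add: action_one pure_closed)
next
  case (Suc m)
  have len: "length l = n" using assms(3) by (simp add: words_def)
  obtain k v where w: "w = [k..<Suc m] @ v" and k: "k \<in> {1..Suc m}" and v: "v \<in> normal_words m"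
    using Suc.prems(1) by (rule normal_word_cases)
  have "m \<le> length l" using Suc.prems len by simp
  with v obtain t where t: "rearrange v l = t @ drop m l" "mset t = mset (take m l)"
    by (rule normal_word_rearrange)
  have lt: "length t = m" using t(2) Suc.prems(2) len by (metis length_take min.absorb2 mset_eq_length Suc_leD)
  have st: "set t = set (take m l)" using t(2) by (rule mset_eq_setD)
  let ?a = "take (k - 1) t" and ?b = "drop (k - 1) t"
  have l: "drop m l = l ! m # drop (Suc m) l" using Suc.prems(2) len by (simp add: Cons_nth_drop_Suc)
  have fst_nth: "fst (l ! p) = Suc p" if "p < n" for p
    using that len assms(4) nth_map[of p l fst] by (simp del: upt_Suc)
  have small: "\<forall>x\<in>set ?b. fst x < fst (l ! m)"
  proof
    fix x assume "x \<in> set ?b"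
    then have "x \<in> set (take m l)" using st by (auto dest: in_set_dropD)
    then obtain p where "p < m" "x = l ! p" by (auto simp: in_set_conv_nth)
    then show "fst x < fst (l ! m)" using fst_nth Suc.prems(2) by simp
  qed
  have vl: "rearrange v l = ?a @ ?b @ l ! m # drop (Suc m) l"
    unfolding t(1) l by (simp only: append_assoc[symmetric] append_take_drop_id)
  have "set (rearrange v l) = set l" unfolding t(1) set_append st by (metis append_take_drop_id set_append)
  then have W: "rearrange v l \<in> words n" using assms(3) by (simp add: words_def)
  have sets: "set [k..<Suc m] \<subseteq> {1..<n}" "set v \<subseteq> {1..<n}"
    using k Suc.prems(2) normal_words_set[OF v] by auto
  have "bt_action (bt.T_word w) (pure_tensor l) =
      bt_action (bt.T_word [k..<Suc m]) (pure_tensor (rearrange v l))"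
    unfolding w using action_T_word_append[OF sets pure_closed[OF assms(3)]] Suc.IH[OF v] Suc.prems(2)
    by (simp del: upt_Suc)
  also have "\<dots> = pure_tensor (?a @ l ! m # ?b @ drop (Suc m) l)"
    unfolding vl using W[unfolded vl] k lt small by (intro action_descent) auto
  also have "?a @ l ! m # ?b @ drop (Suc m) l = rearrange [k..<Suc m] (rearrange v l)"
    unfolding vl by (rule rearrange_descent[symmetric]) (use k lt in auto)
  also have "\<dots> = rearrange w l" by (simp only: w foldr_append o_apply)
  finally show ?case .
qed


section \<open>Linear independence\<close>

text \<open>Label each strand by the least strand of its class.\<close>

lemma ex_word_with_kernel:
  assumes B: "B \<in> bt.equivalences"
  obtains L where "length L = n" "set L \<subseteq> {1..n}" "kernel L = B"
proof -
  have eq: "equiv {1..n} B" using B by (simp add: bt.equivalences_def)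
  define f where "f i = Min (B `` {i})" for i
  have cls: "B `` {i} \<subseteq> {1..n}" for i using bt.equivalences_pairs[OF B] by auto
  have fin: "finite (B `` {i})" for i using cls finite_subset by blast
  have self: "i \<in> B `` {i}" if "i \<in> {1..n}" for i
    using eq that by (rule equiv_class_self)
  have f_in: "f i \<in> B `` {i}" if "i \<in> {1..n}" for i
    unfolding f_def using fin self[OF that] by (intro Min_in) auto
  have f_iff: "f i = f j \<longleftrightarrow> (i, j) \<in> B" if "i \<in> {1..n}" "j \<in> {1..n}" for i j
  proof
    assume "f i = f j"
    then have "(i, f i) \<in> B" "(j, f i) \<in> B" using f_in[OF that(1)] f_in[OF that(2)] by auto
    then show "(i, j) \<in> B" using eq by (meson equivE symD transD)
  next
    assume "(i, j) \<in> B"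
    then show "f i = f j" unfolding f_def using equiv_class_eq[OF eq] by simp
  qed
  show thesis
  proof (rule that)
    show "length (map f [1..<Suc n]) = n" by simp
    show "set (map f [1..<Suc n]) \<subseteq> {1..n}" using f_in cls by fastforce
    have "map f [1..<Suc n] ! (i - 1) = f i" if "i \<in> {1..n}" for i
      using that by (subst nth_map) (auto simp del: upt_Suc)
    then show "kernel (map f [1..<Suc n]) = B"
      using f_iff bt.equivalences_pairs[OF B] unfolding kernel_def by (auto simp del: upt_Suc)
  qed
qed

lemma ex_rearrange_eq:
  assumes "w \<in> normal_words n" "length L = n"
  obtains J where "length J = n" "set J \<subseteq> set L" "rearrange w J = L"
proof -
  let ?l = "[0..<n]"
  have "n \<le> length ?l" by simp
  with assms(1) obtain t where t: "rearrange w ?l = t @ drop n ?l" "mset t = mset (take n ?l)"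
    by (rule normal_word_rearrange)
  have r: "rearrange w ?l = t" using t(1) by simp
  have mt: "mset t = mset ?l" using t(2) by simp
  have d: "distinct t" using mt by (metis distinct_upt mset_eq_imp_distinct_iff)
  have lt: "length t = n" and st: "set t = {..<n}"
    using mset_eq_length[OF mt] mset_eq_setD[OF mt] by (auto simp: lessThan_atLeast0)
  have bij: "bij_betw ((!) t) {..<n} {..<n}"
    by (rule bij_betw_nth) (use d lt st in auto)
  define g where "g = the_inv_into {..<n} ((!) t)"
  \<comment> \<open>The letter that \<open>w\<close> moves to position \<open>p\<close> has to be \<open>L ! p\<close>.\<close>
  define f where "f = (\<lambda>i. L ! g i)"
  have g: "g (t ! p) = p" if "p < n" for p
    unfolding g_def using bij that by (intro the_inv_into_f_f) (auto simp: bij_betw_def)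
  have gn: "g i < n" if "i < n" for i
    using bij_betw_the_inv_into[OF bij] that unfolding g_def bij_betw_def by blast
  show thesis
  proof (rule that)
    show "length (map f ?l) = n" by simp
    show "set (map f ?l) \<subseteq> set L" using gn assms(2) by (auto simp: f_def)
    have "rearrange w (map f ?l) = map f t"
      using map_rearrange[of w ?l f] normal_words_set[OF assms(1)] unfolding r
      by (simp only: length_upt diff_zero)
    also have "\<dots> = L"
      using g lt assms(2) by (intro nth_equalityI) (auto simp: f_def)
    finally show "rearrange w (map f ?l) = L" .
  qed
qed

text \<open>The tensor \<open>l\<close> below has increasing lower indices and its upper indices are chosen such that \<open>w\<close>
  arranges them to a word with kernel \<open>B\<close>. The coefficient of the basis tensor \<open>rearrange w l\<close> then
  collects exactly the \<open>c (A, w)\<close> with \<open>A \<subseteq> B\<close>.\<close>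

lemma coefficients_vanish:
  assumes zero: "\<And>x. x \<in> carrier V \<Longrightarrow>
      (\<Sum>b\<in>bt.normal_forms. scale_tensor (c b) (bt_action (bt.normal_form b) x)) = 0"
    and b: "b \<in> bt.normal_forms"
  shows "c b = 0"
proof -
  obtain B w where bw: "b = (B, w)" "B \<in> bt.equivalences" "w \<in> normal_words n"
    using b by auto
  have "c (B, w) = 0"
  proof (rule moebius_vanishing[of bt.equivalences "\<lambda>A. c (A, w)"])
    fix B assume "B \<in> bt.equivalences"
    then obtain L where L: "length L = n" "set L \<subseteq> {1..n}" "kernel L = B"
      by (rule ex_word_with_kernel)
    obtain J where J: "length J = n" "set J \<subseteq> set L" "rearrange w J = L"
      using bw(3) L(1) by (rule ex_rearrange_eq)
    define l where "l = zip [1..<Suc n] J"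
    have l: "map fst l = [1..<Suc n]" "map snd l = J" "length l = n"
      using J(1) by (simp_all add: l_def del: upt_Suc)
    have lw: "l \<in> words n"
    proof -
      have "fst x \<in> {1..n} \<and> snd x \<in> {1..n}" if "x \<in> set l" for x
      proof -
        have "fst x \<in> set (map fst l)" "snd x \<in> set (map snd l)" using that by auto
        then show ?thesis using J(2) L(2) unfolding l(1,2) by auto
      qed
      then show ?thesis using l(3) by (auto simp: words_def)
    qed
    have dl: "distinct l" using l(1) by (metis distinct_map distinct_upt)
    have coefficient: "Poly_Mapping.lookup (scale_tensor (c (A, v)) (bt_action (bt.normal_form (A, v)) (pure_tensor l)))
        (rearrange w l) = (if v = w \<and> A \<subseteq> B then c (A, v) else 0)"
      if "A \<in> bt.equivalences" "v \<in> normal_words n" for A v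
    proof -
      have sv: "set v \<subseteq> {1..<n}" using that(2) by (rule normal_words_set)
      have "n \<le> length l" using l(3) by simp
      with that(2) obtain t' where "rearrange v l = t' @ drop n l" "mset t' = mset (take n l)"
        by (rule normal_word_rearrange)
      then obtain t where t: "rearrange v l = t" "mset t = mset l" using l(3) by simp
      have "rearrange v l \<in> words n"
        using lw t mset_eq_setD[OF t(2)] mset_eq_length[OF t(2)] by (simp add: words_def l(3))
      moreover have "map snd (rearrange v l) = rearrange v J"
        using map_rearrange[of v l snd] sv l by simp
      ultimately have "pure_tensor (rearrange v l) \<in> upper_space (rearrange v J)"
        by (simp add: upper_space_def)
      then have "bt_action (bt.normal_form (A, v)) (pure_tensor l) =
          (if A \<subseteq> kernel (rearrange v J) then pure_tensor (rearrange v l) else 0)"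
        using that lw l J(1) bt.E_rel_closed[OF that(1)] bt.T_word_closed[OF sv]
        by (simp add: bt.normal_form_def bt_action_mult pure_closed action_normal_word action_E_rel)
      moreover have "rearrange v l = rearrange w l \<longleftrightarrow> v = w"
        using normal_word_rearrange_inj[OF dl _ that(2) bw(3)] l(3) by auto
      ultimately show ?thesis
        using J(3) L(3) by (auto simp: lookup_scale_tensor lookup_single)
    qed
    have "0 = Poly_Mapping.lookup (\<Sum>b\<in>bt.normal_forms.
        scale_tensor (c b) (bt_action (bt.normal_form b) (pure_tensor l))) (rearrange w l)"
      using zero[OF pure_closed[OF lw]] by simp
    also have "\<dots> = (\<Sum>b\<in>bt.normal_forms. if snd b = w \<and> fst b \<subseteq> B then c b else 0)"
      unfolding lookup_sum
    proof (rule sum.cong[OF refl])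
      fix b assume "b \<in> bt.normal_forms"
      then show "Poly_Mapping.lookup (scale_tensor (c b) (bt_action (bt.normal_form b) (pure_tensor l)))
          (rearrange w l) = (if snd b = w \<and> fst b \<subseteq> B then c b else 0)"
        using coefficient[of "fst b" "snd b"] by (cases b) simp
    qed
    also have "\<dots> = (\<Sum>A\<in>bt.equivalences. \<Sum>v\<in>normal_words n. if v = w \<and> A \<subseteq> B then c (A, v) else 0)"
      unfolding sum.cartesian_product by (simp only: case_prod_unfold prod.collapse)
    also have "\<dots> = (\<Sum>A\<in>bt.equivalences. if A \<subseteq> B then c (A, w) else 0)"
    proof (rule sum.cong)
      fix A
      have "(\<Sum>v\<in>normal_words n. if v = w \<and> A \<subseteq> B then c (A, v) else 0) =
        (\<Sum>v\<in>normal_words n. if v = w then (if A \<subseteq> B then c (A, w) else 0) else 0)"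
        by (rule sum.cong) auto
      then show "(\<Sum>v\<in>normal_words n. if v = w \<and> A \<subseteq> B then c (A, v) else 0) =
        (if A \<subseteq> B then c (A, w) else 0)"
        using bw(3) finite_normal_words by simp
    qed simp
    also have "\<dots> = (\<Sum>A | A \<in> bt.equivalences \<and> A \<subseteq> B. c (A, w))"
      using bt.finite_equivalences by (simp add: sum.If_cases Int_def)
    finally show "(\<Sum>A | A \<in> bt.equivalences \<and> A \<subseteq> B. c (A, w)) = 0" by simp
  next
    show "finite A" if "A \<in> bt.equivalences" for A
      using bt.equivalences_pairs[OF that] by (rule finite_subset) simp
  qed (use bw bt.finite_equivalences in auto)
  then show ?thesis using bw by simp
qed

lemma action_finsum:
  assumes "finite S" "\<And>b. b \<in> S \<Longrightarrow> h b \<in> carrier R" "x \<in> carrier V"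
  shows "bt_action (\<Oplus>\<^bsub>R\<^esub>b\<in>S. h b) x = (\<Sum>b\<in>S. bt_action (h b) x)"
  using assms(1,2)
proof (induction S rule: finite_induct)
  case empty
  then show ?case using assms(3) by (simp add: bt_action_zero)
next
  case (insert b S)
  then show ?case using assms(3)
    by (subst R.finsum_insert) (auto simp: bt_action_add R.finsum_closed Pi_def)
qed

lemma tensor_space_faithful:
  assumes r: "r \<in> carrier R" and zero: "\<And>x. x \<in> carrier V \<Longrightarrow> bt_action r x = 0"
  shows "r = \<zero>\<^bsub>R\<^esub>"
proof -
  obtain c where c: "r = (\<Oplus>\<^bsub>R\<^esub>b\<in>bt.normal_forms. scalar (c b) \<otimes>\<^bsub>R\<^esub> bt.normal_form b)"
    using bt.span_normal_forms[OF carrier_R_in_span[OF r]] by blast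
  have "(\<Sum>b\<in>bt.normal_forms. scale_tensor (c b) (bt_action (bt.normal_form b) x)) = 0"
    if x: "x \<in> carrier V" for x
  proof -
    have "bt_action r x = (\<Sum>b\<in>bt.normal_forms. bt_action (scalar (c b) \<otimes>\<^bsub>R\<^esub> bt.normal_form b) x)"
      unfolding c using x bt.finite_normal_forms bt.normal_form_closed by (intro action_finsum) auto
    also have "\<dots> = (\<Sum>b\<in>bt.normal_forms. scale_tensor (c b) (bt_action (bt.normal_form b) x))"
      using x bt.normal_form_closed
      by (intro sum.cong) (auto simp: bt_action_mult bt_action_scalar bt_action_closed)
    finally show ?thesis using zero[OF x] by simp
  qed
  then have "c b = 0" if "b \<in> bt.normal_forms" for b using that by (rule coefficients_vanish)
  then show ?thesis
    unfolding c using bt.normal_form_closed by (intro R.add.finprod_one_eqI) (simp add: bt.sc_zero)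
qed

end

theorem corollary4:
  fixes n :: nat
  assumes "n \<ge> 1"
  shows "faithful_left_module (bt_algebra n) (tensor_space n)"
proof -
  interpret bt_setting n .
  show ?thesis
    by (intro faithful_left_module.intro faithful_left_module_axioms.intro tensor_space_module
        tensor_space_faithful) (simp_all add: V_simps)
qed

end
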